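(* Let $L_t$, $t\ge 0$, be a Lévy process whose Lévy measure $\Pi$ satisfies $\Pi(0,\infty)>0$, and assume $E\log(1+|L_1|)<\infty$. Let $\beta>0$, $x\in\mathbb{R}$, and let $X_t$ be the Ornstein--Uhlenbeck process solving $$X_t = x-\beta\int_0^t X_s\,ds + L_t,\quad t\ge 0.$$ For $b>x$ let $\tau_b=\inf\{t>0: X_t\ge b\}$. Let $K=\sup\{u\ge 0: Ee^{uL_1}<\infty\}$ and assume $0<K<\infty$. Define $$\varphi(u)=\frac{1}{\beta}\int_0^u \frac{\log\left(Ee^{vL_1}\right)}{v}\,dv,\quad 0\le u<K,$$ and assume $\lim_{u\uparrow K}\varphi(u)=\infty$. Then $$\beta E(\tau_b)=E\int_0^K\left(e^{uX_{\tau_b}}-e^{ux}\right)e^{-\varphi(u)}u^{-1}\,du.$$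
   Context: The initial value $X_0=x$ is non-random. *)

theory Defs
  imports "HOL-Probability.Probability"
begin

definition left_lim :: "(real \<Rightarrow> real) \<Rightarrow> real \<Rightarrow> real" where
  "left_lim f s = Lim (at_left s) f"

definition cadlag :: "(real \<Rightarrow> real) \<Rightarrow> bool" where
  "cadlag f \<longleftrightarrow> (\<forall>t\<ge>0. continuous (at_right t) f) \<and>
                 (\<forall>t>0. \<exists>l. (f \<longlongrightarrow> l) (at_left t))"

definition levy_process :: "'a measure \<Rightarrow> (real \<Rightarrow> 'a \<Rightarrow> real) \<Rightarrow> bool" where
  "levy_process M L \<longleftrightarrow> prob_space M \<and>
     (\<forall>t\<ge>0. L t \<in> borel_measurable M) \<and>
     (\<forall>\<omega>\<in>space M. L 0 \<omega> = 0 \<and> cadlag (\<lambda>s. L s \<omega>)) \<and>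
     (\<forall>(n::nat) (tt::nat \<Rightarrow> real). tt 0 \<ge> 0 \<and> (\<forall>i<n. tt i < tt (Suc i)) \<longrightarrow>
        prob_space.indep_vars M (\<lambda>_. borel) (\<lambda>i \<omega>. L (tt (Suc i)) \<omega> - L (tt i) \<omega>) {..<n}) \<and>
     (\<forall>s\<ge>0. \<forall>t\<ge>0. distr M borel (\<lambda>\<omega>. L (s + t) \<omega> - L s \<omega>) = distr M borel (L t))"

text \<open>Levy measure of a set A (A bounded away from 0): the expected number of jumps
  of L during (0,1] whose size lies in A.\<close>
definition levy_measure :: "'a measure \<Rightarrow> (real \<Rightarrow> 'a \<Rightarrow> real) \<Rightarrow> real set \<Rightarrow> ennreal" where
  "levy_measure M L A = (\<integral>\<^sup>+ \<omega>.
      (let J = {s \<in> {0<..1}. L s \<omega> \<noteq> left_lim (\<lambda>r. L r \<omega>) s \<and>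
                             L s \<omega> - left_lim (\<lambda>r. L r \<omega>) s \<in> A}
       in if finite J then of_nat (card J) else \<infinity>) \<partial>M)"

definition hit_time :: "(real \<Rightarrow> 'a \<Rightarrow> real) \<Rightarrow> real \<Rightarrow> 'a \<Rightarrow> ennreal" where
  "hit_time X b \<omega> = Inf {ennreal t | t. t > 0 \<and> X t \<omega> \<ge> b}"

definition ou_phi :: "'a measure \<Rightarrow> (real \<Rightarrow> 'a \<Rightarrow> real) \<Rightarrow> real \<Rightarrow> real \<Rightarrow> real" where
  "ou_phi M L \<beta> u = (1 / \<beta>) *
     (LINT v:{0..u}|lborel. ln (\<integral>\<omega>. exp (v * L 1 \<omega>) \<partial>M) / v)"

end

theory Submission
  imports Defs
begin

text \<open>
  Put \<open>e\<^sub>u(y) = exp (u y - \<phi>(u))\<close>. Over a time step \<open>h\<close> the process satisfies \<open>X \<mapsto> r X + \<xi>\<close> with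
  \<open>r = exp (-\<beta> h)\<close> and \<open>\<xi>\<close> independent of the past, \<open>E exp (u \<xi>) = exp (\<phi>(u) - \<phi>(r u))\<close>; hence the
  transition operator maps \<open>e\<^sub>u\<close> to \<open>e\<^bsub>r u\<^esub>\<close>. Averaging Dynkin's formula for \<open>e\<^sub>u\<close> over \<open>u\<close> with respect
  to \<open>du / u\<close>, which is invariant under \<open>u \<mapsto> r u\<close>, leaves only two boundary terms per step: near
  \<open>u = 0\<close> the integral of \<open>du / u\<close> over \<open>(r \<epsilon>, \<epsilon>]\<close>, which is \<open>\<beta> h\<close>, and near \<open>u = K\<close> a term that vanishes
  because \<open>\<phi> \<rightarrow> \<infinity>\<close> and the process stays below \<open>b\<close> before it is stopped. Refining the grid gives
  \<open>E G(X\<^sub>s) = \<beta> E s\<close> for \<open>s\<close> the first passage time truncated at \<open>N\<close>, and \<open>N \<rightarrow> \<infinity>\<close> gives the theorem; the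
  negative part of \<open>G(X\<^sub>N)\<close> on \<open>{s = N}\<close> is dominated by a Wald argument.

  The hitting time itself need not be measurable. It is replaced by the time at which the running
  supremum reaches \<open>b\<close>; the two agree almost surely because \<open>X\<close> does not jump at the limit of the
  passage times of lower levels.
\<close>

section \<open>Convergence of exponential moments\<close>

text \<open>Two unbounded directions shape the proof. Upwards, the overshoot above \<open>b\<close>
  has no deterministic bound. All exponents stay strictly below \<open>K\<close>, so a slightly
  larger exponent \<open>u'\<close> is always at hand, and moments of order \<open>u'\<close> give
  the uniform integrability behind the limits along refining grids. Downwards, \<open>X\<close> need
  not have any moment; only its logarithmic size is controlled. Identities are therefore written
  between sums of nonnegative extended reals, with negative terms moved to the other side, and a
  finite common part is cancelled only at the end. The negative part of \<open>G\<close> is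
  majorised by a subadditive function of logarithmic growth, to which the innovations can be fed one
  by one. The logarithmic moment of \<open>L 1\<close> enters through \<open>\<phi>\<close>: it
  makes \<open>psi v / v\<close> integrable at 0, so \<open>\<phi>(u) \<rightarrow> 0\<close> as
  \<open>u \<rightarrow> 0\<close>, and this is why the boundary term at 0 counts time with factor
  exactly \<open>\<beta>\<close>. No stochastic calculus is used. The equation is solved path by
  path, and the integral of \<open>exp (\<beta> * s)\<close> against \<open>L\<close> appears only
  as a limit of dyadic Riemann sums.\<close>

lemma exp_mult_le_one_plus:
  fixes u u' y :: real
  assumes "0 \<le> u" "u \<le> u'"
  shows "exp (u * y) \<le> 1 + exp (u' * y)"
proof (cases "y \<ge> 0")
  case True
  then have "exp (u * y) \<le> exp (u' * y)" using assms by (simp add: mult_right_mono)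
  then show ?thesis by linarith
next
  case False
  then have "exp (u * y) \<le> 1" using assms by (simp add: mult_le_0_iff)
  moreover have "0 \<le> exp (u' * y)" by simp
  ultimately show ?thesis by linarith
qed

text \<open>Growth of order \<open>u\<close> together with moments of order \<open>u' > u\<close>
  bounded in \<open>n\<close> gives uniform integrability, so almost sure convergence passes to
  expectations. The bounding variables \<open>Y n\<close> vary with \<open>n\<close> and need not
  converge, and no single dominating function is assumed.\<close>

lemma (in prob_space) exp_moment_convergence:
  fixes f Y :: "nat \<Rightarrow> 'a \<Rightarrow> real" and g :: "'a \<Rightarrow> real"
  assumes [measurable]: "\<And>n. f n \<in> borel_measurable M" "\<And>n. Y n \<in> borel_measurable M"
      "g \<in> borel_measurable M"
    and lim: "AE \<omega> in M. (\<lambda>n. f n \<omega>) \<longlonglongrightarrow> g \<omega>"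
    and u: "0 < u" "u < u'" and c: "0 \<le> c" "0 \<le> C"
    and bd: "\<And>n \<omega>. \<omega> \<in> space M \<Longrightarrow> \<bar>f n \<omega>\<bar> \<le> c * (1 + exp (u * Y n \<omega>))"
    and mom: "\<And>n. (\<integral>\<^sup>+\<omega>. ennreal (exp (u' * Y n \<omega>)) \<partial>M) \<le> ennreal C"
  shows "\<And>n. integrable M (f n)" "integrable M g" "(\<lambda>n. expectation (f n)) \<longlonglongrightarrow> expectation g"
proof -
  have ei: "integrable M (\<lambda>\<omega>. exp (u' * Y n \<omega>))" for n
    by (rule integrableI_nonneg) (auto intro!: le_less_trans[OF mom] simp: ennreal_less_top)
  have eC: "expectation (\<lambda>\<omega>. exp (u' * Y n \<omega>)) \<le> C" for n
    using mom[of n] nn_integral_eq_integral[OF ei[of n]] c(2) by simp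
  have exp_le: "exp (u * y) \<le> 1 + exp (u' * y)" for y :: real
    using u by (intro exp_mult_le_one_plus) auto
  have bd2: "\<bar>f n \<omega>\<bar> \<le> c * (2 + exp (u' * Y n \<omega>))" if "\<omega> \<in> space M" for n \<omega>
  proof -
    have "c * (1 + exp (u * Y n \<omega>)) \<le> c * (2 + exp (u' * Y n \<omega>))"
      using exp_le[of "Y n \<omega>"] c by (intro mult_left_mono) auto
    then show ?thesis using bd[OF that, of n] by linarith
  qed
  show fi: "integrable M (f n)" for n
    by (rule Bochner_Integration.integrable_bound[where f="\<lambda>\<omega>. c * (2 + exp (u' * Y n \<omega>))"])
       (use bd2 ei[of n] c in \<open>auto simp: abs_of_nonneg\<close>)
  have fC: "(\<integral>\<^sup>+\<omega>. ennreal \<bar>f n \<omega>\<bar> \<partial>M) \<le> ennreal (c * (2 + C))" for n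
  proof -
    have "(\<integral>\<^sup>+\<omega>. ennreal \<bar>f n \<omega>\<bar> \<partial>M) = ennreal (expectation (\<lambda>\<omega>. \<bar>f n \<omega>\<bar>))"
      by (rule nn_integral_eq_integral) (use fi in auto)
    also have "expectation (\<lambda>\<omega>. \<bar>f n \<omega>\<bar>) \<le> expectation (\<lambda>\<omega>. c * (2 + exp (u' * Y n \<omega>)))"
      by (rule integral_mono) (use fi ei bd2 in auto)
    also have "\<dots> = c * (2 + expectation (\<lambda>\<omega>. exp (u' * Y n \<omega>)))"
      using ei[of n] by (simp add: prob_space)
    also have "\<dots> \<le> c * (2 + C)" using eC[of n] c by (intro mult_left_mono) auto
    finally show ?thesis by (simp add: ennreal_leI)
  qed
  \<comment> \<open>Integrability of the limit comes from Fatou's lemma, as \<open>g\<close> is not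
    itself bounded by any \<open>Y n\<close>.\<close>
  show gi: "integrable M g"
  proof (rule integrableI_bounded)
    have "(\<integral>\<^sup>+\<omega>. ennreal (norm (g \<omega>)) \<partial>M) = (\<integral>\<^sup>+\<omega>. liminf (\<lambda>n. ennreal \<bar>f n \<omega>\<bar>) \<partial>M)"
    proof (rule nn_integral_cong_AE, use lim in eventually_elim)
      case (elim \<omega>)
      then have "(\<lambda>n. ennreal \<bar>f n \<omega>\<bar>) \<longlonglongrightarrow> ennreal \<bar>g \<omega>\<bar>"
        by (intro tendsto_ennrealI tendsto_rabs)
      then show ?case using lim_imp_Liminf[OF sequentially_bot] by force
    qed
    also have "\<dots> \<le> liminf (\<lambda>n. \<integral>\<^sup>+\<omega>. ennreal \<bar>f n \<omega>\<bar> \<partial>M)"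
      by (rule nn_integral_liminf) auto
    also have "\<dots> \<le> ennreal (c * (2 + C))"
      using fC by (intro Liminf_le) auto
    finally show "(\<integral>\<^sup>+\<omega>. ennreal (norm (g \<omega>)) \<partial>M) < \<infinity>"
      by (metis ennreal_less_top infinity_ennreal_def le_less_trans)
  qed auto
  \<comment> \<open>Truncation to \<open>[-B, B]\<close> reduces the claim to bounded convergence.
    The three errors, of \<open>g\<close>, of \<open>f n\<close> and between the truncated
    variables, take \<open>r/4\<close> each.\<close>
  define clip where "clip B y = max (- B) (min B y)" for B y :: real
  have [measurable]: "clip B \<in> borel_measurable borel" for B unfolding clip_def by measurable
  have clip_bd: "\<bar>clip B y\<bar> \<le> B" if "B \<ge> 0" for B y using that unfolding clip_def by auto
  have clip_le: "\<bar>clip B y\<bar> \<le> \<bar>y\<bar>" if "B \<ge> 0" for B y using that unfolding clip_def by auto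
  have clip_lim: "(\<lambda>B. clip (real B) y) \<longlonglongrightarrow> y" for y
  proof (rule tendsto_eventually)
    show "eventually (\<lambda>B. clip (real B) y = y) sequentially"
      using eventually_ge_at_top[of "nat \<lceil>\<bar>y\<bar>\<rceil>"]
    proof eventually_elim
      case (elim B)
      then have "\<bar>y\<bar> \<le> real B" by linarith
      then show ?case unfolding clip_def by auto
    qed
  qed
  have g_clip: "(\<lambda>B. expectation (\<lambda>\<omega>. clip (real B) (g \<omega>))) \<longlonglongrightarrow> expectation g"
    by (rule integral_dominated_convergence[where w="\<lambda>\<omega>. \<bar>g \<omega>\<bar>"])
       (use gi clip_lim clip_le in auto)
  have f_clip: "(\<lambda>n. expectation (\<lambda>\<omega>. clip (real B) (f n \<omega>))) \<longlonglongrightarrow> expectation (\<lambda>\<omega>. clip (real B) (g \<omega>))" for B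
  proof (rule integral_dominated_convergence[where w="\<lambda>\<omega>. real B"])
    show "AE \<omega> in M. (\<lambda>n. clip (real B) (f n \<omega>)) \<longlonglongrightarrow> clip (real B) (g \<omega>)"
      using lim unfolding clip_def
      by eventually_elim (intro tendsto_max tendsto_min tendsto_const)
  qed (use clip_bd in auto)
  show "(\<lambda>n. expectation (f n)) \<longlonglongrightarrow> expectation g"
  proof (rule LIMSEQ_I)
    fix r :: real assume r: "r > 0"
    have "((\<lambda>R. 2 * c * exp (- ((u' - u) * R)) * C) \<longlongrightarrow> 2 * c * 0 * C) at_top"
      using u by (intro tendsto_mult tendsto_const filterlim_compose[OF exp_at_bot]
          filterlim_compose[OF filterlim_uminus_at_bot_at_top] 
          filterlim_tendsto_pos_mult_at_top[OF tendsto_const] filterlim_ident) auto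
    then have "eventually (\<lambda>R. 2 * c * exp (- ((u' - u) * R)) * C < r/4) at_top"
      using r by (intro order_tendstoD) auto
    with eventually_ge_at_top[of 0] have "eventually (\<lambda>R. R \<ge> 0 \<and> 2 * c * exp (- ((u' - u) * R)) * C < r/4) at_top"
      by eventually_elim auto
    then obtain R where R: "R \<ge> 0" "2 * c * exp (- ((u' - u) * R)) * C < r/4"
      by (auto simp: eventually_at_top_linorder)
    have "eventually (\<lambda>B. \<bar>expectation (\<lambda>\<omega>. clip (real B) (g \<omega>)) - expectation g\<bar> < r/4 
        \<and> real B \<ge> c * (1 + exp (u * R))) sequentially"
      using tendstoD[OF g_clip, of "r/4"] r eventually_ge_at_top[of "nat \<lceil>c * (1 + exp (u * R))\<rceil>"]
      unfolding dist_real_def by (intro eventually_conj) (auto elim!: eventually_mono simp: nat_le_iff ceiling_le_iff)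
    then obtain B where B: "\<bar>expectation (\<lambda>\<omega>. clip (real B) (g \<omega>)) - expectation g\<bar> < r/4"
       "real B \<ge> c * (1 + exp (u * R))" by (auto simp: eventually_sequentially)
    \<comment> \<open>By the choice of \<open>B\<close>, \<open>\<bar>f n \<omega>\<bar> > B\<close>
      forces \<open>Y n \<omega> > R\<close>, and there \<open>exp (u * Y n \<omega>)\<close> is at
      most \<open>exp (- ((u' - u) * R))\<close> times \<open>exp (u' * Y n \<omega>)\<close>. The
      choice of \<open>R\<close> makes this small in expectation, uniformly in
      \<open>n\<close>.\<close>
    have diff: "\<bar>expectation (f n) - expectation (\<lambda>\<omega>. clip (real B) (f n \<omega>))\<bar> \<le> r/4" for n
    proof -
      have ci: "integrable M (\<lambda>\<omega>. clip (real B) (f n \<omega>))"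
        by (rule Bochner_Integration.integrable_bound[OF fi[of n]]) (use clip_le in auto)
      have pw: "\<bar>f n \<omega> - clip (real B) (f n \<omega>)\<bar> \<le> 2 * c * exp (- ((u' - u) * R)) * exp (u' * Y n \<omega>)" 
        if w: "\<omega> \<in> space M" for \<omega>
      proof (cases "\<bar>f n \<omega>\<bar> \<le> real B")
        case True
        then have "clip (real B) (f n \<omega>) = f n \<omega>" unfolding clip_def by auto
        then show ?thesis using c by simp
      next
        case False
        have "\<not> Y n \<omega> \<le> R"
        proof
          assume "Y n \<omega> \<le> R"
          then have "c * (1 + exp (u * Y n \<omega>)) \<le> c * (1 + exp (u * R))"
            using u c by (intro mult_left_mono) auto
          then show False using False bd[OF w, of n] B(2) by linarith
        qed
        then have Y: "Y n \<omega> > R" by simp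
        have "\<bar>f n \<omega> - clip (real B) (f n \<omega>)\<bar> \<le> \<bar>f n \<omega>\<bar>"
          unfolding clip_def by auto
        also have "\<dots> \<le> c * (1 + exp (u * Y n \<omega>))" by (rule bd[OF w])
        also have "\<dots> \<le> c * (2 * exp (u * Y n \<omega>))"
          using c R Y u by (intro mult_left_mono) auto
        also have "exp (u * Y n \<omega>) \<le> exp (- ((u' - u) * R)) * exp (u' * Y n \<omega>)"
        proof -
          have "(u' - u) * R \<le> (u' - u) * Y n \<omega>" using u Y by (intro mult_left_mono) auto
          then show ?thesis by (simp add: exp_add[symmetric] algebra_simps)
        qed
        finally show ?thesis using c by (simp add: mult.assoc mult_left_mono)
      qed
      have "\<bar>expectation (f n) - expectation (\<lambda>\<omega>. clip (real B) (f n \<omega>))\<bar> 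
          = \<bar>expectation (\<lambda>\<omega>. f n \<omega> - clip (real B) (f n \<omega>))\<bar>"
        using fi ci by simp
      also have "\<dots> \<le> expectation (\<lambda>\<omega>. \<bar>f n \<omega> - clip (real B) (f n \<omega>)\<bar>)" by (rule integral_abs_bound)
      also have "\<dots> \<le> expectation (\<lambda>\<omega>. 2 * c * exp (- ((u' - u) * R)) * exp (u' * Y n \<omega>))"
        by (rule integral_mono) (use fi ci ei pw in auto)
      also have "\<dots> = 2 * c * exp (- ((u' - u) * R)) * expectation (\<lambda>\<omega>. exp (u' * Y n \<omega>))" by simp
      also have "\<dots> \<le> 2 * c * exp (- ((u' - u) * R)) * C"
        using eC c by (intro mult_left_mono) auto
      finally show ?thesis using R by linarith
    qed
    obtain N where N: "\<And>n. n \<ge> N \<Longrightarrow> \<bar>expectation (\<lambda>\<omega>. clip (real B) (f n \<omega>)) - expectation (\<lambda>\<omega>. clip (real B) (g \<omega>))\<bar> < r/4"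
      using LIMSEQ_D[OF f_clip[of B], of "r/4"] r by auto
    show "\<exists>no. \<forall>n\<ge>no. norm (expectation (f n) - expectation g) < r"
    proof (intro exI allI impI)
      fix n assume "n \<ge> N"
      from N[OF this] diff[of n] B(1) r show "norm (expectation (f n) - expectation g) < r"
        unfolding real_norm_def by linarith
    qed
  qed
qed

text \<open>By the mean value theorem each increment of \<open>F\<close> is the cell length times
  \<open>g\<close> at an intermediate point, and uniform continuity of \<open>g\<close> lets the
  left end of the cell replace that point. Derivatives are required only in the open interval. The
  dyadic cells match the grids on which increments of \<open>L\<close> are taken.\<close>

lemma left_Riemann_sum_tendsto:
  fixes F g :: "real \<Rightarrow> real"
  assumes h: "h > 0" and g: "continuous_on {0..h} g"
    and F: "continuous_on {0..h} F" "\<And>r. 0 < r \<Longrightarrow> r < h \<Longrightarrow> (F has_real_derivative g r) (at r)"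
  shows "(\<lambda>n. \<Sum>l<(2::nat)^n. g (real l * h / 2^n) * (h / 2^n)) \<longlonglongrightarrow> F h - F 0"
proof (rule LIMSEQ_I)
  fix e :: real assume e: "e > 0"
  have "uniformly_continuous_on {0..h} g" using g by (intro compact_uniformly_continuous) auto
  then obtain d where d: "d > 0" "\<And>r r'. r \<in> {0..h} \<Longrightarrow> r' \<in> {0..h} \<Longrightarrow> \<bar>r' - r\<bar> < d \<Longrightarrow> \<bar>g r' - g r\<bar> < e / (2 * h)"
    unfolding uniformly_continuous_on_def dist_real_def
    using divide_pos_pos[OF e, of "2 * h"] h by auto
  have "(\<lambda>n. h / 2 ^ n) \<longlonglongrightarrow> 0"
    using tendsto_mult[OF tendsto_const[of h] LIMSEQ_power_zero[of "1/2::real"]] by (simp add: power_divide field_simps)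
  then have "eventually (\<lambda>n. h / 2^n < d) sequentially" using d(1) by (intro order_tendstoD)
  then obtain N where N: "\<And>n. n \<ge> N \<Longrightarrow> h / 2^n < d" by (auto simp: eventually_sequentially)
  show "\<exists>no. \<forall>n\<ge>no. norm ((\<Sum>l<(2::nat)^n. g (real l * h / 2^n) * (h / 2^n)) - (F h - F 0)) < e"
  proof (intro exI allI impI)
    fix n assume n: "n \<ge> N"
    define r where "r l = real l * h / 2^n" for l
    have step: "r (Suc l) - r l = h / 2^n" for l unfolding r_def by (simp add: field_simps)
    have r_le: "r l \<le> h" if "l \<le> 2^n" for l
    proof -
      have "real l \<le> 2^n" using that by (metis of_nat_le_iff of_nat_numeral of_nat_power)
      then show ?thesis unfolding r_def using h by (simp add: field_simps)
    qed
    have r_ge: "r l \<ge> 0" for l unfolding r_def using h by simp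
    have tele: "F h - F 0 = (\<Sum>l<(2::nat)^n. F (r (Suc l)) - F (r l))"
      by (subst sum_lessThan_telescope) (simp add: r_def)
    have each: "\<bar>g (r l) * (h / 2^n) - (F (r (Suc l)) - F (r l))\<bar> \<le> e / (2 * h) * (h / 2^n)" if l: "l < 2^n" for l
    proof -
      have lt: "r l < r (Suc l)" using step[of l] h by (smt (verit) divide_pos_pos zero_less_power)
      have le: "r (Suc l) \<le> h" using l by (intro r_le) auto
      have "continuous_on {r l..r (Suc l)} F" 
        by (rule continuous_on_subset[OF F(1)]) (use le r_ge[of l] in auto)
      from MVT[OF lt this] obtain D z where z: "z > r l" "z < r (Suc l)" "(F has_real_derivative D) (at z)"
          "F (r (Suc l)) - F (r l) = (r (Suc l) - r l) * D"
        using F(2) le r_ge[of l] by (auto simp: real_differentiable_def) (smt (verit))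
      have "D = g z" using z(1-3) F(2)[of z] le r_ge[of l] by (intro DERIV_unique[OF z(3)]) auto
      note z = z(1,2) z(4)[unfolded this]
      have "\<bar>g (r l) - g z\<bar> < e / (2 * h)"
        using z(1,2) le r_ge[of l] N[OF n] step[of l] by (intro d(2)) auto
      moreover have "g (r l) * (h / 2^n) - (F (r (Suc l)) - F (r l)) = (g (r l) - g z) * (h / 2^n)"
        unfolding z(3) step[of l] by (simp only: left_diff_distrib mult.commute)
      ultimately show ?thesis 
        using h mult_right_mono[OF less_imp_le[OF \<open>\<bar>g (r l) - g z\<bar> < e / (2 * h)\<close>], of "h / 2^n"]
        by (simp only: abs_mult) (simp del: times_divide_eq_right times_divide_eq_left)
    qed
    have "\<bar>(\<Sum>l<(2::nat)^n. g (r l) * (h / 2^n)) - (F h - F 0)\<bar> 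
        = \<bar>\<Sum>l<(2::nat)^n. g (r l) * (h / 2^n) - (F (r (Suc l)) - F (r l))\<bar>"
      unfolding tele by (simp add: sum_subtractf)
    also have "\<dots> \<le> (\<Sum>l<(2::nat)^n. e / (2 * h) * (h / 2^n))"
      by (rule order_trans[OF sum_abs sum_mono]) (use each in auto)
    also have "\<dots> = e / 2" using h by simp
    finally show "norm ((\<Sum>l<(2::nat)^n. g (real l * h / 2^n) * (h / 2^n)) - (F h - F 0)) < e"
      using e unfolding r_def by simp
  qed
qed

section \<open>The moment generating function and the function phi\<close>

definition dyadic :: "nat \<Rightarrow> nat \<Rightarrow> real" where "dyadic m k = real k / 2 ^ m"

lemma dyadic_nonneg [simp]: "0 \<le> dyadic m k" by (simp add: dyadic_def)
lemma dyadic_0 [simp]: "dyadic m 0 = 0" by (simp add: dyadic_def)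
lemma dyadic_Suc: "dyadic m (Suc k) = dyadic m k + 1 / 2 ^ m" by (simp add: dyadic_def field_simps)
lemma dyadic_le_iff [simp]: "dyadic m i \<le> dyadic m k \<longleftrightarrow> i \<le> k" by (simp add: dyadic_def divide_right_mono field_simps)
lemma dyadic_less_iff [simp]: "dyadic m i < dyadic m k \<longleftrightarrow> i < k" by (simp add: dyadic_def field_simps)
lemma dyadic_add: "dyadic (m + n) (k * 2 ^ n) = dyadic m k" by (simp add: dyadic_def power_add)

text \<open>Serves to dominate \<open>(E exp (v * L 1) - 1) / v\<close> near \<open>v = 0\<close>.
  For \<open>l \<ge> 0\<close> convexity of the exponential suffices. For \<open>l < 0\<close> the
  bound is \<open>1 - exp (- a) \<le> 2 * a / (1 + a)\<close>, a form chosen because its integral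
  over \<open>v\<close> is a logarithm of \<open>\<bar>l\<bar>\<close>, which the logarithmic moment
  controls.\<close>

lemma exp_minus_one_le:
  fixes l v u :: real
  assumes "0 < v" "v \<le> u"
  shows "\<bar>exp (v * l) - 1\<bar> / v \<le> exp (u * l) / u + 2 * \<bar>l\<bar> / (1 + v * \<bar>l\<bar>)"
proof (cases "l \<ge> 0")
  case True
  have "exp ((1 - v/u) *\<^sub>R 0 + (v/u) *\<^sub>R (u * l)) \<le> (1 - v/u) * exp 0 + (v/u) * exp (u * l)"
    by (rule convex_onD[OF exp_convex]) (use assms in auto)
  then have "exp (v * l) - 1 \<le> (v / u) * exp (u * l) - v / u" using assms by simp
  also have "\<dots> \<le> v * (exp (u * l) / u)" using assms by simp
  finally have "(exp (v * l) - 1) / v \<le> exp (u * l) / u"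
    using assms by (simp add: pos_divide_le_eq mult.commute)
  moreover have "0 \<le> 2 * \<bar>l\<bar> / (1 + v * \<bar>l\<bar>)" using assms by simp
  moreover have "\<bar>exp (v * l) - 1\<bar> = exp (v * l) - 1" using True assms by simp
  ultimately show ?thesis by simp
next
  case False
  define a where "a = v * \<bar>l\<bar>"
  have a: "a \<ge> 0" "v * l = - a" using False assms by (auto simp: a_def mult_le_0_iff)
  have "1 - exp (- a) \<le> 2 * a / (1 + a)"
  proof (cases "a \<le> 1")
    case True
    have "1 - exp (- a) \<le> a" using exp_ge_add_one_self[of "- a"] by linarith
    also have "a \<le> 2 * a / (1 + a)" using True a mult_left_mono[OF True, of a] by (simp add: pos_le_divide_eq algebra_simps)
    finally show ?thesis .
  next
    case False
    have "1 - exp (- a) \<le> 1" by simp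
    also have "1 \<le> 2 * a / (1 + a)" using False by (simp add: pos_le_divide_eq)
    finally show ?thesis .
  qed
  then have "(1 - exp (- a)) / v \<le> 2 * a / (1 + a) / v" using assms by (intro divide_right_mono) auto
  also have "\<dots> = 2 * \<bar>l\<bar> / (1 + v * \<bar>l\<bar>)" using assms by (simp add: a_def)
  finally have "(1 - exp (- a)) / v \<le> 2 * \<bar>l\<bar> / (1 + v * \<bar>l\<bar>)" .
  moreover have "\<bar>exp (v * l) - 1\<bar> = 1 - exp (- a)" using a by simp
  moreover have "0 \<le> exp (u * l) / u" using assms by simp
  ultimately show ?thesis by simp
qed

lemma nn_integral_ratio_ln:
  fixes a k :: real assumes "a \<ge> 0" "k > 0"
  shows "(\<integral>\<^sup>+v\<in>{0..k}. ennreal (2 * a / (1 + v * a)) \<partial>lborel) = ennreal (2 * ln (1 + k * a))"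
proof -
  have "(\<integral>\<^sup>+v. ennreal (2 * a / (1 + v * a)) * indicator {0..k} v \<partial>lborel) = ennreal (2 * ln (1 + k * a) - 2 * ln (1 + 0 * a))"
  proof (rule nn_integral_FTC_Icc[where f="\<lambda>v. 2 * a / (1 + v * a)" and F="\<lambda>v. 2 * ln (1 + v * a)"])
    fix v assume v: "v \<in> {0..k}"
    then have "0 < 1 + v * a" using assms by (simp add: add_pos_nonneg)
    then show "((\<lambda>v. 2 * ln (1 + v * a)) has_real_derivative 2 * a / (1 + v * a)) (at v)"
      by (auto intro!: derivative_eq_intros simp: divide_simps)
  qed (use assms in auto)
  then show ?thesis by simp
qed

lemma ln_abs_le: fixes m :: real assumes "\<bar>m - 1\<bar> \<le> 1/2" shows "\<bar>ln m\<bar> \<le> 2 * \<bar>m - 1\<bar>"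
proof (cases "m \<ge> 1")
  case True then show ?thesis using ln_le_minus_one[of m] by simp
next
  case False
  have m: "m > 0" "m \<ge> 1/2" using assms by linarith+
  have "- ln m = ln (1/m)" using m by (simp add: ln_div)
  also have "\<dots> \<le> 1/m - 1" using m by (intro ln_le_minus_one) auto
  also have "\<dots> = (1 - m) / m" using m by (simp add: field_simps)
  also have "\<dots> \<le> (1 - m) / (1/2)" using m False by (intro divide_left_mono) auto
  finally show ?thesis using False m by simp
qed

text \<open>The level \<open>b\<close> is not fixed here, since passages of levels below
  \<open>b\<close> are compared with that of \<open>b\<close>. Taking \<open>K\<close> real and
  embedding it into \<open>ereal\<close> states in particular that the supremum is finite. The
  equation for \<open>X\<close> holds path by path, with a Henstock-Kurzweil integral.\<close>

locale levy_ou =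
  fixes M :: "'a measure" and L X :: "real \<Rightarrow> 'a \<Rightarrow> real" and \<beta> x K :: real
  assumes levy: "levy_process M L"
    and logmom: "integrable M (\<lambda>\<omega>. ln (1 + \<bar>L 1 \<omega>\<bar>))"
    and beta_pos: "\<beta> > 0"
    and OU_int: "\<And>\<omega> t. \<omega> \<in> space M \<Longrightarrow> t \<ge> 0 \<Longrightarrow> (\<lambda>s. X s \<omega>) integrable_on {0..t}"
    and OU: "\<And>\<omega> t. \<omega> \<in> space M \<Longrightarrow> t \<ge> 0 \<Longrightarrow>
               X t \<omega> = x - \<beta> * integral {0..t} (\<lambda>s. X s \<omega>) + L t \<omega>"
    and K_def: "ereal K = Sup (ereal ` {u. 0 \<le> u \<and> integrable M (\<lambda>\<omega>. exp (u * L 1 \<omega>))})"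
    and K_pos: "K > 0"
    and phi_lim: "filterlim (ou_phi M L \<beta>) at_top (at_left K)"

sublocale levy_ou \<subseteq> prob_space M
  using levy by (simp add: levy_process_def)

context levy_ou
begin

lemma L_measurable: "0 \<le> t \<Longrightarrow> L t \<in> borel_measurable M"
  using levy by (simp add: levy_process_def)

lemma L_dyadic [measurable]: "L (dyadic m k) \<in> borel_measurable M" and L_1 [measurable]: "L 1 \<in> borel_measurable M"
  by (simp_all add: L_measurable)

lemma L_0: "\<omega> \<in> space M \<Longrightarrow> L 0 \<omega> = 0" and L_cadlag: "\<omega> \<in> space M \<Longrightarrow> cadlag (\<lambda>s. L s \<omega>)"
  using levy by (simp_all add: levy_process_def)

definition increment :: "nat \<Rightarrow> nat \<Rightarrow> 'a \<Rightarrow> real" where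
  "increment m i \<omega> = L (dyadic m (Suc i)) \<omega> - L (dyadic m i) \<omega>"

lemma increment_measurable [measurable]: "increment m i \<in> borel_measurable M"
  unfolding increment_def by measurable

lemma indep_increment: "indep_vars (\<lambda>_. borel) (increment m) {..<n}"
  using levy unfolding levy_process_def increment_def
  by (elim conjE allE[of _ n] allE[of _ "dyadic m"]) (simp add: fun_eq_iff)

lemma sum_increment: "\<omega> \<in> space M \<Longrightarrow> (\<Sum>i<k. increment m i \<omega>) = L (dyadic m k) \<omega>"
  unfolding increment_def by (subst sum_lessThan_telescope) (simp add: L_0)

lemma distr_increment: "distr M borel (increment m i) = distr M borel (L (1 / 2 ^ m))"
proof -
  have "distr M borel (\<lambda>\<omega>. L (s + t) \<omega> - L s \<omega>) = distr M borel (L t)" if "s \<ge> 0" "t \<ge> 0" for s t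
    using levy that unfolding levy_process_def by blast
  from this[of "dyadic m i" "1 / 2^m"] show ?thesis
    by (simp add: increment_def[abs_def] dyadic_Suc)
qed

section \<open>The cumulant function \<open>psi\<close> and its primitive \<open>phi\<close> with
  respect to dv / v\<close>

definition psi :: "real \<Rightarrow> real" where
  "psi u = ln (expectation (\<lambda>\<omega>. exp (u * L 1 \<omega>)))"

abbreviation phi :: "real \<Rightarrow> real" where "phi \<equiv> ou_phi M L \<beta>"

text \<open>The exponents with a finite moment form an interval, because a smaller exponent is
  dominated by 1 plus a larger one.\<close>

lemma exp_integrable: assumes "0 \<le> u" "u < K" shows "integrable M (\<lambda>\<omega>. exp (u * L 1 \<omega>))"
proof -
  have "ereal u < Sup (ereal ` {u. 0 \<le> u \<and> integrable M (\<lambda>\<omega>. exp (u * L 1 \<omega>))})"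
    using assms by (simp flip: K_def)
  then obtain u' where u': "u < u'" "integrable M (\<lambda>\<omega>. exp (u' * L 1 \<omega>))"
    unfolding less_Sup_iff by auto
  show ?thesis
    by (rule Bochner_Integration.integrable_bound[where f="\<lambda>\<omega>. 1 + exp (u' * L 1 \<omega>)"])
      (use u' assms exp_mult_le_one_plus[of u u'] in \<open>auto simp: abs_of_nonneg add_nonneg_nonneg\<close>)
qed

lemma exp_psi: assumes "0 \<le> u" "u < K" shows "expectation (\<lambda>\<omega>. exp (u * L 1 \<omega>)) = exp (psi u)"
proof -
  have "0 < expectation (\<lambda>\<omega>. exp (u * L 1 \<omega>))"
    by (rule expectation_greater[OF exp_integrable[OF assms]]) simp
  then show ?thesis by (simp add: psi_def)
qed

lemma psi_0 [simp]: "psi 0 = 0" by (simp add: psi_def prob_space)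

lemma psi_measurable [measurable]: "psi \<in> borel_measurable borel"
  unfolding psi_def by measurable

lemma mgf_continuous: "continuous_on {0..<K} (\<lambda>u. expectation (\<lambda>\<omega>. exp (u * L 1 \<omega>)))"
proof (rule continuous_on_sequentiallyI)
  fix v :: "nat \<Rightarrow> real" and a assume v: "\<forall>n. v n \<in> {0..<K}" "a \<in> {0..<K}" "v \<longlonglongrightarrow> a"
  define u where "u = (a + K) / 2"
  have u: "a < u" "u < K" "0 \<le> u" using v by (auto simp: u_def)
  obtain N where N: "\<And>n. n \<ge> N \<Longrightarrow> v n < u"
    using order_tendstoD(2)[OF v(3) u(1)] by (auto simp: eventually_sequentially)
  have "(\<lambda>n. expectation (\<lambda>\<omega>. exp (v (n + N) * L 1 \<omega>))) \<longlonglongrightarrow> expectation (\<lambda>\<omega>. exp (a * L 1 \<omega>))"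
  proof (rule integral_dominated_convergence[where w="\<lambda>\<omega>. 1 + exp (u * L 1 \<omega>)"])
    show "AE \<omega> in M. (\<lambda>n. exp (v (n + N) * L 1 \<omega>)) \<longlonglongrightarrow> exp (a * L 1 \<omega>)"
      using LIMSEQ_ignore_initial_segment[OF v(3), of N] by (intro AE_I2 tendsto_intros)
    show "AE \<omega> in M. norm (exp (v (n + N) * L 1 \<omega>)) \<le> 1 + exp (u * L 1 \<omega>)" for n
      using N[of "n + N"] v(1) exp_mult_le_one_plus[of "v (n + N)" u] by (intro AE_I2) (auto simp: less_imp_le)
  qed (use exp_integrable[of u] u in auto)
  then show "(\<lambda>n. expectation (\<lambda>\<omega>. exp (v n * L 1 \<omega>))) \<longlonglongrightarrow> expectation (\<lambda>\<omega>. exp (a * L 1 \<omega>))"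
    by (rule LIMSEQ_offset)
qed

lemma psi_continuous: "continuous_on {0..<K} psi"
  unfolding psi_def
  by (rule continuous_on_ln[OF mgf_continuous]) (auto simp: exp_psi)

text \<open>\<open>L 1\<close> is a sum of \<open>2 ^ m\<close> independent increments with one
  common law, so the moment of a single increment is the \<open>2 ^ m\<close>-th root of that of
  \<open>L 1\<close>. The nonnegative integral is used because finiteness of the short-time moment
  is part of the result.\<close>

lemma nn_exp_increment: assumes u: "0 \<le> u" "u < K"
  shows "(\<integral>\<^sup>+\<omega>. ennreal (exp (u * increment m i \<omega>)) \<partial>M) = ennreal (exp (psi u / 2 ^ m))"
proof -
  define I where "I = (\<integral>\<^sup>+y. ennreal (exp (u * y)) \<partial>distr M borel (L (1 / 2 ^ m)))"
  have I: "(\<integral>\<^sup>+\<omega>. ennreal (exp (u * increment m j \<omega>)) \<partial>M) = I" for j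
    unfolding I_def distr_increment[of m j, symmetric] by (subst nn_integral_distr) auto
  have "ennreal (exp (psi u)) = (\<integral>\<^sup>+\<omega>. ennreal (exp (u * L 1 \<omega>)) \<partial>M)"
    using nn_integral_eq_integral[OF exp_integrable[OF u]] exp_psi[OF u] by simp
  also have "\<dots> = (\<integral>\<^sup>+\<omega>. (\<Prod>j<2^m. ennreal (exp (u * increment m j \<omega>))) \<partial>M)"
  proof (rule nn_integral_cong)
    fix \<omega> assume "\<omega> \<in> space M"
    then have "L 1 \<omega> = (\<Sum>j<2^m. increment m j \<omega>)" by (simp add: sum_increment dyadic_def)
    then show "ennreal (exp (u * L 1 \<omega>)) = (\<Prod>j<2^m. ennreal (exp (u * increment m j \<omega>)))"
      by (simp add: prod_ennreal sum_distrib_left exp_sum)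
  qed
  also have "\<dots> = (\<Prod>j<(2::nat)^m. I)"
    by (subst indep_vars_nn_integral) (auto intro!: indep_vars_compose2[OF indep_increment] simp: I)
  finally have pw: "I ^ (2 ^ m) = ennreal (exp (psi u))" by simp
  \<comment> \<open>An infinite \<open>I\<close> would have an infinite power, but the power is the
    finite moment of \<open>L 1\<close>.\<close>
  then have "I \<noteq> top" by (metis ennreal_neq_top power_eq_top_ennreal power_eq_0_iff zero_neq_numeral)
  then obtain r where r: "I = ennreal r" "r \<ge> 0" by (cases I) auto
  have "r ^ (2 ^ m) = exp (psi u)" using pw r by (simp add: ennreal_power)
  also have "\<dots> = exp (psi u / 2 ^ m) ^ (2 ^ m)" by (simp flip: exp_of_nat_mult)
  finally have "r = exp (psi u / 2 ^ m)" using r(2) by (intro power_eq_imp_eq_base[of r "2^m"]) auto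
  then show ?thesis using I r by simp
qed

lemma exp_increment_integrable: "0 \<le> u \<Longrightarrow> u < K \<Longrightarrow> integrable M (\<lambda>\<omega>. exp (u * increment m i \<omega>))"
  by (rule integrableI_nonneg) (auto simp: nn_exp_increment)

text \<open>Near 0, \<open>\<bar>psi v\<bar>\<close> is at most twice
  \<open>\<bar>E exp (v * L 1) - 1\<bar>\<close>. The pointwise bound for
  \<open>(exp (v * l) - 1) / v\<close> is integrated over \<open>v\<close> first, by Tonelli, which
  leaves \<open>exp (k * L 1)\<close> and \<open>ln (1 + k * \<bar>L 1\<bar>)\<close>. The second of
  these is integrable by the logarithmic moment.\<close>

lemma psi_over_integrable_near_0: "\<exists>k. 0 < k \<and> k < K \<and> set_integrable lborel {0..k} (\<lambda>v. psi v / v)"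
proof -
  have "((\<lambda>u. expectation (\<lambda>\<omega>. exp (u * L 1 \<omega>))) \<longlongrightarrow> 1) (at 0 within {0..<K})"
    using mgf_continuous[unfolded continuous_on, rule_format, of 0] K_pos by (simp add: prob_space)
  from tendstoD[OF this, of "1/2"] obtain d where d: "d > 0"
    "\<And>v. v \<in> {0..<K} \<Longrightarrow> v \<noteq> 0 \<Longrightarrow> \<bar>v\<bar> < d \<Longrightarrow> \<bar>expectation (\<lambda>\<omega>. exp (v * L 1 \<omega>)) - 1\<bar> < 1/2"
    unfolding eventually_at by (auto simp: dist_real_def)
  \<comment> \<open>\<open>k < d\<close> keeps the moment generating function within 1/2 of 1, as
    the estimate of the logarithm requires; \<open>k < K\<close> makes \<open>exp (k * L 1)\<close>
    integrable; \<open>k \<le> 1\<close> gives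
    \<open>ln (1 + k * \<bar>y\<bar>) \<le> ln (1 + \<bar>y\<bar>)\<close>.\<close>
  define k where "k = min 1 (min (K/2) (d/2))"
  have k: "0 < k" "k < K" "k < d" "k \<le> 1" using K_pos d by (auto simp: k_def)
  define A where "A = expectation (\<lambda>\<omega>. exp (k * L 1 \<omega>)) / k"
  have A: "A \<ge> 0" using k by (simp add: A_def)
  have intk: "integrable M (\<lambda>\<omega>. exp (k * L 1 \<omega>) / k)" using exp_integrable[of k] k by simp
  have bnd: "ennreal \<bar>psi v / v\<bar> \<le> (\<integral>\<^sup>+\<omega>. 2 * (ennreal (exp (k * L 1 \<omega>) / k) + ennreal (2 * \<bar>L 1 \<omega>\<bar> / (1 + v * \<bar>L 1 \<omega>\<bar>))) \<partial>M)"
    if v: "v \<in> {0..k}" for v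
  proof (cases "v = 0")
    case False
    then have v0: "0 < v" "v \<le> k" using v by auto
    have ei: "integrable M (\<lambda>\<omega>. exp (v * L 1 \<omega>) - 1)" using exp_integrable[of v] v0 k by simp
    have "\<bar>psi v\<bar> \<le> 2 * \<bar>expectation (\<lambda>\<omega>. exp (v * L 1 \<omega>)) - 1\<bar>"
      unfolding psi_def using d(2)[of v] v0 k by (intro ln_abs_le) auto
    also have "expectation (\<lambda>\<omega>. exp (v * L 1 \<omega>)) - 1 = expectation (\<lambda>\<omega>. exp (v * L 1 \<omega>) - 1)"
      using exp_integrable[of v] v0 k by (simp add: prob_space)
    also have "\<bar>\<dots>\<bar> \<le> expectation (\<lambda>\<omega>. \<bar>exp (v * L 1 \<omega>) - 1\<bar>)" by (rule integral_abs_bound)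
    finally have "\<bar>psi v / v\<bar> \<le> 2 * expectation (\<lambda>\<omega>. \<bar>exp (v * L 1 \<omega>) - 1\<bar>) / v"
      using v0 by (simp add: divide_right_mono)
    also have "\<dots> = expectation (\<lambda>\<omega>. 2 * (\<bar>exp (v * L 1 \<omega>) - 1\<bar> / v))" by simp
    finally have "ennreal \<bar>psi v / v\<bar> \<le> ennreal (expectation (\<lambda>\<omega>. 2 * (\<bar>exp (v * L 1 \<omega>) - 1\<bar> / v)))"
      by (rule ennreal_leI)
    also have "\<dots> = (\<integral>\<^sup>+\<omega>. ennreal (2 * (\<bar>exp (v * L 1 \<omega>) - 1\<bar> / v)) \<partial>M)"
      using ei v0 by (intro nn_integral_eq_integral[symmetric]) auto
    also have "\<dots> \<le> (\<integral>\<^sup>+\<omega>. 2 * (ennreal (exp (k * L 1 \<omega>) / k) + ennreal (2 * \<bar>L 1 \<omega>\<bar> / (1 + v * \<bar>L 1 \<omega>\<bar>))) \<partial>M)"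
    proof (rule nn_integral_mono)
      fix \<omega>
      have "2 * (\<bar>exp (v * L 1 \<omega>) - 1\<bar> / v) \<le> 2 * (exp (k * L 1 \<omega>) / k + 2 * \<bar>L 1 \<omega>\<bar> / (1 + v * \<bar>L 1 \<omega>\<bar>))"
        using exp_minus_one_le[OF v0, of "L 1 \<omega>"] by simp
      from ennreal_leI[OF this] show "ennreal (2 * (\<bar>exp (v * L 1 \<omega>) - 1\<bar> / v)) \<le> 2 * (ennreal (exp (k * L 1 \<omega>) / k) + ennreal (2 * \<bar>L 1 \<omega>\<bar> / (1 + v * \<bar>L 1 \<omega>\<bar>)))"
        using k v0 by (subst (asm) ennreal_mult) (auto simp: ennreal_plus)
    qed
    finally show ?thesis .
  qed simp
  interpret P: pair_sigma_finite lborel M ..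
  define f where "f v \<omega> = ennreal (exp (k * L 1 \<omega>) / k) + ennreal (2 * \<bar>L 1 \<omega>\<bar> / (1 + v * \<bar>L 1 \<omega>\<bar>))" for v \<omega>
  have [measurable]: "(\<lambda>(v, \<omega>). f v \<omega>) \<in> borel_measurable (lborel \<Otimes>\<^sub>M M)" unfolding f_def by measurable
  have "(\<integral>\<^sup>+v\<in>{0..k}. ennreal \<bar>psi v / v\<bar> \<partial>lborel) \<le> (\<integral>\<^sup>+v. (\<integral>\<^sup>+\<omega>. 2 * f v \<omega> * indicator {0..k} v \<partial>M) \<partial>lborel)"
  proof (rule nn_integral_mono)
    fix v :: real
    show "ennreal \<bar>psi v / v\<bar> * indicator {0..k} v \<le> (\<integral>\<^sup>+\<omega>. 2 * f v \<omega> * indicator {0..k} v \<partial>M)"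
      using bnd[of v] by (cases "v \<in> {0..k}") (simp_all add: f_def)
  qed
  also have "\<dots> = (\<integral>\<^sup>+\<omega>. (\<integral>\<^sup>+v. 2 * f v \<omega> * indicator {0..k} v \<partial>lborel) \<partial>M)"
    by (rule P.Fubini'[symmetric]) measurable
  also have "\<dots> = (\<integral>\<^sup>+\<omega>. ennreal (2 * (exp (k * L 1 \<omega>) + 2 * ln (1 + k * \<bar>L 1 \<omega>\<bar>))) \<partial>M)"
  proof (rule nn_integral_cong)
    fix \<omega>
    have "(\<integral>\<^sup>+v. 2 * f v \<omega> * indicator {0..k} v \<partial>lborel) = 2 * (\<integral>\<^sup>+v. f v \<omega> * indicator {0..k} v \<partial>lborel)"
      unfolding mult.assoc f_def by (rule nn_integral_cmult) measurable
    also have "(\<integral>\<^sup>+v. f v \<omega> * indicator {0..k} v \<partial>lborel) = 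
       (\<integral>\<^sup>+v. ennreal (exp (k * L 1 \<omega>) / k) * indicator {0..k} v \<partial>lborel) + (\<integral>\<^sup>+v\<in>{0..k}. ennreal (2 * \<bar>L 1 \<omega>\<bar> / (1 + v * \<bar>L 1 \<omega>\<bar>)) \<partial>lborel)"
      unfolding f_def distrib_right by (rule nn_integral_add) measurable
    also have "\<dots> = ennreal (exp (k * L 1 \<omega>) / k) * ennreal k + ennreal (2 * ln (1 + k * \<bar>L 1 \<omega>\<bar>))"
      using k by (subst nn_integral_ratio_ln) (auto simp: nn_integral_cmult_indicator)
    also have "\<dots> = ennreal (exp (k * L 1 \<omega>) + 2 * ln (1 + k * \<bar>L 1 \<omega>\<bar>))"
      using k by (subst ennreal_mult[symmetric]) (auto simp: ennreal_plus)
    also have "2 * \<dots> = ennreal (2 * (exp (k * L 1 \<omega>) + 2 * ln (1 + k * \<bar>L 1 \<omega>\<bar>)))"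
      using k by (subst ennreal_mult) (auto simp: ennreal_plus)
    finally show "(\<integral>\<^sup>+v. 2 * f v \<omega> * indicator {0..k} v \<partial>lborel) = \<dots>" .
  qed
  also have "\<dots> < \<infinity>"
  proof -
    have "integrable M (\<lambda>\<omega>. ln (1 + k * \<bar>L 1 \<omega>\<bar>))"
    proof (rule Bochner_Integration.integrable_bound[OF logmom])
      have "ln (1 + k * \<bar>y\<bar>) \<le> ln (1 + \<bar>y\<bar>)" for y
        using k mult_right_mono[of k 1 "\<bar>y\<bar>"] by (intro ln_mono) (auto intro: add_pos_nonneg)
      then show "AE \<omega> in M. norm (ln (1 + k * \<bar>L 1 \<omega>\<bar>)) \<le> norm (ln (1 + \<bar>L 1 \<omega>\<bar>))" 
        using k by simp
    qed measurable
    then have "integrable M (\<lambda>\<omega>. 2 * (exp (k * L 1 \<omega>) + 2 * ln (1 + k * \<bar>L 1 \<omega>\<bar>)))"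
      using exp_integrable[of k] k by simp
    then show ?thesis by (subst nn_integral_eq_integral) (use k in auto)
  qed
  finally have fin: "(\<integral>\<^sup>+v\<in>{0..k}. ennreal \<bar>psi v / v\<bar> \<partial>lborel) < \<infinity>" .
  have "(\<integral>\<^sup>+v. ennreal (norm (indicator {0..k} v *\<^sub>R (psi v / v))) \<partial>lborel) = (\<integral>\<^sup>+v\<in>{0..k}. ennreal \<bar>psi v / v\<bar> \<partial>lborel)"
    by (rule nn_integral_cong) (simp split: split_indicator)
  with fin have "set_integrable lborel {0..k} (\<lambda>v. psi v / v)"
    unfolding set_integrable_def by (intro integrableI_bounded) (use psi_measurable in \<open>simp_all\<close>)
  then show ?thesis using k by blast
qed

lemma psi_over_integrable: assumes "0 \<le> u" "u < K" shows "set_integrable lborel {0..u} (\<lambda>v. psi v / v)"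
proof -
  obtain k where k: "0 < k" "k < K" "set_integrable lborel {0..k} (\<lambda>v. psi v / v)"
    using psi_over_integrable_near_0 by blast
  have "set_integrable lborel {k..max k u} (\<lambda>v. psi v / v)"
    unfolding set_integrable_def
    by (rule borel_integrable_compact)
       (use k assms in \<open>auto intro!: continuous_intros continuous_on_subset[OF psi_continuous]\<close>)
  with k(3) have "set_integrable lborel ({0..k} \<union> {k..max k u}) (\<lambda>v. psi v / v)"
    by (rule set_integrable_Un) auto
  then show ?thesis by (rule set_integrable_subset) auto
qed

lemma psi_over_integrable_on: assumes "0 \<le> u" "u < K" shows "(\<lambda>v. psi v / v) integrable_on {0..u}"
  using set_borel_integral_eq_integral(1)[OF psi_over_integrable[OF assms]] .

lemma phi_eq: assumes "0 \<le> u" "u < K" shows "phi u = integral {0..u} (\<lambda>v. psi v / v) / \<beta>"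
  unfolding ou_phi_def using set_borel_integral_eq_integral(2)[OF psi_over_integrable[OF assms]]
  by (simp add: psi_def)

lemma phi_0 [simp]: "phi 0 = 0" using phi_eq[of 0] K_pos by simp

lemma phi_continuous_on_Icc: assumes "u < K" shows "continuous_on {0..u} phi"
proof (cases "0 \<le> u")
  case True
  have "continuous_on {0..u} (\<lambda>v. integral {0..v} (\<lambda>v. psi v / v) / \<beta>)"
    using psi_over_integrable_on[OF True assms] beta_pos
    by (intro continuous_intros indefinite_integral_continuous_1) auto
  then show ?thesis
    by (rule continuous_on_cong[THEN iffD1, rotated 2]) (use assms in \<open>auto simp: phi_eq\<close>)
qed simp

lemma phi_DERIV: assumes u: "0 < u" "u < K" shows "(phi has_real_derivative psi u / (\<beta> * u)) (at u)"
proof -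
  \<comment> \<open>Continuity of \<open>psi v / v\<close> is available only away from 0, so the
    fundamental theorem is applied from the base point \<open>u/2\<close>; the part over
    \<open>[0, a]\<close> is a constant.\<close>
  define a c where "a = u/2" and "c = (u + K)/2"
  have ac: "0 < a" "a < u" "u < c" "c < K" using u by (auto simp: a_def c_def)
  have cont: "continuous_on {a..c} (\<lambda>v. psi v / v)"
    by (intro continuous_intros continuous_on_subset[OF psi_continuous]) (use ac in auto)
  have "((\<lambda>v. integral {a..v} (\<lambda>v. psi v / v)) has_real_derivative psi u / u) (at u within {a..c})"
    by (rule integral_has_real_derivative[OF cont]) (use ac in auto)
  then have "((\<lambda>v. integral {a..v} (\<lambda>v. psi v / v)) has_real_derivative psi u / u) (at u)"
    using at_within_Icc_at[of a u c] ac by simp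
  then have D: "((\<lambda>v. (integral {0..a} (\<lambda>v. psi v / v) + integral {a..v} (\<lambda>v. psi v / v)) / \<beta>) has_real_derivative psi u / (\<beta> * u)) (at u)"
    using beta_pos by (auto intro!: derivative_eq_intros simp: field_simps)
  show ?thesis
  proof (rule has_field_derivative_transform_within_open[OF D, of "{a<..<c}"])
    fix v assume v: "v \<in> {a<..<c}"
    have "integral {0..a} (\<lambda>v. psi v / v) + integral {a..v} (\<lambda>v. psi v / v) = integral {0..v} (\<lambda>v. psi v / v)"
      using Henstock_Kurzweil_Integration.integral_combine[where a=0 and c=a and b=v and f="\<lambda>v. psi v / v"] v ac psi_over_integrable_on[of v] by auto
    then show "(integral {0..a} (\<lambda>v. psi v / v) + integral {a..v} (\<lambda>v. psi v / v)) / \<beta> = phi v"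
      using v ac by (simp add: phi_eq)
  qed (use ac in auto)
qed

lemma phi_tendsto_0: "(phi \<longlongrightarrow> 0) (at_right 0)"
proof -
  have "continuous_on {0..K/2} phi" using K_pos by (intro phi_continuous_on_Icc) auto
  from this[unfolded continuous_on, rule_format, of 0] 
  have "(phi \<longlongrightarrow> phi 0) (at 0 within {0..K/2})" using K_pos by simp
  then show ?thesis using K_pos by (simp add: at_within_Icc_at_right)
qed

lemma phi_continuous: "continuous_on {0..<K} phi"
  unfolding continuous_on_def
proof
  fix u assume u: "u \<in> {0..<K}"
  have "continuous_on {0..(u+K)/2} phi" using u by (intro phi_continuous_on_Icc) auto
  then have "(phi \<longlongrightarrow> phi u) (at u within {0..(u+K)/2})" using u unfolding continuous_on by auto
  moreover have "at u within {0..(u+K)/2} = at u within {0..<K}"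
    by (rule at_within_nhd[of _ "{..<(u+K)/2}"]) (use u in auto)
  ultimately show "(phi \<longlongrightarrow> phi u) (at u within {0..<K})" by simp
qed

text \<open>Near \<open>K\<close> the divergence of \<open>phi\<close> makes it nonnegative, and on
  the remaining compact interval it is continuous. Since \<open>psi\<close> may be negative,
  \<open>phi\<close> need be neither monotone nor nonnegative.\<close>

lemma phi_bounded_below: obtains C where "C \<ge> 0" "\<And>u. 0 \<le> u \<Longrightarrow> u < K \<Longrightarrow> exp (- phi u) \<le> C"
proof -
  have "eventually (\<lambda>u. phi u \<ge> 0) (at_left K)"
    using phi_lim by (simp add: filterlim_at_top)
  then obtain a where a: "a < K" "\<And>u. a < u \<Longrightarrow> u < K \<Longrightarrow> phi u \<ge> 0"
    unfolding eventually_at_left_field by auto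
  have "compact ((\<lambda>u. exp (- phi u)) ` {0..max a 0})"
    using a K_pos by (intro compact_continuous_image continuous_intros phi_continuous_on_Icc) auto
  then obtain C where C: "\<And>u. u \<in> {0..max a 0} \<Longrightarrow> exp (- phi u) \<le> C"
    by (meson bounded_imp_bdd_above compact_imp_bounded bdd_above.E image_eqI)
  show ?thesis
  proof (rule that[of "max C 1"])
    fix u assume u: "0 \<le> u" "u < K"
    show "exp (- phi u) \<le> max C 1"
    proof (cases "u \<le> max a 0")
      case True then show ?thesis using C[of u] u by auto
    next
      case False 
      then have "exp (- phi u) \<le> 1" using a(2)[of u] u by auto
      then show ?thesis by (rule order_trans) simp
    qed
  qed simp
qed

lemma phi_measurable [measurable]: "phi \<in> borel_measurable borel"
proof -
  have "phi = (\<lambda>u. 1 / \<beta> * (LINT v|lborel. (if 0 \<le> v \<and> v \<le> u then psi v / v else 0)))"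
    unfolding ou_phi_def psi_def set_lebesgue_integral_def fun_eq_iff
    by (intro allI arg_cong2[where f="(*)"] refl Bochner_Integration.integral_cong) auto
  then show ?thesis by simp
qed

end

section \<open>Paths of the Ornstein--Uhlenbeck process\<close>

lemma right_continuous_seq:
  fixes f :: "real \<Rightarrow> real"
  assumes f: "(f \<longlongrightarrow> f r) (at_right r)" and s: "s \<longlonglongrightarrow> r" "\<And>n. s n \<ge> r"
  shows "(\<lambda>n. f (s n)) \<longlonglongrightarrow> f r"
proof (rule tendstoI)
  fix e :: real assume e: "e > 0"
  from tendstoD[OF f e] obtain d where d: "d > r" "\<And>y. y > r \<Longrightarrow> y < d \<Longrightarrow> dist (f y) (f r) < e"
    unfolding eventually_at_right_field by auto
  show "eventually (\<lambda>n. dist (f (s n)) (f r) < e) sequentially"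
    using order_tendstoD(2)[OF s(1) d(1)]
  proof eventually_elim
    case (elim n)
    then show ?case using s(2)[of n] d(2)[of "s n"] e by (cases "s n = r") auto
  qed
qed

lemma regulated_bounded:
  fixes f :: "real \<Rightarrow> real"
  assumes r: "\<And>t. t \<ge> 0 \<Longrightarrow> \<exists>l. (f \<longlongrightarrow> l) (at_right t)" and l: "\<And>t. t > 0 \<Longrightarrow> \<exists>l. (f \<longlongrightarrow> l) (at_left t)"
  shows "\<exists>B. \<forall>s\<in>{0..T}. \<bar>f s\<bar> \<le> B"
proof (cases "0 \<le> T")
  case True
  have bnd: "\<exists>B. eventually (\<lambda>s. \<bar>f s\<bar> \<le> B) F" if "(f \<longlongrightarrow> c) F" for c F
  proof -
    have "eventually (\<lambda>s. dist (f s) c < 1) F" using tendstoD[OF that, of 1] by simp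
    then have "eventually (\<lambda>s. \<bar>f s\<bar> \<le> \<bar>c\<bar> + 1) F"
      by eventually_elim (auto simp: dist_real_def)
    then show ?thesis by blast
  qed
  \<comment> \<open>The intervals tested in Bolzano's principle may reach below 0, where nothing is
    known about \<open>f\<close>; hence the guard \<open>0 \<le> s\<close>.\<close>
  have "\<exists>B. \<forall>s\<in>{0..T}. 0 \<le> s \<longrightarrow> \<bar>f s\<bar> \<le> B"
  proof (rule Bolzano[where P="\<lambda>a b. \<exists>B. \<forall>s\<in>{a..b}. 0 \<le> s \<longrightarrow> \<bar>f s\<bar> \<le> B", OF True], goal_cases)
    case (1 a b c)
    then obtain B1 B2 where "\<forall>s\<in>{a..b}. 0 \<le> s \<longrightarrow> \<bar>f s\<bar> \<le> B1" "\<forall>s\<in>{b..c}. 0 \<le> s \<longrightarrow> \<bar>f s\<bar> \<le> B2" by blast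
    then have "\<forall>s\<in>{a..c}. 0 \<le> s \<longrightarrow> \<bar>f s\<bar> \<le> max B1 B2" by (auto simp: le_max_iff_disj)
    then show ?case by blast
  next
    case (2 t)
    note local = 2(1)
    obtain B1 d1 where 1: "d1 > t" "\<And>s. t < s \<Longrightarrow> s < d1 \<Longrightarrow> \<bar>f s\<bar> \<le> B1"
    proof -
      obtain l' B where "(f \<longlongrightarrow> l') (at_right t)" "eventually (\<lambda>s. \<bar>f s\<bar> \<le> B) (at_right t)"
        using r[OF local] bnd by blast
      then show ?thesis using that unfolding eventually_at_right_field by blast
    qed
    obtain B2 d2 where 2: "d2 < t" "\<And>s. d2 < s \<Longrightarrow> s < t \<Longrightarrow> 0 \<le> s \<Longrightarrow> \<bar>f s\<bar> \<le> B2"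
    proof (cases "t = 0")
      case True then show ?thesis using that[of "-1"] by auto
    next
      case False
      then obtain l' B where "(f \<longlongrightarrow> l') (at_left t)" "eventually (\<lambda>s. \<bar>f s\<bar> \<le> B) (at_left t)"
        using l[of t] local bnd by (metis order_less_le)
      then show ?thesis using that unfolding eventually_at_left_field by blast
    qed
    show ?case
    proof (rule exI[of _ "min (d1 - t) (t - d2)"], intro conjI allI impI)
      fix a b assume ab: "a \<le> t \<and> t \<le> b \<and> b - a < min (d1 - t) (t - d2)"
      show "\<exists>B. \<forall>s\<in>{a..b}. 0 \<le> s \<longrightarrow> \<bar>f s\<bar> \<le> B"
      proof (rule exI[of _ "max (max B1 B2) \<bar>f t\<bar>"], intro ballI impI)
        fix s assume "s \<in> {a..b}" "0 \<le> s"
        then show "\<bar>f s\<bar> \<le> max (max B1 B2) \<bar>f t\<bar>"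
          using 1(2)[of s] 2(2)[of s] ab by (cases s t rule: linorder_cases) auto
      qed
    qed (use 1 2 in auto)
  qed
  then show ?thesis by auto
qed auto

context levy_ou
begin

section \<open>Regularity of the paths of \<open>X\<close>\<close>

lemma X_0: "\<omega> \<in> space M \<Longrightarrow> X 0 \<omega> = x"
  using OU[of \<omega> 0] by (simp add: L_0)

text \<open>The integral term is continuous in time, so \<open>X\<close> inherits the one-sided
  limits of \<open>L\<close>. The set \<open>S\<close> selects the side, and \<open>ev\<close> keeps
  the nearby times nonnegative, where the equation holds.\<close>

lemma X_tendsto_aux:
  assumes w: "\<omega> \<in> space M" and t: "0 \<le> t" and ev: "eventually (\<lambda>s. s \<in> {0..t+1}) (at t within S)"
    and l: "((\<lambda>s. L s \<omega>) \<longlongrightarrow> l) (at t within S)"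
  shows "((\<lambda>s. X s \<omega>) \<longlongrightarrow> x - \<beta> * integral {0..t} (\<lambda>s. X s \<omega>) + l) (at t within S)"
proof -
  have "continuous_on {0..t+1} (\<lambda>r. integral {0..r} (\<lambda>s. X s \<omega>))"
    using OU_int[OF w, of "t+1"] t by (intro indefinite_integral_continuous_1) auto
  then have "((\<lambda>r. integral {0..r} (\<lambda>s. X s \<omega>)) \<longlongrightarrow> integral {0..t} (\<lambda>s. X s \<omega>)) (at t within {0..t+1})"
    unfolding continuous_on using t by auto
  then have "((\<lambda>r. integral {0..r} (\<lambda>s. X s \<omega>)) \<longlongrightarrow> integral {0..t} (\<lambda>s. X s \<omega>)) (at t within (S \<inter> {0..t+1}))"
    by (rule tendsto_within_subset) auto
  moreover have "at t within (S \<inter> {0..t+1}) = at t within S"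
    unfolding filter_eq_iff eventually_at_filter
    by (intro allI eventually_subst eventually_mono[OF ev[unfolded eventually_at_filter]]) auto
  ultimately have "((\<lambda>s. x - \<beta> * integral {0..s} (\<lambda>s. X s \<omega>) + L s \<omega>) \<longlongrightarrow> x - \<beta> * integral {0..t} (\<lambda>s. X s \<omega>) + l) (at t within S)"
    using l by (intro tendsto_intros) auto
  then show ?thesis
    by (rule Lim_transform_eventually) (use ev in eventually_elim, use OU[OF w] in auto)
qed

lemma X_right: assumes w: "\<omega> \<in> space M" and t: "0 \<le> t" shows "((\<lambda>s. X s \<omega>) \<longlongrightarrow> X t \<omega>) (at_right t)"
proof -
  have "((\<lambda>s. L s \<omega>) \<longlongrightarrow> L t \<omega>) (at_right t)"
    using L_cadlag[OF w] t unfolding cadlag_def continuous_within by auto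
  moreover have "eventually (\<lambda>s. s \<in> {0..t+1}) (at_right t)"
    using t unfolding eventually_at_right_field by (intro exI[of _ "t+1"]) auto
  ultimately show ?thesis using X_tendsto_aux[OF w t, of "{t<..}" "L t \<omega>"] OU[OF w t] by simp
qed

lemma X_left: assumes w: "\<omega> \<in> space M" and t: "0 < t" shows "\<exists>l. ((\<lambda>s. X s \<omega>) \<longlongrightarrow> l) (at_left t)"
proof -
  obtain l where "((\<lambda>s. L s \<omega>) \<longlongrightarrow> l) (at_left t)"
    using L_cadlag[OF w] t unfolding cadlag_def by auto
  moreover have "eventually (\<lambda>s. s \<in> {0..t+1}) (at_left t)"
    using t unfolding eventually_at_left_field by (intro exI[of _ 0]) auto
  ultimately show ?thesis using X_tendsto_aux[OF w less_imp_le[OF t]] by blast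
qed

lemma X_bounded: "\<omega> \<in> space M \<Longrightarrow> \<exists>B. \<forall>s\<in>{0..T}. \<bar>X s \<omega>\<bar> \<le> B"
  using X_right X_left by (intro regulated_bounded) blast+

text \<open>Integration by parts on one cell, without an integral against \<open>L\<close>. The
  difference of \<open>exp (\<beta> * t) * X t\<close> over the cell splits into
  \<open>(exp (\<beta> * b) - exp (\<beta> * a)) * X b\<close>, which is the integral of
  \<open>\<beta> * exp (\<beta> * r) * X b\<close>, and
  \<open>exp (\<beta> * a) * (X b - X a)\<close>, where the equation replaces the increment of
  \<open>X\<close> by that of \<open>L\<close> minus an integral of \<open>X\<close>.\<close>

lemma OU_cell: 
  assumes w: "\<omega> \<in> space M" and ab: "0 \<le> a" "a \<le> b"
  shows "((\<lambda>r. \<beta> * exp (\<beta> * r) * X b \<omega> - \<beta> * exp (\<beta> * a) * X r \<omega>) has_integral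
     (exp (\<beta> * b) * X b \<omega> - exp (\<beta> * a) * X a \<omega> - exp (\<beta> * a) * (L b \<omega> - L a \<omega>))) {a..b}"
proof -
  let ?I = "\<lambda>t. integral {0..t} (\<lambda>s. X s \<omega>)"
  have int: "(\<lambda>s. X s \<omega>) integrable_on {0..b}" using OU_int[OF w, of b] ab by simp
  have "?I a + integral {a..b} (\<lambda>s. X s \<omega>) = ?I b"
    by (rule Henstock_Kurzweil_Integration.integral_combine[OF ab int])
  moreover have "((\<lambda>s. X s \<omega>) has_integral integral {a..b} (\<lambda>s. X s \<omega>)) {a..b}"
    by (rule integrable_integral[OF integrable_subinterval_real[OF int]]) (use ab in auto)
  ultimately have 1: "((\<lambda>s. X s \<omega>) has_integral (?I b - ?I a)) {a..b}" by (metis add_diff_cancel_left')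
  have 2: "((\<lambda>r. \<beta> * exp (\<beta> * r)) has_integral (exp (\<beta> * b) - exp (\<beta> * a))) {a..b}"
    using ab(2) by (intro fundamental_theorem_of_calculus)
      (auto intro!: derivative_eq_intros simp: has_real_derivative_iff_has_vector_derivative[symmetric])
  have "((\<lambda>r. \<beta> * exp (\<beta> * r) * X b \<omega> - \<beta> * exp (\<beta> * a) * X r \<omega>) has_integral
     ((exp (\<beta> * b) - exp (\<beta> * a)) * X b \<omega> - \<beta> * exp (\<beta> * a) * (?I b - ?I a))) {a..b}"
    by (intro has_integral_diff has_integral_mult_left 2 has_integral_mult_right 1)
  moreover have "\<beta> * (?I b - ?I a) = (L b \<omega> - L a \<omega>) - (X b \<omega> - X a \<omega>)"
    using OU[OF w ab(1)] OU[OF w, of b] ab by (simp add: algebra_simps)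
  then have "\<beta> * exp (\<beta> * a) * (?I b - ?I a) = exp (\<beta> * a) * ((L b \<omega> - L a \<omega>) - (X b \<omega> - X a \<omega>))"
    by (metis mult.assoc mult.commute)
  then have "(exp (\<beta> * b) - exp (\<beta> * a)) * X b \<omega> - \<beta> * exp (\<beta> * a) * (?I b - ?I a)
      = exp (\<beta> * b) * X b \<omega> - exp (\<beta> * a) * X a \<omega> - exp (\<beta> * a) * (L b \<omega> - L a \<omega>)"
    by (simp only:) (simp add: algebra_simps)
  ultimately show ?thesis by metis
qed

text \<open>The limit is the pathwise integral of \<open>exp (\<beta> * s)\<close> against
  \<open>L\<close>. Summing the one-cell identity shows that the Riemann sum differs from the
  boundary terms by the integral of a function that is bounded uniformly in the mesh and tends to 0
  pointwise.\<close>

lemma OU_Riemann: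
  assumes w: "\<omega> \<in> space M" and pq: "p \<le> q"
  shows "(\<lambda>n. \<Sum>i\<in>{p * 2^n..<q * 2^n}. exp (\<beta> * dyadic (m + n) i) * increment (m + n) i \<omega>)
    \<longlonglongrightarrow> exp (\<beta> * dyadic m q) * X (dyadic m q) \<omega> - exp (\<beta> * dyadic m p) * X (dyadic m p) \<omega>"
proof -
  define cg where "cg N r = real_of_int \<lceil>r * 2^N\<rceil> / 2^N" for N :: nat and r :: real
  \<comment> \<open>With \<open>X\<close> taken at the right end of a cell and the weight at its left end, the integrand of the
    error tends to 0 at every point by right continuity alone.\<close>
  define f where "f N r = \<beta> * exp (\<beta> * r) * X (cg N r) \<omega> - \<beta> * exp (\<beta> * (cg N r - 1 / 2^N)) * X r \<omega>" for N r
  have cell: "(f N has_integral (exp (\<beta> * dyadic N (Suc i)) * X (dyadic N (Suc i)) \<omega> - exp (\<beta> * dyadic N i) * X (dyadic N i) \<omega>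
       - exp (\<beta> * dyadic N i) * increment N i \<omega>)) {dyadic N i..dyadic N (Suc i)}" for N i
  proof -
    have "(f N has_integral (exp (\<beta> * dyadic N (Suc i)) * X (dyadic N (Suc i)) \<omega> - exp (\<beta> * dyadic N i) * X (dyadic N i) \<omega>
       - exp (\<beta> * dyadic N i) * increment N i \<omega>)) (cbox (dyadic N i) (dyadic N (Suc i)))"
    \<comment> \<open>At the left end of a cell the ceiling returns that point and not the right end
      of the cell, so the two integrands are compared in the interior only.\<close>
    proof (rule has_integral_spike_interior)
      show "((\<lambda>r. \<beta> * exp (\<beta> * r) * X (dyadic N (Suc i)) \<omega> - \<beta> * exp (\<beta> * dyadic N i) * X r \<omega>) has_integral
        (exp (\<beta> * dyadic N (Suc i)) * X (dyadic N (Suc i)) \<omega> - exp (\<beta> * dyadic N i) * X (dyadic N i) \<omega>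
       - exp (\<beta> * dyadic N i) * increment N i \<omega>)) (cbox (dyadic N i) (dyadic N (Suc i)))"
        unfolding increment_def cbox_interval by (rule OU_cell[OF w]) auto
      fix r assume "r \<in> box (dyadic N i) (dyadic N (Suc i))"
      then have "real i < r * 2^N" "r * 2^N < real i + 1" by (auto simp: dyadic_def field_simps)
      then have "\<lceil>r * 2^N\<rceil> = int i + 1" by (intro ceiling_unique) auto
      then have "cg N r = dyadic N (Suc i)" "cg N r - 1/2^N = dyadic N i" by (auto simp: cg_def dyadic_def field_simps)
      then show "f N r = \<beta> * exp (\<beta> * r) * X (dyadic N (Suc i)) \<omega> - \<beta> * exp (\<beta> * dyadic N i) * X r \<omega>"
        by (simp add: f_def)
    qed
    then show ?thesis by simp
  qed
  have sum: "(f N has_integral (exp (\<beta> * dyadic N j) * X (dyadic N j) \<omega> - exp (\<beta> * dyadic N i) * X (dyadic N i) \<omega>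
       - (\<Sum>l\<in>{i..<j}. exp (\<beta> * dyadic N l) * increment N l \<omega>))) {dyadic N i..dyadic N j}" if "i \<le> j" for N i j
    using that
  proof (induction j rule: dec_induct)
    case base show ?case using has_integral_refl(2)[of "f N" "dyadic N i"] by simp
  next
    case (step j)
    have "(f N has_integral ((exp (\<beta> * dyadic N j) * X (dyadic N j) \<omega> - exp (\<beta> * dyadic N i) * X (dyadic N i) \<omega>
       - (\<Sum>l\<in>{i..<j}. exp (\<beta> * dyadic N l) * increment N l \<omega>)) + (exp (\<beta> * dyadic N (Suc j)) * X (dyadic N (Suc j)) \<omega> - exp (\<beta> * dyadic N j) * X (dyadic N j) \<omega>
       - exp (\<beta> * dyadic N j) * increment N j \<omega>))) {dyadic N i..dyadic N (Suc j)}"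
      by (rule has_integral_combine[OF _ _ step.IH cell]) (use step in auto)
    then show ?case using step(1) by (simp add: algebra_simps)
  qed
  obtain B where B: "\<And>s. s \<in> {0..dyadic m q + 1} \<Longrightarrow> \<bar>X s \<omega>\<bar> \<le> B" using X_bounded[OF w] by blast
  have B0: "B \<ge> 0" using B[of 0] by auto
  have cg: "r \<le> cg N r" "cg N r < r + 1 / 2^N" for N r
    unfolding cg_def by (simp_all add: field_simps) linarith+
  let ?S = "{dyadic m p..dyadic m q}"
  have S: "?S = {dyadic (m+n) (p * 2^n)..dyadic (m+n) (q * 2^n)}" for n by (simp add: dyadic_add)
  have int: "integral ?S (f (m + n)) = exp (\<beta> * dyadic m q) * X (dyadic m q) \<omega> - exp (\<beta> * dyadic m p) * X (dyadic m p) \<omega>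
       - (\<Sum>i\<in>{p * 2^n..<q * 2^n}. exp (\<beta> * dyadic (m + n) i) * increment (m + n) i \<omega>)" 
     "f (m + n) integrable_on ?S" for n
    using sum[of "p * 2^n" "q * 2^n" "m + n"] pq unfolding S[symmetric]
    by (auto simp: dyadic_add intro: integral_unique)
  have lim0: "(\<lambda>n. 1 / 2 ^ (m + n) :: real) \<longlonglongrightarrow> 0"
    using LIMSEQ_ignore_initial_segment[OF LIMSEQ_power_zero[of "1/2::real"], of m] by (simp add: power_divide add.commute)
  have "(\<lambda>n. integral ?S (f (m + n))) \<longlonglongrightarrow> integral ?S (\<lambda>_. 0)"
  proof (rule dominated_convergence(2)[where h="\<lambda>_. 2 * \<beta> * exp (\<beta> * dyadic m q) * B"])
    show "f (m + n) integrable_on ?S" for n by (rule int)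
    show "(\<lambda>_. 2 * \<beta> * exp (\<beta> * dyadic m q) * B) integrable_on ?S" by (rule integrable_const_ivl)
    fix n r assume r: "r \<in> ?S"
    have r0: "0 \<le> r" using r by (intro order_trans[OF dyadic_nonneg, of m p]) auto
    have le1: "1 / 2^(m+n) \<le> (1::real)" by simp
    have "\<bar>X r \<omega>\<bar> \<le> B" using r r0 by (intro B) auto
    moreover have "\<bar>X (cg (m+n) r) \<omega>\<bar> \<le> B" 
    proof (rule B)
      have "cg (m+n) r \<le> dyadic m q + 1" using r cg(2)[of "m+n" r] le1 by (simp only: atLeastAtMost_iff) linarith
      then show "cg (m+n) r \<in> {0..dyadic m q + 1}" using r0 cg(1)[of r "m+n"] by simp
    qed
    moreover have "exp (\<beta> * r) \<le> exp (\<beta> * dyadic m q)" using r beta_pos by simp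
    moreover have "exp (\<beta> * (cg (m+n) r - 1 / 2^(m+n))) \<le> exp (\<beta> * dyadic m q)" using r beta_pos cg(2)[of "m+n" r] by simp
    ultimately have "exp (\<beta> * r) * \<bar>X (cg (m+n) r) \<omega>\<bar> \<le> exp (\<beta> * dyadic m q) * B"
       "exp (\<beta> * (cg (m+n) r - 1 / 2^(m+n))) * \<bar>X r \<omega>\<bar> \<le> exp (\<beta> * dyadic m q) * B"
      by (auto intro!: mult_mono)
    from mult_left_mono[OF this(1), of \<beta>] mult_left_mono[OF this(2), of \<beta>] beta_pos
    have "\<bar>\<beta> * exp (\<beta> * r) * X (cg (m+n) r) \<omega>\<bar> + \<bar>\<beta> * exp (\<beta> * (cg (m+n) r - 1 / 2^(m+n))) * X r \<omega>\<bar> \<le> 2 * \<beta> * exp (\<beta> * dyadic m q) * B"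
      by (simp only: abs_mult abs_exp_cancel abs_of_pos mult.assoc) linarith
    then show "norm (f (m + n) r) \<le> 2 * \<beta> * exp (\<beta> * dyadic m q) * B"
      unfolding f_def real_norm_def by linarith
  next
    fix r assume r: "r \<in> ?S"
    have r0: "0 \<le> r" using r by (intro order_trans[OF dyadic_nonneg, of m p]) auto
    have cgl: "(\<lambda>n. cg (m + n) r) \<longlonglongrightarrow> r"
    proof (rule tendsto_sandwich[OF _ _ tendsto_const])
      show "(\<lambda>n. r + 1 / 2^(m+n)) \<longlonglongrightarrow> r" using tendsto_add[OF tendsto_const lim0, of r] by simp
    qed (intro always_eventually allI cg less_imp_le)+
    have "(\<lambda>n. X (cg (m + n) r) \<omega>) \<longlonglongrightarrow> X r \<omega>"
      by (rule right_continuous_seq[OF X_right[OF w r0] cgl]) (rule cg)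
    then have "(\<lambda>n. f (m + n) r) \<longlonglongrightarrow> \<beta> * exp (\<beta> * r) * X r \<omega> - \<beta> * exp (\<beta> * (r - 0)) * X r \<omega>"
      unfolding f_def using cgl lim0 by (intro tendsto_intros) auto
    then show "(\<lambda>n. f (m + n) r) \<longlonglongrightarrow> 0" by simp
  qed
  then have "(\<lambda>n. exp (\<beta> * dyadic m q) * X (dyadic m q) \<omega> - exp (\<beta> * dyadic m p) * X (dyadic m p) \<omega> - integral ?S (f (m + n)))
     \<longlonglongrightarrow> exp (\<beta> * dyadic m q) * X (dyadic m q) \<omega> - exp (\<beta> * dyadic m p) * X (dyadic m p) \<omega> - 0"
    by (intro tendsto_diff tendsto_const) simp
  then show ?thesis by (simp add: int(1))
qed

end

section \<open>The past and the innovations on a dyadic grid\<close>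

context levy_ou
begin

lemma increment_refine: "increment n i \<omega> = (\<Sum>l\<in>{i * 2^j..<Suc i * 2^j}. increment (n + j) l \<omega>)"
  unfolding increment_def
  by (subst sum_Suc_diff') (simp_all only: dyadic_add, simp_all)

text \<open>Along refining grids the events \<open>grid_events\<close> increase, so the generator of \<open>past r\<close> is closed
  under intersections.\<close>

definition grid_events :: "nat \<Rightarrow> nat \<Rightarrow> 'a set set" where
  "grid_events n k = {(\<lambda>\<omega>. \<lambda>i\<in>{..<k}. increment n i \<omega>) -` B \<inter> space M | B. B \<in> sets (PiM {..<k} (\<lambda>_. borel))}"

definition past_gens :: "real \<Rightarrow> 'a set set" where "past_gens r = (\<Union>n. \<Union>k\<in>{k. dyadic n k \<le> r}. grid_events n k)"

definition past :: "real \<Rightarrow> 'a measure" where "past r = sigma (space M) (past_gens r)"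

lemma space_past_gens: "space M \<in> past_gens (dyadic m k)"
proof -
  have "space M = (\<lambda>\<omega>. \<lambda>i\<in>{..<k}. increment m i \<omega>) -` space (PiM {..<k} (\<lambda>_. borel)) \<inter> space M"
    by (auto simp: space_PiM)
  then have "space M \<in> grid_events m k" unfolding grid_events_def by blast
  then show ?thesis unfolding past_gens_def by blast
qed

lemma restrict_increment_measurable [measurable]: 
  "(\<lambda>\<omega>. \<lambda>i\<in>I. increment n i \<omega>) \<in> measurable M (PiM I (\<lambda>_. borel))"
  by (rule measurable_restrict) simp

lemma grid_events_sets: "grid_events n k \<subseteq> sets M"
  unfolding grid_events_def by (auto intro: measurable_sets[OF restrict_increment_measurable])

lemma past_gens_sets: "past_gens r \<subseteq> sets M" unfolding past_gens_def using grid_events_sets by blast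

lemma past_gens_Pow: "past_gens r \<subseteq> Pow (space M)" using past_gens_sets sets.space_closed by blast

lemma space_past [simp]: "space (past r) = space M" unfolding past_def using past_gens_Pow by (rule space_measure_of)

lemma sets_past: "sets (past r) = sigma_sets (space M) (past_gens r)" unfolding past_def using past_gens_Pow by (rule sets_measure_of)

lemma sets_past_subset: "sets (past r) \<subseteq> sets M"
  unfolding sets_past using past_gens_sets by (rule sets.sigma_sets_subset)

lemma past_mono: "r \<le> s \<Longrightarrow> sets (past r) \<subseteq> sets (past s)"
  unfolding sets_past past_gens_def by (intro sigma_sets_mono') (auto intro: order_trans)

lemma past_measurableD: "f \<in> measurable (past r) N \<Longrightarrow> f \<in> measurable M N"
  using sets_past_subset[of r] unfolding measurable_def by auto

text \<open>A coarse increment is the sum of \<open>2 ^ j\<close> fine ones, so the vector of coarse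
  increments is a measurable function of the vector of fine ones and its events pull back.\<close>

lemma grid_events_refine: assumes "dyadic n k \<le> dyadic (n + j) k'" shows "grid_events n k \<subseteq> grid_events (n + j) k'"
proof
  fix A assume "A \<in> grid_events n k"
  then obtain B where B: "B \<in> sets (PiM {..<k} (\<lambda>_. borel))" and A: "A = (\<lambda>\<omega>. \<lambda>i\<in>{..<k}. increment n i \<omega>) -` B \<inter> space M"
    unfolding grid_events_def by auto
  have "dyadic (n + j) (k * 2^j) \<le> dyadic (n + j) k'" using assms by (simp only: dyadic_add)
  then have kk: "k * 2^j \<le> k'" by simp
  define T where "T y = (\<lambda>i\<in>{..<k}. \<Sum>l\<in>{i * 2^j..<Suc i * 2^j}. y l)" for y :: "nat \<Rightarrow> real"
  have sub: "l < k'" if "i < k" "l \<in> {i * 2^j..<Suc i * 2^j}" for i l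
  proof -
    have "l < Suc i * 2^j" using that by simp
    also have "\<dots> \<le> k * 2^j" using that(1) by (intro mult_right_mono) auto
    finally show ?thesis using kk by simp
  qed
  have T: "T \<in> measurable (PiM {..<k'} (\<lambda>_. borel)) (PiM {..<k} (\<lambda>_. borel))"
    unfolding T_def
  proof (intro measurable_restrict borel_measurable_sum)
    fix i l assume "i \<in> {..<k}" "l \<in> {i * 2^j..<Suc i * 2^j}"
    then show "(\<lambda>y. y l) \<in> borel_measurable (Pi\<^sub>M {..<k'} (\<lambda>_. borel))"
      using sub by (intro measurable_component_singleton) auto
  qed
  define B' where "B' = T -` B \<inter> space (PiM {..<k'} (\<lambda>_. borel :: real measure))"
  have "A = (\<lambda>\<omega>. \<lambda>i\<in>{..<k'}. increment (n + j) i \<omega>) -` B' \<inter> space M"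
  proof -
    have "T (\<lambda>i\<in>{..<k'}. increment (n + j) i \<omega>) = (\<lambda>i\<in>{..<k}. increment n i \<omega>)" for \<omega>
      unfolding T_def
    proof (rule restrict_ext)
      fix i assume i: "i \<in> {..<k}"
      have "(\<Sum>l\<in>{i * 2^j..<Suc i * 2^j}. (\<lambda>i\<in>{..<k'}. increment (n + j) i \<omega>) l) = (\<Sum>l\<in>{i * 2^j..<Suc i * 2^j}. increment (n + j) l \<omega>)"
        by (rule sum.cong) (use sub[of i] i in auto)
      then show "(\<Sum>l\<in>{i * 2^j..<Suc i * 2^j}. (\<lambda>i\<in>{..<k'}. increment (n + j) i \<omega>) l) = increment n i \<omega>"
        by (simp only: increment_refine[of n i \<omega> j])
    qed
    then show ?thesis unfolding A B'_def
      by (auto simp: space_PiM)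
  qed
  moreover have "B' \<in> sets (PiM {..<k'} (\<lambda>_. borel))" unfolding B'_def by (rule measurable_sets[OF T B])
  ultimately show "A \<in> grid_events (n + j) k'" unfolding grid_events_def by auto
qed

lemma Int_stable_past_gens: "Int_stable (past_gens r)"
proof (rule Int_stableI)
  fix A B assume "A \<in> past_gens r" "B \<in> past_gens r"
  then obtain n k n' k' where A: "A \<in> grid_events n k" "dyadic n k \<le> r" and B: "B \<in> grid_events n' k'" "dyadic n' k' \<le> r"
    unfolding past_gens_def by auto
  \<comment> \<open>Grid \<open>n + n'\<close> refines both grids, and the larger of the two
    rescaled indices still stands for a time at most \<open>r\<close>.\<close>
  define N q where "N = n + n'" and "q = max (k * 2^n') (k' * 2^n)"
  have e: "dyadic N (k * 2^n') = dyadic n k" "dyadic N (k' * 2^n) = dyadic n' k'"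
    unfolding N_def using dyadic_add[of n n' k] dyadic_add[of n' n k'] by (simp_all add: add.commute)
  have le: "dyadic n k \<le> dyadic N q" "dyadic n' k' \<le> dyadic N q" unfolding e[symmetric] by (simp_all add: q_def)
  have "dyadic N q \<le> r" using A(2) B(2) e unfolding q_def max_def by (auto split: if_splits)
  moreover have "A \<in> grid_events N q" "B \<in> grid_events N q"
    using grid_events_refine[of n k n' q] grid_events_refine[of n' k' n q] A B le by (auto simp: N_def add.commute)
  then have "A \<inter> B \<in> grid_events N q"
  proof -
    assume "A \<in> grid_events N q" "B \<in> grid_events N q"
    then obtain S T where ST: "S \<in> sets (PiM {..<q} (\<lambda>_. borel))" "T \<in> sets (PiM {..<q} (\<lambda>_. borel))"
       "A = (\<lambda>\<omega>. \<lambda>i\<in>{..<q}. increment N i \<omega>) -` S \<inter> space M" "B = (\<lambda>\<omega>. \<lambda>i\<in>{..<q}. increment N i \<omega>) -` T \<inter> space M"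
      unfolding grid_events_def by blast
    then have "A \<inter> B = (\<lambda>\<omega>. \<lambda>i\<in>{..<q}. increment N i \<omega>) -` (S \<inter> T) \<inter> space M" by blast
    then show ?thesis unfolding grid_events_def using sets.Int[OF ST(1,2)] by blast
  qed
  ultimately show "A \<inter> B \<in> past_gens r" unfolding past_gens_def by auto
qed

lemma increment_past: assumes "dyadic n (Suc i) \<le> r" shows "increment n i \<in> borel_measurable (past r)"
proof (rule measurableI)
  fix S :: "real set" assume S: "S \<in> sets borel"
  define B where "B = (\<lambda>y. y i) -` S \<inter> space (PiM {..<Suc i} (\<lambda>_. borel :: real measure))"
  have "B \<in> sets (PiM {..<Suc i} (\<lambda>_. borel))"
    unfolding B_def by (rule measurable_sets[OF _ S], rule measurable_component_singleton) auto
  moreover have "increment n i -` S \<inter> space (past r) = (\<lambda>\<omega>. \<lambda>i\<in>{..<Suc i}. increment n i \<omega>) -` B \<inter> space M"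
    unfolding B_def by (auto simp: space_PiM)
  ultimately have "increment n i -` S \<inter> space (past r) \<in> grid_events n (Suc i)" unfolding grid_events_def by auto
  then show "increment n i -` S \<inter> space (past r) \<in> sets (past r)"
    using assms unfolding sets_past past_gens_def by (intro sigma_sets.Basic) auto
qed simp

text \<open>The equation gives \<open>X\<close> only implicitly, through an integral of its own
  path. The Riemann sums for the integral of \<open>exp (\<beta> * s)\<close> against
  \<open>L\<close> are explicit and use increments up to \<open>dyadic m k\<close> alone, so their
  limit is measurable with respect to the past.\<close>

lemma X_past: assumes r: "dyadic m k \<le> r" shows "X (dyadic m k) \<in> borel_measurable (past r)"
proof (rule borel_measurable_LIMSEQ_real)
  let ?s = "\<lambda>n \<omega>. exp (- \<beta> * dyadic m k) * (x + (\<Sum>i\<in>{0 * 2^n..<k * 2^n}. exp (\<beta> * dyadic (m + n) i) * increment (m + n) i \<omega>))"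
  show "(\<lambda>n. ?s n \<omega>) \<longlonglongrightarrow> X (dyadic m k) \<omega>" if "\<omega> \<in> space (past r)" for \<omega>
  proof -
    have w: "\<omega> \<in> space M" using that by simp
    have "(\<lambda>n. ?s n \<omega>) \<longlonglongrightarrow> exp (- \<beta> * dyadic m k) * (x + (exp (\<beta> * dyadic m k) * X (dyadic m k) \<omega> - exp (\<beta> * dyadic m 0) * X (dyadic m 0) \<omega>))"
      by (intro tendsto_intros OU_Riemann w) simp
    then show ?thesis by (simp add: X_0[OF w] mult.assoc[symmetric] exp_add[symmetric])
  qed
  show "?s n \<in> borel_measurable (past r)" for n
  proof (intro borel_measurable_times borel_measurable_add borel_measurable_const borel_measurable_sum increment_past)
    fix i assume "i \<in> {0 * 2^n..<k * 2^n}"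
    then have "dyadic (m + n) (Suc i) \<le> dyadic (m + n) (k * 2^n)" by simp
    then show "dyadic (m + n) (Suc i) \<le> r" using r by (simp only: dyadic_add)
  qed
qed

lemma X_dyadic_measurable [measurable]: "X (dyadic m k) \<in> borel_measurable M"
  using X_past[of m k] by (intro past_measurableD) auto

section \<open>Innovations: exponential moments and independence of the past\<close>

definition decay :: "nat \<Rightarrow> real" where "decay m = exp (- \<beta> / 2 ^ m)"

lemma decay_pos [simp]: "0 < decay m" and decay_le_1 [simp]: "decay m \<le> 1" and decay_less_1 [simp]: "decay m < 1"
  using beta_pos by (auto simp: decay_def)

definition innovation :: "nat \<Rightarrow> nat \<Rightarrow> 'a \<Rightarrow> real" where
  "innovation m k \<omega> = X (dyadic m (Suc k)) \<omega> - decay m * X (dyadic m k) \<omega>"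

lemma innovation_measurable [measurable]: "innovation m k \<in> borel_measurable M" unfolding innovation_def by measurable

lemma integral_exp_increment: "0 \<le> u \<Longrightarrow> u < K \<Longrightarrow> expectation (\<lambda>\<omega>. exp (u * increment m i \<omega>)) = exp (psi u / 2^m)"
  using nn_exp_increment[of u m i] by (subst integral_eq_nn_integral) auto

text \<open>Increments with index below \<open>p\<close> and those from \<open>p\<close> on form
  independent blocks. The weights vary from step to step, so the moment of the sum is a product with
  a different factor for each increment, and the exponents \<open>psi (c i)\<close> add up.\<close>

lemma weighted_sum_past_independent:
  fixes c :: "nat \<Rightarrow> real"
  assumes pq: "p \<le> q" and A: "A \<in> grid_events N p" and c: "\<And>i. i < q \<Longrightarrow> 0 \<le> c i \<and> c i < K"
  shows "integrable M (\<lambda>\<omega>. exp (\<Sum>i\<in>{p..<q}. c i * increment N i \<omega>))"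
    "expectation (\<lambda>\<omega>. indicator A \<omega> * exp (\<Sum>i\<in>{p..<q}. c i * increment N i \<omega>)) = prob A * exp ((\<Sum>i\<in>{p..<q}. psi (c i)) / 2^N)"
    "expectation (\<lambda>\<omega>. exp (\<Sum>i\<in>{p..<q}. c i * increment N i \<omega>)) = exp ((\<Sum>i\<in>{p..<q}. psi (c i)) / 2^N)"
proof -
  let ?J = "{p..<q}"
  let ?e = "\<lambda>\<omega>. exp (\<Sum>i\<in>?J. c i * increment N i \<omega>)"
  have e: "?e = (\<lambda>\<omega>. \<Prod>i\<in>?J. exp (c i * increment N i \<omega>))" by (simp add: exp_sum)
  have iv: "indep_vars (\<lambda>_. borel) (\<lambda>i \<omega>. exp (c i * increment N i \<omega>)) ?J"
    by (rule indep_vars_compose2[OF indep_vars_subset[OF indep_increment[of N q]]]) auto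
  show int: "integrable M ?e" unfolding e
    by (rule indep_vars_integrable[OF _ iv]) (use c exp_increment_integrable in auto)
  have "expectation ?e = (\<Prod>i\<in>?J. expectation (\<lambda>\<omega>. exp (c i * increment N i \<omega>)))" unfolding e
    by (rule indep_vars_lebesgue_integral[OF _ iv]) (use c exp_increment_integrable in auto)
  also have "\<dots> = (\<Prod>i\<in>?J. exp (psi (c i) / 2^N))"
    by (rule prod.cong) (use c integral_exp_increment in auto)
  also have "\<dots> = exp ((\<Sum>i\<in>?J. psi (c i)) / 2^N)" by (simp add: exp_sum sum_divide_distrib)
  finally show Ee: "expectation ?e = exp ((\<Sum>i\<in>?J. psi (c i)) / 2^N)" .
  obtain B where B: "B \<in> sets (PiM {..<p} (\<lambda>_. borel))" and Aeq: "A = (\<lambda>\<omega>. \<lambda>i\<in>{..<p}. increment N i \<omega>) -` B \<inter> space M"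
    using A unfolding grid_events_def by auto
  have ind: "indep_var (PiM {..<p} (\<lambda>_. borel)) (\<lambda>\<omega>. restrict (\<lambda>i. increment N i \<omega>) {..<p}) (PiM ?J (\<lambda>_. borel)) (\<lambda>\<omega>. restrict (\<lambda>i. increment N i \<omega>) ?J)"
    by (rule indep_var_restrict[OF indep_increment[of N q]]) (use pq in auto)
  have m2: "(\<lambda>y. exp (\<Sum>i\<in>?J. c i * y i)) \<in> borel_measurable (PiM ?J (\<lambda>_. borel))"
    by (intro measurable_compose[OF _ borel_measurable_exp] borel_measurable_sum borel_measurable_times borel_measurable_const measurable_component_singleton) 
  from indep_var_compose[OF ind borel_measurable_indicator[OF B] m2]
  have "indep_var borel (\<lambda>\<omega>. indicator B (restrict (\<lambda>i. increment N i \<omega>) {..<p}) :: real) borel ?e"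
    by (simp add: comp_def)
  moreover have "integrable M (\<lambda>\<omega>. indicat_real B (restrict (\<lambda>i. increment N i \<omega>) {..<p}))"
    by (rule integrable_const_bound[where B=1])
      (use measurable_compose[OF restrict_increment_measurable borel_measurable_indicator[OF B]] in auto)
  ultimately have "expectation (\<lambda>\<omega>. indicator B (restrict (\<lambda>i. increment N i \<omega>) {..<p}) * ?e \<omega>) = 
     expectation (\<lambda>\<omega>. indicator B (restrict (\<lambda>i. increment N i \<omega>) {..<p})) * expectation ?e"
    using int by (rule indep_var_lebesgue_integral)
  moreover have "expectation (\<lambda>\<omega>. indicat_real B (restrict (\<lambda>i. increment N i \<omega>) {..<p}) * ?e \<omega>) = expectation (\<lambda>\<omega>. indicator A \<omega> * ?e \<omega>)"
    by (rule Bochner_Integration.integral_cong) (auto simp: Aeq indicator_def)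
  moreover have "expectation (\<lambda>\<omega>. indicat_real B (restrict (\<lambda>i. increment N i \<omega>) {..<p})) = expectation (indicat_real A)"
    by (rule Bochner_Integration.integral_cong) (auto simp: Aeq indicator_def)
  moreover have "expectation (indicat_real A) = prob A" using A grid_events_sets[of N p] by (simp add: subset_iff)
  ultimately show "expectation (\<lambda>\<omega>. indicator A \<omega> * ?e \<omega>) = prob A * exp ((\<Sum>i\<in>?J. psi (c i)) / 2^N)"
    using Ee by simp
qed

text \<open>A Riemann sum for the integral of \<open>exp (- \<beta> * (t - s))\<close> against
  \<open>L\<close> over the step that ends at \<open>t = dyadic m (Suc k)\<close>. All weights are
  at most 1, so multiplying them by an exponent below \<open>K\<close> stays below
  \<open>K\<close>.\<close>

definition innovation_approx :: "nat \<Rightarrow> nat \<Rightarrow> nat \<Rightarrow> 'a \<Rightarrow> real" where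
  "innovation_approx m k n \<omega> = (\<Sum>i\<in>{k * 2^n..<Suc k * 2^n}. exp (\<beta> * (dyadic (m + n) i - dyadic m (Suc k))) * increment (m + n) i \<omega>)"

lemma innovation_approx_tendsto: assumes w: "\<omega> \<in> space M" shows "(\<lambda>n. innovation_approx m k n \<omega>) \<longlonglongrightarrow> innovation m k \<omega>"
proof -
  have "(\<lambda>n. exp (- \<beta> * dyadic m (Suc k)) * (\<Sum>i\<in>{k * 2^n..<Suc k * 2^n}. exp (\<beta> * dyadic (m + n) i) * increment (m + n) i \<omega>))
    \<longlonglongrightarrow> exp (- \<beta> * dyadic m (Suc k)) * (exp (\<beta> * dyadic m (Suc k)) * X (dyadic m (Suc k)) \<omega> - exp (\<beta> * dyadic m k) * X (dyadic m k) \<omega>)"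
    by (intro tendsto_intros OU_Riemann w) simp
  moreover have "exp (- \<beta> * dyadic m (Suc k)) * exp (\<beta> * dyadic m k) = decay m"
    by (simp add: exp_add[symmetric] decay_def dyadic_Suc algebra_simps)
  then have "exp (- \<beta> * dyadic m (Suc k)) * (exp (\<beta> * dyadic m (Suc k)) * X (dyadic m (Suc k)) \<omega> - exp (\<beta> * dyadic m k) * X (dyadic m k) \<omega>) = innovation m k \<omega>"
    by (simp add: innovation_def right_diff_distrib mult.assoc[symmetric] exp_add[symmetric])
  moreover have "(\<lambda>n. exp (- \<beta> * dyadic m (Suc k)) * (\<Sum>i\<in>{k * 2^n..<Suc k * 2^n}. exp (\<beta> * dyadic (m + n) i) * increment (m + n) i \<omega>)) = (\<lambda>n. innovation_approx m k n \<omega>)"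
    unfolding innovation_approx_def sum_distrib_left mult.assoc[symmetric] exp_add[symmetric] 
    by (simp add: algebra_simps)
  ultimately show ?thesis by metis
qed

text \<open>Along \<open>a r = u * exp (\<beta> * (r - h))\<close> the derivative of
  \<open>a\<close> is \<open>\<beta> * a r\<close>, and that of \<open>phi\<close> at
  \<open>v\<close> is \<open>psi v / (\<beta> * v)\<close>. Hence \<open>phi (a r)\<close> has
  derivative exactly \<open>psi (a r)\<close>; the factor \<open>1 / \<beta>\<close> and the measure
  \<open>dv / v\<close> in \<open>phi\<close> are made for this.\<close>

lemma psi_Riemann:
  assumes u: "0 < u" "u < K"
  shows "(\<lambda>n. (\<Sum>i\<in>{k * 2^n..<Suc k * 2^n}. psi (u * exp (\<beta> * (dyadic (m + n) i - dyadic m (Suc k))))) / 2^(m + n)) \<longlonglongrightarrow> phi u - phi (decay m * u)"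
proof -
  define h where "h = 1 / (2::real)^m"
  define a where "a r = u * exp (\<beta> * (r - h))" for r
  have h: "h > 0" by (simp add: h_def)
  have a: "0 < a r" "r \<le> h \<Longrightarrow> a r < K" for r
  proof -
    show "0 < a r" using u by (simp add: a_def)
    assume "r \<le> h"
    then have "exp (\<beta> * (r - h)) \<le> 1" using beta_pos by (simp add: mult_le_0_iff)
    then have "a r \<le> u" unfolding a_def using u by simp
    then show "a r < K" using u by simp
  qed
  have "(\<lambda>n. \<Sum>l<(2::nat)^n. psi (a (real l * h / 2^n)) * (h / 2^n)) \<longlonglongrightarrow> phi (a h) - phi (a 0)"
  proof (rule left_Riemann_sum_tendsto[OF h])
    have ca: "continuous_on {0..h} a" unfolding a_def by (intro continuous_intros)
    have ca2: "a ` {0..h} \<subseteq> {0..<K}" using a by (force intro: less_imp_le)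
    show "continuous_on {0..h} (\<lambda>r. psi (a r))" 
      by (rule continuous_on_compose2[OF psi_continuous ca ca2])
    show "continuous_on {0..h} (\<lambda>r. phi (a r))" 
      by (rule continuous_on_compose2[OF phi_continuous ca ca2])
    fix r assume r: "0 < r" "r < h"
    have "(a has_real_derivative \<beta> * a r) (at r)"
      unfolding a_def by (auto intro!: derivative_eq_intros)
    from DERIV_chain2[OF phi_DERIV this] a[of r] r
    show "((\<lambda>r. phi (a r)) has_real_derivative psi (a r)) (at r)" using beta_pos by (simp add: field_simps)
  qed
  moreover have "a h = u" "a 0 = decay m * u" by (simp_all add: a_def h_def decay_def)
  moreover have "(\<Sum>l<(2::nat)^n. psi (a (real l * h / 2^n)) * (h / 2^n)) = 
     (\<Sum>i\<in>{k * 2^n..<Suc k * 2^n}. psi (u * exp (\<beta> * (dyadic (m + n) i - dyadic m (Suc k))))) / 2^(m + n)" for n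
  proof -
    have "(\<Sum>i\<in>{k * 2^n..<Suc k * 2^n}. psi (u * exp (\<beta> * (dyadic (m + n) i - dyadic m (Suc k))))) = 
      (\<Sum>l\<in>{0..<2^n}. psi (u * exp (\<beta> * (dyadic (m + n) (l + k * 2^n) - dyadic m (Suc k)))))"
      using sum.shift_bounds_nat_ivl[of "\<lambda>i. psi (u * exp (\<beta> * (dyadic (m + n) i - dyadic m (Suc k))))" 0 "k * 2^n" "2^n"]
      by (simp add: add.commute)
    also have "\<dots> = (\<Sum>l<2^n. psi (a (real l * h / 2^n)))"
      unfolding a_def h_def dyadic_def lessThan_atLeast0
      by (intro sum.cong refl arg_cong[where f=psi] arg_cong[where f=exp] arg_cong2[where f="(*)"]) (simp add: field_simps power_add)
    finally show ?thesis by (simp add: sum_divide_distrib h_def power_add)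
  qed
  ultimately show ?thesis by simp
qed

text \<open>The formula is exact for the Riemann sums, with \<open>S u N\<close> in the exponent.
  Convergence of \<open>S\<close> gives the limit on the right and, at a larger exponent
  \<open>u'\<close>, the uniform moment bound that allows the limit on the left. The event
  \<open>A\<close> belongs to some grid \<open>n\<close> and enters only once the refined grid
  contains that one, whence the shift of the sequences by \<open>n\<close>.\<close>

lemma innovation_past_gens:
  assumes u: "0 < u" "u < K" and A: "A \<in> past_gens (dyadic m k)"
  shows "integrable M (\<lambda>\<omega>. exp (u * innovation m k \<omega>))"
    "expectation (\<lambda>\<omega>. indicator A \<omega> * exp (u * innovation m k \<omega>)) = prob A * exp (phi u - phi (decay m * u))"
    "expectation (\<lambda>\<omega>. exp (u * innovation m k \<omega>)) = exp (phi u - phi (decay m * u))"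
proof -
  obtain n k' where nk: "A \<in> grid_events n k'" "dyadic n k' \<le> dyadic m k" using A unfolding past_gens_def by auto
  define c where "c v N i = v * exp (\<beta> * (dyadic (m + N) i - dyadic m (Suc k)))" for v N i
  have c: "0 \<le> c v N i \<and> c v N i < K" if v: "0 < v" "v < K" and i: "i < Suc k * 2^N" for v N i
  proof -
    have "dyadic (m + N) i \<le> dyadic (m + N) (Suc k * 2^N)" using i by (simp only: dyadic_le_iff less_imp_le)
    then have "exp (\<beta> * (dyadic (m + N) i - dyadic m (Suc k))) \<le> 1" using beta_pos unfolding dyadic_add by (simp add: mult_le_0_iff)
    then have "c v N i \<le> v" unfolding c_def using v by simp
    moreover have "0 \<le> c v N i" using v by (simp add: c_def)
    ultimately show ?thesis using v by linarith
  qed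
  have xc: "v * innovation_approx m k N \<omega> = (\<Sum>i\<in>{k * 2^N..<Suc k * 2^N}. c v N i * increment (m + N) i \<omega>)" for v N \<omega>
    unfolding innovation_approx_def c_def sum_distrib_left mult.assoc ..
  have kk: "k * 2^N \<le> Suc k * 2^N" for N by simp
  have AN: "A \<in> grid_events (m + N) (k * 2^N)" if "N \<ge> n" for N
  proof -
    have "grid_events n k' \<subseteq> grid_events (n + (m + N - n)) (k * 2^N)"
      using that nk(2) by (intro grid_events_refine) (simp add: dyadic_add)
    then show ?thesis using that nk(1) by auto
  qed
  define S where "S v N = (\<Sum>i\<in>{k * 2^N..<Suc k * 2^N}. psi (c v N i)) / 2^(m + N)" for v N
  have lim: "(\<lambda>N. S v N) \<longlonglongrightarrow> phi v - phi (decay m * v)" if "0 < v" "v < K" for v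
    using psi_Riemann[OF that, of m k] unfolding S_def c_def .
  have I1: "integrable M (\<lambda>\<omega>. exp (v * innovation_approx m k N \<omega>))" 
    and E1: "expectation (\<lambda>\<omega>. exp (v * innovation_approx m k N \<omega>)) = exp (S v N)" 
    and E2: "expectation (\<lambda>\<omega>. indicator A \<omega> * exp (v * innovation_approx m k N \<omega>)) = prob A * exp (S v N)"
    if "N \<ge> n" "0 < v" "v < K" for N v
    using weighted_sum_past_independent[OF kk AN[OF that(1)], where c="c v N"] c[OF that(2,3)]
    unfolding xc S_def by blast+
  have Aset: "A \<in> sets M" using nk(1) grid_events_sets by auto
  have meas: "innovation_approx m k N \<in> borel_measurable M" for N unfolding innovation_approx_def by measurable
  define u' where "u' = (u + K) / 2"
  have u': "u < u'" "u' < K" "0 < u'" using u by (auto simp: u'_def)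
  obtain C where C: "\<And>N. exp (S u' N) \<le> C"
  proof -
    have "convergent (\<lambda>N. exp (S u' N))" using tendsto_exp[OF lim[OF u'(3,2)]] by (auto simp: convergent_def)
    then have "Bseq (\<lambda>N. exp (S u' N))" by (rule convergent_imp_Bseq)
    then show ?thesis using that by (auto simp: Bseq_def)
  qed
  have C0: "C \<ge> 0" using order_trans[OF exp_ge_zero C] .
  have nnC: "(\<integral>\<^sup>+\<omega>. ennreal (exp (u' * innovation_approx m k (N + n) \<omega>)) \<partial>M) \<le> ennreal C" for N
    using C[of "N + n"] E1[of "N + n" u'] I1[of "N + n" u'] u'
    by (subst nn_integral_eq_integral) (auto intro: ennreal_leI)
  have xil: "AE \<omega> in M. (\<lambda>N. exp (u * innovation_approx m k (N + n) \<omega>)) \<longlonglongrightarrow> exp (u * innovation m k \<omega>)"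
    by (intro AE_I2 tendsto_exp tendsto_mult tendsto_const LIMSEQ_ignore_initial_segment innovation_approx_tendsto)
  have xil2: "AE \<omega> in M. (\<lambda>N. indicator A \<omega> * exp (u * innovation_approx m k (N + n) \<omega>)) \<longlonglongrightarrow> indicator A \<omega> * exp (u * innovation m k \<omega>)"
    using xil by eventually_elim (intro tendsto_mult tendsto_const)
  note ui1 = exp_moment_convergence[where c=1 and u=u and u'=u' and C=C and Y="\<lambda>N. innovation_approx m k (N + n)", 
      OF _ _ _ xil u(1) u'(1) _ C0 _ nnC]
  note ui2 = exp_moment_convergence[where c=1 and u=u and u'=u' and C=C and Y="\<lambda>N. innovation_approx m k (N + n)", 
      OF _ _ _ xil2 u(1) u'(1) _ C0 _ nnC]
  show "integrable M (\<lambda>\<omega>. exp (u * innovation m k \<omega>))"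
    by (rule ui1(2)) (use meas in auto)
  have "(\<lambda>N. expectation (\<lambda>\<omega>. exp (u * innovation_approx m k (N + n) \<omega>))) \<longlonglongrightarrow> expectation (\<lambda>\<omega>. exp (u * innovation m k \<omega>))"
    by (rule ui1(3)) (use meas in auto)
  moreover have "(\<lambda>N. expectation (\<lambda>\<omega>. exp (u * innovation_approx m k (N + n) \<omega>))) \<longlonglongrightarrow> exp (phi u - phi (decay m * u))"
    using LIMSEQ_ignore_initial_segment[OF tendsto_exp[OF lim[OF u]], of n] E1[OF _ u] by simp
  ultimately show "expectation (\<lambda>\<omega>. exp (u * innovation m k \<omega>)) = exp (phi u - phi (decay m * u))"
    by (rule LIMSEQ_unique)
  have "(\<lambda>N. expectation (\<lambda>\<omega>. indicator A \<omega> * exp (u * innovation_approx m k (N + n) \<omega>))) \<longlonglongrightarrow> expectation (\<lambda>\<omega>. indicator A \<omega> * exp (u * innovation m k \<omega>))"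
    by (rule ui2(3)) (use meas Aset in \<open>auto simp: indicator_def\<close>)
  moreover have "(\<lambda>N. expectation (\<lambda>\<omega>. indicator A \<omega> * exp (u * innovation_approx m k (N + n) \<omega>))) \<longlonglongrightarrow> prob A * exp (phi u - phi (decay m * u))"
    using tendsto_mult[OF tendsto_const LIMSEQ_ignore_initial_segment[OF tendsto_exp[OF lim[OF u]], of n]] E2[OF _ u] by simp
  ultimately show "expectation (\<lambda>\<omega>. indicator A \<omega> * exp (u * innovation m k \<omega>)) = prob A * exp (phi u - phi (decay m * u))"
    by (rule LIMSEQ_unique)
qed

lemma exp_innovation_integrable: "0 < u \<Longrightarrow> u < K \<Longrightarrow> integrable M (\<lambda>\<omega>. exp (u * innovation m k \<omega>))"
  by (rule innovation_past_gens(1)[OF _ _ space_past_gens])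

text \<open>Both sides are finite measures in \<open>A\<close>: one has density
  \<open>exp (u * innovation m k \<omega>)\<close>, the other is a multiple of \<open>M\<close>.
  They agree on an intersection-stable generator that contains the whole space, hence on the
  past.\<close>

lemma innovation_past_sets:
  assumes u: "0 < u" "u < K" and A: "A \<in> sets (past (dyadic m k))"
  shows "(\<integral>\<^sup>+\<omega>. indicator A \<omega> * ennreal (exp (u * innovation m k \<omega>)) \<partial>M) = emeasure M A * ennreal (exp (phi u - phi (decay m * u)))"
proof -
  let ?c = "exp (phi u - phi (decay m * u))"
  define \<nu> where "\<nu> = density M (\<lambda>\<omega>. ennreal (exp (u * innovation m k \<omega>)))"
  have em: "emeasure \<nu> B = (\<integral>\<^sup>+\<omega>. indicator B \<omega> * ennreal (exp (u * innovation m k \<omega>)) \<partial>M)" if "B \<in> sets M" for B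
    unfolding \<nu>_def by (subst emeasure_density) (use that in \<open>auto simp: mult.commute\<close>)
  interpret \<nu>: finite_measure \<nu>
  proof
    have "emeasure \<nu> (space \<nu>) = ennreal (expectation (\<lambda>\<omega>. exp (u * innovation m k \<omega>)))"
      unfolding \<nu>_def by (simp add: emeasure_density exp_innovation_integrable[OF u] nn_integral_eq_integral[symmetric] cong: nn_integral_cong)
    then show "emeasure \<nu> (space \<nu>) \<noteq> \<infinity>" by simp
  qed
  have [simp]: "space \<nu> = space M" "sets \<nu> = sets M" by (simp_all add: \<nu>_def)
  have gen1: "measure \<nu> B = prob B * ?c" if B: "B \<in> past_gens (dyadic m k)" for B
  proof -
    have Bm: "B \<in> sets M" using B past_gens_sets by auto
    have "emeasure \<nu> B = (\<integral>\<^sup>+\<omega>. ennreal (indicator B \<omega> * exp (u * innovation m k \<omega>)) \<partial>M)"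
      unfolding em[OF Bm] by (rule nn_integral_cong) (simp split: split_indicator)
    also have "\<dots> = ennreal (expectation (\<lambda>\<omega>. indicator B \<omega> * exp (u * innovation m k \<omega>)))"
      using exp_innovation_integrable[OF u] Bm integrable_mult_indicator[OF Bm exp_innovation_integrable[OF u]]
      by (intro nn_integral_eq_integral) auto
    finally show ?thesis using innovation_past_gens(2)[OF u B] by (simp add: \<nu>.emeasure_eq_measure)
  qed
  have "A \<in> sigma_sets (space M) (past_gens (dyadic m k))" using A by (simp add: sets_past)
  with Int_stable_past_gens past_gens_Pow have "measure \<nu> A = prob A * ?c"
  proof (induction rule: sigma_sets_induct_disjoint)
    case (basic A) then show ?case by (rule gen1)
  next
    case empty show ?case by simp
  next
    case (compl A)
    then have A: "A \<in> sets M" using sets_past_subset sets_past by blast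
    have "measure \<nu> (space \<nu> - A) = measure \<nu> (space \<nu>) - measure \<nu> A"
      using A by (intro \<nu>.finite_measure_compl) auto
    then show ?case using compl.IH gen1[OF space_past_gens] A by (simp add: prob_compl prob_space algebra_simps)
  next
    case (union A)
    have A: "range A \<subseteq> sets M" using union(2) sets_past_subset sets_past by blast
    have "(\<lambda>i. measure \<nu> (A i)) sums measure \<nu> (\<Union>i. A i)"
      using A union(1) by (intro \<nu>.finite_measure_UNION) auto
    moreover have "(\<lambda>i. prob (A i) * ?c) sums (prob (\<Union>i. A i) * ?c)"
      using A union(1) by (intro sums_mult2 finite_measure_UNION) auto
    ultimately show ?case using union(3) sums_unique2 by simp
  qed
  moreover have "A \<in> sets M" using A sets_past_subset by auto
  ultimately show ?thesis 
    by (simp add: em[symmetric] \<nu>.emeasure_eq_measure emeasure_eq_measure ennreal_mult'')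
qed

lemma innovation_past:
  assumes u: "0 < u" "u < K" and Y: "Y \<in> borel_measurable (past (dyadic m k))"
  shows "(\<integral>\<^sup>+\<omega>. Y \<omega> * ennreal (exp (u * innovation m k \<omega>)) \<partial>M) = (\<integral>\<^sup>+\<omega>. Y \<omega> \<partial>M) * ennreal (exp (phi u - phi (decay m * u)))"
  using Y
proof (induction rule: borel_measurable_induct)
  case (cong f g)
  have "(\<integral>\<^sup>+\<omega>. f \<omega> * ennreal (exp (u * innovation m k \<omega>)) \<partial>M) = (\<integral>\<^sup>+\<omega>. g \<omega> * ennreal (exp (u * innovation m k \<omega>)) \<partial>M)" 
    "(\<integral>\<^sup>+\<omega>. f \<omega> \<partial>M) = (\<integral>\<^sup>+\<omega>. g \<omega> \<partial>M)"
    using cong(3) by (auto intro!: nn_integral_cong)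
  then show ?case using cong(4) by simp
next
  case (set A)
  then have "A \<in> sets M" using sets_past_subset by auto
  then show ?case using innovation_past_sets[OF u set] by simp
next
  case (mult f c)
  note [measurable] = past_measurableD[OF \<open>f \<in> borel_measurable (past (dyadic m k))\<close>]
  show ?case using mult(4) by (simp add: nn_integral_cmult mult.assoc)
next
  case (add f g)
  note [measurable] = past_measurableD[OF \<open>f \<in> borel_measurable (past (dyadic m k))\<close>] past_measurableD[OF \<open>g \<in> borel_measurable (past (dyadic m k))\<close>]
  show ?case using add by (simp add: nn_integral_add distrib_right)
next
  case (seq U)
  note [measurable] = past_measurableD[OF seq(1)]
  have inc: "incseq U" using seq(3) .
  have "(\<integral>\<^sup>+\<omega>. (SUP i. U i) \<omega> * ennreal (exp (u * innovation m k \<omega>)) \<partial>M) = (\<integral>\<^sup>+\<omega>. (SUP i. U i \<omega> * ennreal (exp (u * innovation m k \<omega>))) \<partial>M)"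
    by (simp add: SUP_apply SUP_mult_right_ennreal image_comp comp_def)
  also have "\<dots> = (SUP i. (\<integral>\<^sup>+\<omega>. U i \<omega> * ennreal (exp (u * innovation m k \<omega>)) \<partial>M))"
    using inc by (intro nn_integral_monotone_convergence_SUP) (auto simp: incseq_def le_fun_def intro!: mult_right_mono)
  also have "\<dots> = (SUP i. (\<integral>\<^sup>+\<omega>. U i \<omega> \<partial>M)) * ennreal (exp (phi u - phi (decay m * u)))"
    using seq(5) by (simp add: SUP_mult_right_ennreal)
  also have "(SUP i. (\<integral>\<^sup>+\<omega>. U i \<omega> \<partial>M)) = (\<integral>\<^sup>+\<omega>. (SUP i. U i) \<omega> \<partial>M)"
    using inc by (simp add: SUP_apply image_comp comp_def nn_integral_monotone_convergence_SUP)
  finally show ?case using seq by simp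
qed

end

section \<open>Dynkin's formula on a dyadic grid\<close>

context levy_ou
begin

section \<open>The normalised exponentials and their one-step transition\<close>

definition tilt :: "real \<Rightarrow> real \<Rightarrow> real" where "tilt u y = exp (u * y - phi u)"

lemma tilt_pos [simp]: "0 < tilt u y" and tilt_nonneg [simp]: "0 \<le> tilt u y" by (simp_all add: tilt_def)

lemma tilt_measurable [measurable]: "tilt u \<in> borel_measurable borel"
  unfolding tilt_def[abs_def] by measurable

lemma X_step: "X (dyadic m (Suc k)) \<omega> = decay m * X (dyadic m k) \<omega> + innovation m k \<omega>"
  by (simp add: innovation_def)

lemma decay_mult: "0 < u \<Longrightarrow> u < K \<Longrightarrow> 0 < decay m * u \<and> decay m * u < K"
  by (metis mult_left_le_one_le mult_pos_pos decay_pos decay_le_1 less_imp_le le_less_trans)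

text \<open>Given the past, \<open>exp (u * innovation m k \<omega>)\<close> averages to
  \<open>exp (phi u - phi (decay m * u))\<close>. The normalisation \<open>- phi u\<close> cancels,
  and what is left is the normalisation belonging to the exponent
  \<open>decay m * u\<close>.\<close>

lemma tilt_step:
  assumes u: "0 < u" "u < K" and A: "A \<in> sets (past (dyadic m k))"
  shows "(\<integral>\<^sup>+\<omega>. indicator A \<omega> * ennreal (tilt u (X (dyadic m (Suc k)) \<omega>)) \<partial>M) = (\<integral>\<^sup>+\<omega>. indicator A \<omega> * ennreal (tilt (decay m * u) (X (dyadic m k) \<omega>)) \<partial>M)"
proof -
  have A': "A \<in> sets M" using A sets_past_subset by auto
  define Y where "Y \<omega> = indicator A \<omega> * ennreal (exp (u * decay m * X (dyadic m k) \<omega> - phi u))" for \<omega>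
  have [measurable]: "X (dyadic m k) \<in> borel_measurable (past (dyadic m k))" by (rule X_past) simp
  have [measurable]: "indicator A \<in> borel_measurable (past (dyadic m k))" using A by simp
  have Y: "Y \<in> borel_measurable (past (dyadic m k))" unfolding Y_def by measurable
  note [measurable] = past_measurableD[OF Y]
  have "(\<integral>\<^sup>+\<omega>. indicator A \<omega> * ennreal (tilt u (X (dyadic m (Suc k)) \<omega>)) \<partial>M) = (\<integral>\<^sup>+\<omega>. Y \<omega> * ennreal (exp (u * innovation m k \<omega>)) \<partial>M)"
    unfolding Y_def X_step tilt_def
    by (intro nn_integral_cong) (simp add: mult.assoc ennreal_mult[symmetric] exp_add[symmetric] algebra_simps)
  also have "\<dots> = (\<integral>\<^sup>+\<omega>. Y \<omega> * ennreal (exp (phi u - phi (decay m * u))) \<partial>M)"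
    by (subst innovation_past[OF u Y]) (simp add: nn_integral_multc)
  also have "\<dots> = (\<integral>\<^sup>+\<omega>. indicator A \<omega> * ennreal (tilt (decay m * u) (X (dyadic m k) \<omega>)) \<partial>M)"
    unfolding Y_def tilt_def
    by (intro nn_integral_cong) (simp add: mult.assoc ennreal_mult[symmetric] exp_add[symmetric] algebra_simps)
  finally show ?thesis .
qed

lemma stopped_measurable:
  fixes T :: "'a \<Rightarrow> nat"
  assumes "\<And>k. {\<omega>\<in>space M. k < T \<omega>} \<in> sets M"
  shows "T \<in> measurable M (count_space UNIV)"
proof -
  have "T -` {k} \<inter> space M \<in> sets M" for k
  proof -
    have "T -` {k} \<inter> space M = (if k = 0 then space M else {\<omega>\<in>space M. k - 1 < T \<omega>}) - {\<omega>\<in>space M. k < T \<omega>}"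
      by auto
    also have "\<dots> \<in> sets M" using assms by auto
    finally show ?thesis .
  qed
  then show ?thesis using measurable_count_space_eq2_countable[where A=UNIV and f=T and M=M] by auto
qed

lemma X_stopped_measurable:
  assumes "T \<in> measurable M (count_space UNIV)"
  shows "(\<lambda>\<omega>. X (dyadic m (T \<omega>)) \<omega>) \<in> borel_measurable M"
  by (rule measurable_compose_countable[OF _ assms]) simp

text \<open>Finiteness of the stopped moment is not known yet, so nothing is subtracted and terms
  with a minus sign stand on the other side. In the induction step the value at \<open>n\<close> is
  exchanged for the value at \<open>Suc n\<close> on \<open>{n < T}\<close>, and the one-step
  formula applies because this event lies in the past of \<open>n\<close>.\<close>

lemma Dynkin_discrete:
  assumes u: "0 < u" "u < K" and T: "\<And>k. {\<omega>\<in>space M. k < T \<omega>} \<in> sets (past (dyadic m k))"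
  shows "(\<integral>\<^sup>+\<omega>. ennreal (tilt u (X (dyadic m (min n (T \<omega>))) \<omega>)) \<partial>M) 
      + (\<Sum>j<n. \<integral>\<^sup>+\<omega>. indicator {\<omega>. j < T \<omega>} \<omega> * ennreal (tilt u (X (dyadic m j) \<omega>)) \<partial>M)
    = ennreal (tilt u x) + (\<Sum>j<n. \<integral>\<^sup>+\<omega>. indicator {\<omega>. j < T \<omega>} \<omega> * ennreal (tilt (decay m * u) (X (dyadic m j) \<omega>)) \<partial>M)"
proof (induction n)
  case 0
  have "(\<integral>\<^sup>+\<omega>. ennreal (tilt u (X 0 \<omega>)) \<partial>M) = (\<integral>\<^sup>+\<omega>. ennreal (tilt u x) \<partial>M)"
    by (rule nn_integral_cong) (simp add: X_0)
  then show ?case by (simp add: emeasure_space_1)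
next
  case (Suc n)
  have Tm: "{\<omega>\<in>space M. k < T \<omega>} \<in> sets M" for k using T[of k] sets_past_subset by auto
  note [measurable] = stopped_measurable[OF Tm]
  have [measurable]: "(\<lambda>\<omega>. X (dyadic m (min k (T \<omega>))) \<omega>) \<in> borel_measurable M" for k
    by (rule X_stopped_measurable) simp
  have [measurable]: "Measurable.pred M (\<lambda>\<omega>. k < T \<omega>)" for k using Tm by (simp add: pred_def)
  let ?E = "\<lambda>v j. \<integral>\<^sup>+\<omega>. indicator {\<omega>. n < T \<omega>} \<omega> * ennreal (tilt v (X (dyadic m j) \<omega>)) \<partial>M"
  have ind: "(\<integral>\<^sup>+\<omega>. indicator {\<omega>\<in>space M. n < T \<omega>} \<omega> * ennreal (tilt v (X (dyadic m j) \<omega>)) \<partial>M) = ?E v j" for v j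
    by (intro nn_integral_cong) (simp add: indicator_def)
  have "(\<integral>\<^sup>+\<omega>. ennreal (tilt u (X (dyadic m (min (Suc n) (T \<omega>))) \<omega>)) \<partial>M) + ?E u n
      = (\<integral>\<^sup>+\<omega>. ennreal (tilt u (X (dyadic m (min (Suc n) (T \<omega>))) \<omega>)) + indicator {\<omega>. n < T \<omega>} \<omega> * ennreal (tilt u (X (dyadic m n) \<omega>)) \<partial>M)"
    by (rule nn_integral_add[symmetric]) measurable
  also have "\<dots> = (\<integral>\<^sup>+\<omega>. ennreal (tilt u (X (dyadic m (min n (T \<omega>))) \<omega>)) + indicator {\<omega>. n < T \<omega>} \<omega> * ennreal (tilt u (X (dyadic m (Suc n)) \<omega>)) \<partial>M)"
  proof (rule nn_integral_cong)
    fix \<omega>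
    show "ennreal (tilt u (X (dyadic m (min (Suc n) (T \<omega>))) \<omega>)) + indicator {\<omega>. n < T \<omega>} \<omega> * ennreal (tilt u (X (dyadic m n) \<omega>))
       = ennreal (tilt u (X (dyadic m (min n (T \<omega>))) \<omega>)) + indicator {\<omega>. n < T \<omega>} \<omega> * ennreal (tilt u (X (dyadic m (Suc n)) \<omega>))"
      by (cases "n < T \<omega>") (simp_all add: min_def add.commute not_less_eq_eq)
  qed
  also have "\<dots> = (\<integral>\<^sup>+\<omega>. ennreal (tilt u (X (dyadic m (min n (T \<omega>))) \<omega>)) \<partial>M) + ?E u (Suc n)"
    by (rule nn_integral_add) measurable
  also have "?E u (Suc n) = ?E (decay m * u) n"
    using tilt_step[OF u T[of n]] unfolding ind .
  finally have step: "(\<integral>\<^sup>+\<omega>. ennreal (tilt u (X (dyadic m (min (Suc n) (T \<omega>))) \<omega>)) \<partial>M) + ?E u n = 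
     (\<integral>\<^sup>+\<omega>. ennreal (tilt u (X (dyadic m (min n (T \<omega>))) \<omega>)) \<partial>M) + ?E (decay m * u) n" .
  have alg: "a' + (P + p) = c + (Q + q)" if "a' + p = a + q" "a + P = c + Q" for a a' p q c P Q :: ennreal
  proof -
    have "a' + (P + p) = (a' + p) + P" by (simp only: ac_simps)
    also have "\<dots> = (a + P) + q" unfolding that(1) by (simp only: ac_simps)
    also have "\<dots> = c + (Q + q)" unfolding that(2) by (simp only: ac_simps)
    finally show ?thesis .
  qed
  show ?case unfolding sum.lessThan_Suc by (rule alg[OF step Suc.IH])
qed

lemma tilt_bounded: assumes "0 \<le> u" "y \<le> b" shows "tilt u y \<le> tilt u b"
  using assms by (simp add: tilt_def mult_left_mono)

text \<open>A sum over \<open>N * 2^m\<close> steps then stays below \<open>N * C\<close> whatever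
  the mesh. The bound is the mean value theorem in the exponent, whose increment
  \<open>u - decay m * u\<close> is at most \<open>u * \<beta> / 2^m\<close>. The half-line
  \<open>y \<le> b\<close> is enough because only positions before stopping are inserted.\<close>

lemma tilt_increment_bound:
  assumes u: "0 < u" "u < K"
  obtains C where "C \<ge> 0" "\<And>m y. y \<le> b \<Longrightarrow> \<bar>tilt (decay m * u) y - tilt u y\<bar> \<le> C / 2^m"
proof -
  \<comment> \<open>The smallest exponent that occurs for any \<open>m\<close>, so that one constant
    serves all meshes.\<close>
  define w0 where "w0 = decay 0 * u"
  have w0: "0 < w0" "w0 < u" using u by (simp_all add: w0_def)
  obtain C0 where C0: "C0 \<ge> 0" "\<And>v. 0 \<le> v \<Longrightarrow> v < K \<Longrightarrow> exp (- phi v) \<le> C0" using phi_bounded_below by blast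
  have "compact ((\<lambda>w. psi w / (\<beta> * w)) ` {w0..u})"
    using w0 u beta_pos
    by (intro compact_continuous_image continuous_intros continuous_on_subset[OF psi_continuous]) auto
  then obtain P where P: "\<And>w. w \<in> {w0..u} \<Longrightarrow> \<bar>psi w / (\<beta> * w)\<bar> \<le> P"
    by (meson bounded_real compact_imp_bounded image_eqI)
  have P0: "P \<ge> 0" using order_trans[OF abs_ge_zero P[of u]] w0 by simp
  define C1 where "C1 = C0 * (exp (K * \<bar>b\<bar>) * (\<bar>b\<bar> + P) + (P + 1 / w0))"
  have C1: "C1 \<ge> 0" unfolding C1_def using C0 P0 w0 by (intro mult_nonneg_nonneg add_nonneg_nonneg) auto
  \<comment> \<open>The derivative in the exponent brings in a factor linear in \<open>y\<close>.
    For \<open>y \<ge> 0\<close> everything is bounded by its value at \<open>\<bar>b\<bar>\<close>;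
    for \<open>y < 0\<close> the linear factor is absorbed by
    \<open>exp (w * y) * \<bar>y\<bar> \<le> 1 / w\<close>.\<close>
  have D: "\<bar>tilt w y * (y - psi w / (\<beta> * w))\<bar> \<le> C1" if w: "w \<in> {w0..u}" and y: "y \<le> b" for w y
  proof -
    have wK: "0 < w" "w < K" using w w0 u by auto
    have yP: "\<bar>y - psi w / (\<beta> * w)\<bar> \<le> \<bar>y\<bar> + P" using P[OF w] by linarith
    have "exp (w * y) * (\<bar>y\<bar> + P) \<le> exp (K * \<bar>b\<bar>) * (\<bar>b\<bar> + P) + (P + 1 / w0)"
    proof (cases "y \<ge> 0")
      case True
      then have "w * y \<le> K * \<bar>b\<bar>" using wK y by (intro mult_mono) auto
      then have "exp (w * y) * (\<bar>y\<bar> + P) \<le> exp (K * \<bar>b\<bar>) * (\<bar>b\<bar> + P)"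
        using True y P0 by (intro mult_mono) auto
      then show ?thesis using P0 w0 by (simp add: add_increasing2)
    next
      case False
      have "w * \<bar>y\<bar> \<le> exp (w * \<bar>y\<bar>)" using exp_ge_add_one_self[of "w * \<bar>y\<bar>"] by linarith
      then have "exp (w * y) * \<bar>y\<bar> \<le> 1 / w" 
        using False wK by (simp add: exp_minus field_simps)
      also have "\<dots> \<le> 1 / w0" using w w0 by (intro divide_left_mono) auto
      finally have 1: "exp (w * y) * \<bar>y\<bar> \<le> 1 / w0" .
      have "exp (w * y) \<le> 1" using False wK by (simp add: mult_le_0_iff)
      then have "exp (w * y) * P \<le> P" using P0 by (simp add: mult_left_le_one_le)
      with 1 have "exp (w * y) * (\<bar>y\<bar> + P) \<le> P + 1 / w0" by (simp add: distrib_left)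
      moreover have "0 \<le> exp (K * \<bar>b\<bar>) * (\<bar>b\<bar> + P)" using P0 by simp
      ultimately show ?thesis by linarith
    qed
    moreover have "\<bar>tilt w y * (y - psi w / (\<beta> * w))\<bar> \<le> exp (- phi w) * (exp (w * y) * (\<bar>y\<bar> + P))"
    proof -
      have "tilt w y = exp (- phi w) * exp (w * y)" by (simp add: tilt_def exp_add[symmetric])
      then have "\<bar>tilt w y * (y - psi w / (\<beta> * w))\<bar> = exp (- phi w) * (exp (w * y) * \<bar>y - psi w / (\<beta> * w)\<bar>)"
        by (simp only: abs_mult abs_exp_cancel mult.assoc)
      also have "\<dots> \<le> exp (- phi w) * (exp (w * y) * (\<bar>y\<bar> + P))"
        using yP by (intro mult_left_mono) auto
      finally show ?thesis .
    qed
    moreover have "exp (- phi w) * (exp (w * y) * (\<bar>y\<bar> + P)) \<le> C0 * (exp (w * y) * (\<bar>y\<bar> + P))"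
      using C0(2)[of w] wK P0 by (intro mult_right_mono) auto
    ultimately show ?thesis unfolding C1_def using C0(1) mult_left_mono by (meson order_trans)
  qed
  show ?thesis
  proof (rule that[of "C1 * (u * \<beta>)"])
    show "C1 * (u * \<beta>) \<ge> 0" using C1 u beta_pos by simp
    fix m y assume y: "y \<le> b"
    have "decay 0 \<le> decay m" using beta_pos by (simp add: decay_def divide_le_eq)
    then have le: "w0 \<le> decay m * u" "decay m * u < u" using u by (simp_all add: w0_def mult_right_mono)
    have "\<exists>z. decay m * u < z \<and> z < u \<and> tilt u y - tilt (decay m * u) y = (u - decay m * u) * (tilt z y * (y - psi z / (\<beta> * z)))"
    proof (rule MVT2[OF le(2)])
      fix w assume "decay m * u \<le> w" "w \<le> u"
      then have "0 < w" "w < K" using le w0 u by auto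
      from phi_DERIV[OF this] show "((\<lambda>w. tilt w y) has_real_derivative tilt w y * (y - psi w / (\<beta> * w))) (at w)"
        unfolding tilt_def by (auto intro!: derivative_eq_intros)
    qed
    then obtain z where z: "decay m * u < z" "z < u" "tilt u y - tilt (decay m * u) y = (u - decay m * u) * (tilt z y * (y - psi z / (\<beta> * z)))" by blast
    have "1 - decay m \<le> \<beta> / 2^m" using exp_ge_add_one_self[of "- \<beta> / 2^m"] by (simp add: decay_def)
    then have "u * (1 - decay m) \<le> u * (\<beta> / 2^m)" using u by (intro mult_left_mono) auto
    then have ur: "u - decay m * u \<le> u * \<beta> / 2^m" by (simp add: right_diff_distrib mult.commute)
    have "\<bar>tilt (decay m * u) y - tilt u y\<bar> = (u - decay m * u) * \<bar>tilt z y * (y - psi z / (\<beta> * z))\<bar>"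
      using z(3) le(2) by (subst abs_minus_commute) (simp add: abs_mult)
    also have "\<dots> \<le> (u * \<beta> / 2^m) * C1"
      using D[of z y] z le ur y u beta_pos by (intro mult_mono) auto
    finally show "\<bar>tilt (decay m * u) y - tilt u y\<bar> \<le> C1 * (u * \<beta>) / 2^m" by (simp add: mult.commute)
  qed
qed

text \<open>Measurability is asked at dyadic times only, where the grid formula needs it. The path
  is bounded by \<open>b\<close> strictly before \<open>s\<close>; the position at \<open>s\<close>
  is unrestricted and may overshoot.\<close>

definition stopping :: "real \<Rightarrow> nat \<Rightarrow> ('a \<Rightarrow> real) \<Rightarrow> bool" where
  "stopping b N s \<longleftrightarrow> (\<forall>\<omega>\<in>space M. 0 \<le> s \<omega> \<and> s \<omega> \<le> real N) \<and>
     (\<forall>m k. {\<omega>\<in>space M. dyadic m k < s \<omega>} \<in> sets (past (dyadic m k))) \<and>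
     (\<forall>\<omega>\<in>space M. \<forall>q. 0 \<le> q \<and> q < s \<omega> \<longrightarrow> X q \<omega> \<le> b)"

text \<open>Rounding up makes the discretised time a stopping time of the grid, because
  \<open>k < grid_index m s \<omega>\<close> means \<open>dyadic m k < s \<omega>\<close>, and it
  approaches \<open>s\<close> from the right, where the paths are continuous.\<close>

definition grid_index :: "nat \<Rightarrow> ('a \<Rightarrow> real) \<Rightarrow> 'a \<Rightarrow> nat" where "grid_index m s \<omega> = nat \<lceil>s \<omega> * 2^m\<rceil>"

lemma less_grid_index_iff: "k < grid_index m s \<omega> \<longleftrightarrow> dyadic m k < s \<omega>"
proof -
  have "k < grid_index m s \<omega> \<longleftrightarrow> int k < \<lceil>s \<omega> * 2^m\<rceil>" unfolding grid_index_def by linarith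
  also have "\<dots> \<longleftrightarrow> real k < s \<omega> * 2^m" by (simp add: less_ceiling_iff)
  finally show ?thesis by (simp add: dyadic_def field_simps)
qed

section \<open>Dynkin's formula at a discretised stopping time\<close>

context
  fixes b N s assumes s: "stopping b N s"
begin

lemma stopping_range: "\<omega> \<in> space M \<Longrightarrow> 0 \<le> s \<omega>" "\<omega> \<in> space M \<Longrightarrow> s \<omega> \<le> real N"
  using s unfolding stopping_def by auto

lemma grid_index_le: "\<omega> \<in> space M \<Longrightarrow> grid_index m s \<omega> \<le> N * 2^m"
  using stopping_range[of \<omega>] unfolding grid_index_def by (simp add: ceiling_le_iff)

lemma dyadic_grid_index: assumes "\<omega> \<in> space M" shows "s \<omega> \<le> dyadic m (grid_index m s \<omega>)" "dyadic m (grid_index m s \<omega>) < s \<omega> + 1 / 2^m"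
proof -
  have "0 \<le> s \<omega> * 2^m" using stopping_range[OF assms] by simp
  then have r: "real (grid_index m s \<omega>) = of_int \<lceil>s \<omega> * 2^m\<rceil>" unfolding grid_index_def by (simp add: of_nat_nat)
  show "s \<omega> \<le> dyadic m (grid_index m s \<omega>)" unfolding dyadic_def r by (simp add: field_simps)
  have "of_int \<lceil>s \<omega> * 2^m\<rceil> < s \<omega> * 2^m + 1" by linarith
  then show "dyadic m (grid_index m s \<omega>) < s \<omega> + 1 / 2^m" unfolding dyadic_def r by (simp add: field_simps)
qed

lemma dyadic_grid_index_tendsto: assumes "\<omega> \<in> space M" shows "(\<lambda>m. dyadic m (grid_index m s \<omega>)) \<longlonglongrightarrow> s \<omega>"
proof (rule tendsto_sandwich[OF _ _ tendsto_const])
  show "(\<lambda>m. s \<omega> + 1 / 2^m) \<longlonglongrightarrow> s \<omega>"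
    using tendsto_add[OF tendsto_const LIMSEQ_power_zero[of "1/2::real"], of "s \<omega>"] by (simp add: power_divide)
qed (intro always_eventually allI dyadic_grid_index less_imp_le assms)+

lemma X_grid_index_tendsto: "\<omega> \<in> space M \<Longrightarrow> (\<lambda>m. X (dyadic m (grid_index m s \<omega>)) \<omega>) \<longlonglongrightarrow> X (s \<omega>) \<omega>"
  by (rule right_continuous_seq[OF X_right dyadic_grid_index_tendsto]) (auto intro: stopping_range dyadic_grid_index)

lemma grid_index_past: "{\<omega>\<in>space M. k < grid_index m s \<omega>} \<in> sets (past (dyadic m k))"
  using s unfolding less_grid_index_iff stopping_def by auto

lemma grid_index_measurable [measurable]: "grid_index m s \<in> measurable M (count_space UNIV)"
  by (rule stopped_measurable) (use grid_index_past sets_past_subset in blast)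

lemma X_grid_index_measurable [measurable]: "(\<lambda>\<omega>. X (dyadic m (grid_index m s \<omega>)) \<omega>) \<in> borel_measurable M"
  by (rule X_stopped_measurable) simp

lemma stopping_measurable: "s \<in> borel_measurable M"
  by (rule borel_measurable_LIMSEQ_real[OF dyadic_grid_index_tendsto]) (auto simp: dyadic_def)

lemma X_stopping_measurable: "(\<lambda>\<omega>. X (s \<omega>) \<omega>) \<in> borel_measurable M"
  by (rule borel_measurable_LIMSEQ_real[OF X_grid_index_tendsto]) auto

lemma X_before: "\<omega> \<in> space M \<Longrightarrow> j < grid_index m s \<omega> \<Longrightarrow> X (dyadic m j) \<omega> \<le> b"
  using s unfolding less_grid_index_iff stopping_def by auto

lemma Dynkin_grid_index:
  assumes u: "0 < u" "u < K"
  shows "(\<integral>\<^sup>+\<omega>. ennreal (tilt u (X (dyadic m (grid_index m s \<omega>)) \<omega>)) \<partial>M) 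
      + (\<Sum>j<N * 2^m. \<integral>\<^sup>+\<omega>. indicator {\<omega>. j < grid_index m s \<omega>} \<omega> * ennreal (tilt u (X (dyadic m j) \<omega>)) \<partial>M)
    = ennreal (tilt u x) + (\<Sum>j<N * 2^m. \<integral>\<^sup>+\<omega>. indicator {\<omega>. j < grid_index m s \<omega>} \<omega> * ennreal (tilt (decay m * u) (X (dyadic m j) \<omega>)) \<partial>M)"
proof -
  have "(\<integral>\<^sup>+\<omega>. ennreal (tilt u (X (dyadic m (grid_index m s \<omega>)) \<omega>)) \<partial>M) = (\<integral>\<^sup>+\<omega>. ennreal (tilt u (X (dyadic m (min (N * 2^m) (grid_index m s \<omega>))) \<omega>)) \<partial>M)"
    by (rule nn_integral_cong) (simp add: grid_index_le min_absorb2)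
  then show ?thesis using Dynkin_discrete[OF u grid_index_past] by simp
qed

lemma grid_index_pred [measurable]: "Measurable.pred M (\<lambda>\<omega>. j < grid_index m s \<omega>)"
  by simp

lemma before_integrable:
  assumes u: "0 \<le> u"
  shows "integrable M (\<lambda>\<omega>. indicat_real {\<omega>. j < grid_index m s \<omega>} \<omega> * tilt u (X (dyadic m j) \<omega>))"
  by (rule integrable_const_bound[where B="tilt u b"])
     (use tilt_bounded[OF u X_before] in \<open>auto intro!: AE_I2 simp: indicator_def\<close>)

text \<open>Before stopping the process is at most \<open>b\<close>, so the sums over earlier times
  are finite. The extended identity then forces the stopped moment to be finite too, and subtraction
  becomes legitimate.\<close>

lemma Dynkin_real:
  assumes u: "0 < u" "u < K"
  shows "integrable M (\<lambda>\<omega>. tilt u (X (dyadic m (grid_index m s \<omega>)) \<omega>))"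
    "expectation (\<lambda>\<omega>. tilt u (X (dyadic m (grid_index m s \<omega>)) \<omega>)) = tilt u x + 
      expectation (\<lambda>\<omega>. \<Sum>j<N * 2^m. indicator {\<omega>. j < grid_index m s \<omega>} \<omega> * (tilt (decay m * u) (X (dyadic m j) \<omega>) - tilt u (X (dyadic m j) \<omega>)))"
proof -
  let ?I = "\<lambda>v j. expectation (\<lambda>\<omega>. indicat_real {\<omega>. j < grid_index m s \<omega>} \<omega> * tilt v (X (dyadic m j) \<omega>))"
  have nn: "(\<integral>\<^sup>+\<omega>. indicator {\<omega>. j < grid_index m s \<omega>} \<omega> * ennreal (tilt v (X (dyadic m j) \<omega>)) \<partial>M) = ennreal (?I v j)" if "0 \<le> v" for v j
  proof -
    have "(\<integral>\<^sup>+\<omega>. indicator {\<omega>. j < grid_index m s \<omega>} \<omega> * ennreal (tilt v (X (dyadic m j) \<omega>)) \<partial>M) = (\<integral>\<^sup>+\<omega>. ennreal (indicat_real {\<omega>. j < grid_index m s \<omega>} \<omega> * tilt v (X (dyadic m j) \<omega>)) \<partial>M)"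
      by (rule nn_integral_cong) (simp split: split_indicator)
    also have "\<dots> = ennreal (?I v j)"
      by (rule nn_integral_eq_integral[OF before_integrable[OF that]]) simp
    finally show ?thesis .
  qed
  have pos: "0 \<le> ?I v j" for v j by (rule Bochner_Integration.integral_nonneg) simp
  have u': "0 \<le> decay m * u" "0 \<le> u" using u by (simp_all add: less_imp_le)
  have D: "(\<integral>\<^sup>+\<omega>. ennreal (tilt u (X (dyadic m (grid_index m s \<omega>)) \<omega>)) \<partial>M) + ennreal (\<Sum>j<N * 2^m. ?I u j) = ennreal (tilt u x + (\<Sum>j<N * 2^m. ?I (decay m * u) j))"
  proof -
    have sums: "(\<Sum>j<N * 2^m. \<integral>\<^sup>+\<omega>. indicator {\<omega>. j < grid_index m s \<omega>} \<omega> * ennreal (tilt v (X (dyadic m j) \<omega>)) \<partial>M) = ennreal (\<Sum>j<N * 2^m. ?I v j)" if "0 \<le> v" for v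
      unfolding nn[OF that] by (rule sum_ennreal) (rule pos)
    have "0 \<le> (\<Sum>j<N * 2^m. ?I (decay m * u) j)" by (rule sum_nonneg) (rule pos)
    then have pl: "ennreal (tilt u x + (\<Sum>j<N * 2^m. ?I (decay m * u) j)) = ennreal (tilt u x) + ennreal (\<Sum>j<N * 2^m. ?I (decay m * u) j)"
      by (intro ennreal_plus) auto
    have D0: "(\<integral>\<^sup>+\<omega>. ennreal (tilt u (X (dyadic m (grid_index m s \<omega>)) \<omega>)) \<partial>M) 
      + (\<Sum>j<N * 2^m. \<integral>\<^sup>+\<omega>. indicator {\<omega>. j < grid_index m s \<omega>} \<omega> * ennreal (tilt u (X (dyadic m j) \<omega>)) \<partial>M)
    = ennreal (tilt u x) + (\<Sum>j<N * 2^m. \<integral>\<^sup>+\<omega>. indicator {\<omega>. j < grid_index m s \<omega>} \<omega> * ennreal (tilt (decay m * u) (X (dyadic m j) \<omega>)) \<partial>M)"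
      by (rule Dynkin_grid_index[OF u])
    have s1: "(\<Sum>j<N * 2^m. \<integral>\<^sup>+\<omega>. indicator {\<omega>. j < grid_index m s \<omega>} \<omega> * ennreal (tilt u (X (dyadic m j) \<omega>)) \<partial>M) = ennreal (\<Sum>j<N * 2^m. ?I u j)"
      by (rule sums[OF u'(2)])
    have s2: "(\<Sum>j<N * 2^m. \<integral>\<^sup>+\<omega>. indicator {\<omega>. j < grid_index m s \<omega>} \<omega> * ennreal (tilt (decay m * u) (X (dyadic m j) \<omega>)) \<partial>M) = ennreal (\<Sum>j<N * 2^m. ?I (decay m * u) j)"
      by (rule sums[OF u'(1)])
    show ?thesis using D0 unfolding s1 s2 pl .
  qed
  have "(\<integral>\<^sup>+\<omega>. ennreal (tilt u (X (dyadic m (grid_index m s \<omega>)) \<omega>)) \<partial>M) \<le> (\<integral>\<^sup>+\<omega>. ennreal (tilt u (X (dyadic m (grid_index m s \<omega>)) \<omega>)) \<partial>M) + ennreal (\<Sum>j<N * 2^m. ?I u j)"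
    by (rule add_increasing2) auto
  then have "(\<integral>\<^sup>+\<omega>. ennreal (tilt u (X (dyadic m (grid_index m s \<omega>)) \<omega>)) \<partial>M) < \<infinity>"
    unfolding D by (rule le_less_trans) simp
  then show int: "integrable M (\<lambda>\<omega>. tilt u (X (dyadic m (grid_index m s \<omega>)) \<omega>))"
    by (intro integrableI_nonneg) auto
  have pos2: "0 \<le> expectation (\<lambda>\<omega>. tilt u (X (dyadic m (grid_index m s \<omega>)) \<omega>))" by (rule Bochner_Integration.integral_nonneg) simp
  have "expectation (\<lambda>\<omega>. tilt u (X (dyadic m (grid_index m s \<omega>)) \<omega>)) + (\<Sum>j<N * 2^m. ?I u j) = tilt u x + (\<Sum>j<N * 2^m. ?I (decay m * u) j)"
  proof -
    have p: "0 \<le> (\<Sum>j<N * 2^m. ?I v j)" for v by (rule sum_nonneg) (rule pos)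
    have "ennreal (expectation (\<lambda>\<omega>. tilt u (X (dyadic m (grid_index m s \<omega>)) \<omega>)) + (\<Sum>j<N * 2^m. ?I u j)) = ennreal (tilt u x + (\<Sum>j<N * 2^m. ?I (decay m * u) j))"
      unfolding D[symmetric] ennreal_plus[OF pos2 p] by (subst nn_integral_eq_integral[OF int]) auto
    moreover have "0 \<le> tilt u x + (\<Sum>j<N * 2^m. ?I (decay m * u) j)" using p by (intro add_nonneg_nonneg) auto
    ultimately show ?thesis using pos2 p[of u] by (subst (asm) ennreal_inj) auto
  qed
  moreover have "expectation (\<lambda>\<omega>. \<Sum>j<N * 2^m. indicator {\<omega>. j < grid_index m s \<omega>} \<omega> * (tilt (decay m * u) (X (dyadic m j) \<omega>) - tilt u (X (dyadic m j) \<omega>)))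
     = (\<Sum>j<N * 2^m. ?I (decay m * u) j) - (\<Sum>j<N * 2^m. ?I u j)"
  proof -
    have "(\<Sum>j<N * 2^m. ?I (decay m * u) j) - (\<Sum>j<N * 2^m. ?I u j) = (\<Sum>j<N * 2^m. ?I (decay m * u) j - ?I u j)"
      by (rule sum_subtractf[symmetric])
    also have "\<dots> = (\<Sum>j<N * 2^m. expectation (\<lambda>\<omega>. indicator {\<omega>. j < grid_index m s \<omega>} \<omega> * (tilt (decay m * u) (X (dyadic m j) \<omega>) - tilt u (X (dyadic m j) \<omega>))))"
      unfolding right_diff_distrib
      by (intro sum.cong refl Bochner_Integration.integral_diff[symmetric] before_integrable u')
    also have "\<dots> = expectation (\<lambda>\<omega>. \<Sum>j<N * 2^m. indicator {\<omega>. j < grid_index m s \<omega>} \<omega> * (tilt (decay m * u) (X (dyadic m j) \<omega>) - tilt u (X (dyadic m j) \<omega>)))"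
      unfolding right_diff_distrib
      by (intro Bochner_Integration.integral_sum[symmetric] Bochner_Integration.integrable_diff before_integrable u')
    finally show ?thesis by (rule sym)
  qed
  ultimately show "expectation (\<lambda>\<omega>. tilt u (X (dyadic m (grid_index m s \<omega>)) \<omega>)) = tilt u x + 
      expectation (\<lambda>\<omega>. \<Sum>j<N * 2^m. indicator {\<omega>. j < grid_index m s \<omega>} \<omega> * (tilt (decay m * u) (X (dyadic m j) \<omega>) - tilt u (X (dyadic m j) \<omega>)))"
    by simp
qed

lemma sum_before: "\<omega> \<in> space M \<Longrightarrow> (\<Sum>j<N * 2^m. indicat_real {\<omega>. j < grid_index m s \<omega>} \<omega>) = real (grid_index m s \<omega>)"
proof -
  assume w: "\<omega> \<in> space M"
  have "(\<Sum>j<N * 2^m. indicat_real {\<omega>. j < grid_index m s \<omega>} \<omega>) = (\<Sum>j<N * 2^m. if j \<in> {..<grid_index m s \<omega>} then 1 else 0)"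
    by (intro sum.cong) (auto simp: indicator_def)
  also have "\<dots> = real (card ({..<N * 2^m} \<inter> {..<grid_index m s \<omega>}))" by (subst sum.inter_restrict[symmetric]) auto
  also have "{..<N * 2^m} \<inter> {..<grid_index m s \<omega>} = {..<grid_index m s \<omega>}" using grid_index_le[OF w, of m] by auto
  finally show ?thesis by simp
qed

end

text \<open>At most \<open>N * 2^m\<close> steps contribute at most \<open>C / 2^m\<close> each. The
  constant is chosen before \<open>s\<close> and \<open>m\<close>, so it can be used along refining
  grids and for a whole family of passage times.\<close>

lemma stopping_moment_bound:
  assumes u: "0 < u" "u < K"
  obtains C where "C \<ge> 0" "\<And>s m. stopping b N s \<Longrightarrow> (\<integral>\<^sup>+\<omega>. ennreal (exp (u * X (dyadic m (grid_index m s \<omega>)) \<omega>)) \<partial>M) \<le> ennreal C"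
proof -
  obtain C where C: "C \<ge> 0" "\<And>m y. y \<le> b \<Longrightarrow> \<bar>tilt (decay m * u) y - tilt u y\<bar> \<le> C / 2^m"
    using tilt_increment_bound[OF u, of b] by metis
  define D where "D = exp (phi u) * (tilt u x + real N * C)"
  show ?thesis
  proof (rule that[of D])
    show "D \<ge> 0" using C by (simp add: D_def add_nonneg_nonneg less_imp_le)
    fix s m assume s: "stopping b N s"
    note int = Dynkin_real(1)[OF s u, of m]
    have "expectation (\<lambda>\<omega>. \<Sum>j<N * 2^m. indicator {\<omega>. j < grid_index m s \<omega>} \<omega> * (tilt (decay m * u) (X (dyadic m j) \<omega>) - tilt u (X (dyadic m j) \<omega>)))
       \<le> expectation (\<lambda>\<omega>. real N * C)"
    proof (rule integral_mono)
      show "integrable M (\<lambda>\<omega>. \<Sum>j<N * 2^m. indicator {\<omega>. j < grid_index m s \<omega>} \<omega> * (tilt (decay m * u) (X (dyadic m j) \<omega>) - tilt u (X (dyadic m j) \<omega>)))"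
        unfolding right_diff_distrib
        by (intro Bochner_Integration.integrable_sum Bochner_Integration.integrable_diff before_integrable[OF s])
           (use u in \<open>simp_all add: less_imp_le\<close>)
      fix \<omega> assume w: "\<omega> \<in> space M"
      have "(\<Sum>j<N * 2^m. indicator {\<omega>. j < grid_index m s \<omega>} \<omega> * (tilt (decay m * u) (X (dyadic m j) \<omega>) - tilt u (X (dyadic m j) \<omega>)))
          \<le> (\<Sum>j<N * 2^m. C / 2^m)"
      proof (rule sum_mono)
        fix j
        show "indicator {\<omega>. j < grid_index m s \<omega>} \<omega> * (tilt (decay m * u) (X (dyadic m j) \<omega>) - tilt u (X (dyadic m j) \<omega>)) \<le> C / 2^m"
          using C(2)[OF X_before[OF s w], of j m m] C(1) by (auto simp: indicator_def)
      qed
      then show "(\<Sum>j<N * 2^m. indicator {\<omega>. j < grid_index m s \<omega>} \<omega> * (tilt (decay m * u) (X (dyadic m j) \<omega>) - tilt u (X (dyadic m j) \<omega>))) \<le> real N * C"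
        by simp
    qed simp
    then have "expectation (\<lambda>\<omega>. tilt u (X (dyadic m (grid_index m s \<omega>)) \<omega>)) \<le> tilt u x + real N * C"
      unfolding Dynkin_real(2)[OF s u] by (simp add: prob_space)
    then have "ennreal (exp (phi u)) * ennreal (expectation (\<lambda>\<omega>. tilt u (X (dyadic m (grid_index m s \<omega>)) \<omega>))) \<le> ennreal D"
      unfolding D_def by (subst ennreal_mult[symmetric]) (auto intro!: ennreal_leI mult_left_mono)
    also have "ennreal (expectation (\<lambda>\<omega>. tilt u (X (dyadic m (grid_index m s \<omega>)) \<omega>))) = (\<integral>\<^sup>+\<omega>. ennreal (tilt u (X (dyadic m (grid_index m s \<omega>)) \<omega>)) \<partial>M)"
      using int by (subst nn_integral_eq_integral) auto
    also have "ennreal (exp (phi u)) * \<dots> = (\<integral>\<^sup>+\<omega>. ennreal (exp (u * X (dyadic m (grid_index m s \<omega>)) \<omega>)) \<partial>M)"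
      using X_grid_index_measurable[OF s]
      by (subst nn_integral_cmult[symmetric]) (auto intro!: nn_integral_cong simp: ennreal_mult[symmetric] tilt_def exp_add[symmetric])
    finally show "(\<integral>\<^sup>+\<omega>. ennreal (exp (u * X (dyadic m (grid_index m s \<omega>)) \<omega>)) \<partial>M) \<le> ennreal D" .
  qed
qed

text \<open>A function of growth \<open>exp (u * y)\<close> with \<open>u < K\<close> leaves room
  for the exponent \<open>(u + K) / 2\<close>, whose moments are bounded along the grids; right
  continuity of the paths supplies the pointwise convergence.\<close>

lemma grid_index_limit:
  assumes s: "stopping b N s" and u: "0 < u" "u < K" and F: "continuous_on UNIV F" "\<And>y. \<bar>F y\<bar> \<le> c * (1 + exp (u * y))" and c: "0 \<le> c"
  shows "integrable M (\<lambda>\<omega>. F (X (s \<omega>) \<omega>))" "\<And>m. integrable M (\<lambda>\<omega>. F (X (dyadic m (grid_index m s \<omega>)) \<omega>))"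
    "(\<lambda>m. expectation (\<lambda>\<omega>. F (X (dyadic m (grid_index m s \<omega>)) \<omega>))) \<longlonglongrightarrow> expectation (\<lambda>\<omega>. F (X (s \<omega>) \<omega>))"
proof -
  define u' where "u' = (u + K) / 2"
  have u': "u < u'" "0 < u'" "u' < K" using u by (auto simp: u'_def)
  obtain C where C: "C \<ge> 0" "\<And>s m. stopping b N s \<Longrightarrow> (\<integral>\<^sup>+\<omega>. ennreal (exp (u' * X (dyadic m (grid_index m s \<omega>)) \<omega>)) \<partial>M) \<le> ennreal C"
    using stopping_moment_bound[OF u'(2,3), of b N] by metis
  have [measurable]: "F \<in> borel_measurable borel" by (rule borel_measurable_continuous_onI[OF F(1)])
  note [measurable] = X_grid_index_measurable[OF s] X_stopping_measurable[OF s]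
  have lim: "AE \<omega> in M. (\<lambda>m. F (X (dyadic m (grid_index m s \<omega>)) \<omega>)) \<longlonglongrightarrow> F (X (s \<omega>) \<omega>)"
    using X_grid_index_tendsto[OF s] F(1) by (intro AE_I2 continuous_on_tendsto_compose[OF F(1)]) auto
  have m1: "(\<lambda>\<omega>. F (X (dyadic m (grid_index m s \<omega>)) \<omega>)) \<in> borel_measurable M" for m
    by (rule measurable_compose[OF X_grid_index_measurable[OF s]]) simp
  have m2: "(\<lambda>\<omega>. F (X (s \<omega>) \<omega>)) \<in> borel_measurable M"
    by (rule measurable_compose[OF X_stopping_measurable[OF s]]) simp
  have bd: "\<bar>F (X (dyadic m (grid_index m s \<omega>)) \<omega>)\<bar> \<le> c * (1 + exp (u * X (dyadic m (grid_index m s \<omega>)) \<omega>))" if "\<omega> \<in> space M" for m \<omega>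
    by (rule F(2))
  have mom: "(\<integral>\<^sup>+\<omega>. ennreal (exp (u' * X (dyadic m (grid_index m s \<omega>)) \<omega>)) \<partial>M) \<le> ennreal C" for m
    by (rule C(2)[OF s])
  note ui = exp_moment_convergence[where f="\<lambda>m \<omega>. F (X (dyadic m (grid_index m s \<omega>)) \<omega>)" and g="\<lambda>\<omega>. F (X (s \<omega>) \<omega>)" 
     and Y="\<lambda>m \<omega>. X (dyadic m (grid_index m s \<omega>)) \<omega>" and u=u and u'=u' and c=c and C=C, OF m1 X_grid_index_measurable[OF s] m2 lim u(1) u'(1) c C(1) bd mom]
  show "integrable M (\<lambda>\<omega>. F (X (s \<omega>) \<omega>))" by (rule ui(2))
  show "integrable M (\<lambda>\<omega>. F (X (dyadic m (grid_index m s \<omega>)) \<omega>))" for m by (rule ui(1))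
  show "(\<lambda>m. expectation (\<lambda>\<omega>. F (X (dyadic m (grid_index m s \<omega>)) \<omega>))) \<longlonglongrightarrow> expectation (\<lambda>\<omega>. F (X (s \<omega>) \<omega>))" by (rule ui(3))
qed

end

section \<open>Averaging over the exponent\<close>

lemma nn_integral_inverse:
  fixes a c :: real assumes "0 < a" "a \<le> c"
  shows "(\<integral>\<^sup>+u\<in>{a<..c}. ennreal (1 / u) \<partial>lborel) = ennreal (ln (c / a))"
proof -
  have "(\<integral>\<^sup>+u\<in>{a<..c}. ennreal (1 / u) \<partial>lborel) = (\<integral>\<^sup>+u. ennreal (if u \<le> 0 then 0 else 1 / u) * indicator {a..c} u \<partial>lborel)"
    using AE_lborel_singleton[of a] assms by (intro nn_integral_cong_AE) (auto simp: indicator_def elim!: eventually_mono)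
  also have "\<dots> = ennreal (ln c - ln a)"
    by (rule nn_integral_FTC_Icc) (use assms in \<open>auto intro!: derivative_eq_intros\<close>)
  finally show ?thesis using assms by (simp add: ln_div)
qed

context levy_ou
begin

text \<open>Half-open ranges can be split and scaled without treating end points separately. The
  lower end is kept positive in use because \<open>du / u\<close> has infinite mass near 0, where
  \<open>tilt u y\<close> tends to 1.\<close>

definition tilt_integral :: "real \<Rightarrow> real \<Rightarrow> real \<Rightarrow> ennreal" where
  "tilt_integral a c y = (\<integral>\<^sup>+u\<in>{a<..c}. ennreal (tilt u y / u) \<partial>lborel)"

lemma tilt_measurable2 [measurable]: "(\<lambda>p. tilt (fst p) (snd p)) \<in> borel_measurable (borel \<Otimes>\<^sub>M borel)"
  unfolding tilt_def by measurable

lemma tilt_measurable2' [measurable (raw)]: 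
  assumes [measurable]: "f \<in> borel_measurable N" "g \<in> borel_measurable N"
  shows "(\<lambda>z. tilt (f z) (g z)) \<in> borel_measurable N"
  unfolding tilt_def by measurable

lemma tilt_integral_measurable [measurable]: "tilt_integral a c \<in> borel_measurable borel"
  unfolding tilt_integral_def[abs_def] by measurable

lemma tilt_integral_add: assumes "a \<le> c" "c \<le> d" shows "tilt_integral a d y = tilt_integral a c y + tilt_integral c d y"
  unfolding tilt_integral_def
  by (subst nn_integral_add[symmetric]) (use assms in \<open>auto intro!: nn_integral_cong simp: indicator_def\<close>)

lemma tilt_integral_scale: assumes r: "0 < r" shows "(\<integral>\<^sup>+u\<in>{a<..c}. ennreal (tilt (r * u) y / u) \<partial>lborel) = tilt_integral (r * a) (r * c) y"
proof -
  have "tilt_integral (r * a) (r * c) y = ennreal \<bar>r\<bar> * (\<integral>\<^sup>+u. ennreal (tilt (0 + r * u) y / (0 + r * u)) * indicator {r * a<..r * c} (0 + r * u) \<partial>lborel)"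
    unfolding tilt_integral_def using r by (intro nn_integral_real_affine) auto
  also have "\<dots> = (\<integral>\<^sup>+u. ennreal \<bar>r\<bar> * (ennreal (tilt (0 + r * u) y / (0 + r * u)) * indicator {r * a<..r * c} (0 + r * u)) \<partial>lborel)"
    by (rule nn_integral_cmult[symmetric]) measurable
  also have "\<dots> = (\<integral>\<^sup>+u\<in>{a<..c}. ennreal (tilt (r * u) y / u) \<partial>lborel)"
  proof (rule nn_integral_cong)
    fix u
    have "ennreal \<bar>r\<bar> * ennreal (tilt (r * u) y / (r * u)) = ennreal (tilt (r * u) y / u)"
      using r by (subst ennreal_mult'[symmetric]) auto
    moreover have "(indicator {r * a<..r * c} (r * u) :: ennreal) = indicator {a<..c} u"
      using r by (simp add: indicator_def)
    ultimately show "ennreal \<bar>r\<bar> * (ennreal (tilt (0 + r * u) y / (0 + r * u)) * indicator {r * a<..r * c} (0 + r * u)) = ennreal (tilt (r * u) y / u) * indicator {a<..c} u"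
      by (simp add: mult.assoc[symmetric])
  qed
  finally show ?thesis ..
qed

lemma tilt_integral_le:
  assumes "0 < a" "a \<le> c" "0 \<le> A" "\<And>u. a < u \<Longrightarrow> u \<le> c \<Longrightarrow> tilt u y \<le> A"
  shows "tilt_integral a c y \<le> ennreal A * ennreal (ln (c / a))"
proof -
  have "tilt_integral a c y \<le> (\<integral>\<^sup>+u. ennreal A * (ennreal (1 / u) * indicator {a<..c} u) \<partial>lborel)"
    unfolding tilt_integral_def
  proof (rule nn_integral_mono)
    fix u
    show "ennreal (tilt u y / u) * indicator {a<..c} u \<le> ennreal A * (ennreal (1 / u) * indicator {a<..c} u)"
    proof (cases "u \<in> {a<..c}")
      case True
      then have "tilt u y / u \<le> A * (1 / u)" using assms(1) assms(4)[of u] by (simp add: divide_right_mono)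
      then have "ennreal (tilt u y / u) \<le> ennreal A * ennreal (1 / u)"
        using assms True by (subst ennreal_mult[symmetric]) (auto intro: ennreal_leI)
      then show ?thesis using True by simp
    qed simp
  qed
  also have "\<dots> = ennreal A * ennreal (ln (c / a))"
    by (subst nn_integral_cmult) (simp_all add: nn_integral_inverse assms)
  finally show ?thesis .
qed

lemma tilt_integral_ge:
  assumes "0 < a" "a \<le> c" "0 \<le> A" "\<And>u. a < u \<Longrightarrow> u \<le> c \<Longrightarrow> A \<le> tilt u y"
  shows "ennreal A * ennreal (ln (c / a)) \<le> tilt_integral a c y"
proof -
  have "ennreal A * ennreal (ln (c / a)) = (\<integral>\<^sup>+u. ennreal A * (ennreal (1 / u) * indicator {a<..c} u) \<partial>lborel)"
    by (subst nn_integral_cmult) (simp_all add: nn_integral_inverse assms)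
  also have "\<dots> \<le> tilt_integral a c y"
    unfolding tilt_integral_def
  proof (rule nn_integral_mono)
    fix u
    show "ennreal A * (ennreal (1 / u) * indicator {a<..c} u) \<le> ennreal (tilt u y / u) * indicator {a<..c} u"
    proof (cases "u \<in> {a<..c}")
      case True
      then have "A * (1 / u) \<le> tilt u y / u" using assms(1) assms(4)[of u] by (simp add: divide_right_mono)
      then have "ennreal A * ennreal (1 / u) \<le> ennreal (tilt u y / u)"
        using assms True by (subst ennreal_mult[symmetric]) (auto intro: ennreal_leI)
      then show ?thesis using True by simp
    qed simp
  qed
  finally show ?thesis .
qed

text \<open>The mass of one boundary interval \<open>(decay m * a, a]\<close> under
  \<open>du / u\<close> is \<open>\<beta>\<close> times the length of a time step. This is what
  turns a number of steps into elapsed time.\<close>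

lemma ln_inverse_decay: "0 < a \<Longrightarrow> ln (a / (decay m * a)) = \<beta> / 2^m"
  by (simp add: decay_def ln_div)

lemma tilt_le_uniform: obtains C where "C \<ge> 0" "\<And>u y. 0 \<le> u \<Longrightarrow> u < K \<Longrightarrow> tilt u y \<le> C * exp (u * y)"
  using phi_bounded_below by (metis tilt_def exp_diff exp_minus divide_inverse mult.commute exp_ge_zero mult_right_mono)

lemma tilt_integral_finite: assumes "0 < a" "a \<le> c" "c < K" shows "tilt_integral a c y < \<infinity>"
proof -
  obtain C where C: "C \<ge> 0" "\<And>u y. 0 \<le> u \<Longrightarrow> u < K \<Longrightarrow> tilt u y \<le> C * exp (u * y)" using tilt_le_uniform by blast
  have "tilt_integral a c y \<le> ennreal (C * exp (K * \<bar>y\<bar>)) * ennreal (ln (c / a))"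
  proof (rule tilt_integral_le[OF assms(1,2)])
    fix u assume u: "a < u" "u \<le> c"
    have "u * y \<le> u * \<bar>y\<bar>" using u assms by (intro mult_left_mono) auto
    also have "\<dots> \<le> K * \<bar>y\<bar>" using u assms by (intro mult_right_mono) auto
    finally show "tilt u y \<le> C * exp (K * \<bar>y\<bar>)" 
      using C(1) C(2)[of u y] u assms by (intro order_trans[OF C(2)] mult_left_mono) auto
  qed (use C in simp)
  also have "\<dots> < \<infinity>" by (simp add: ennreal_mult_less_top)
  finally show ?thesis .
qed

lemma tilt_integral_Fubini:
  assumes r: "0 < r" and [measurable]: "g \<in> borel_measurable M" "Y \<in> borel_measurable M"
  shows "(\<integral>\<^sup>+u\<in>{a<..c}. ennreal (1 / u) * (\<integral>\<^sup>+\<omega>. g \<omega> * ennreal (tilt (r * u) (Y \<omega>)) \<partial>M) \<partial>lborel) = (\<integral>\<^sup>+\<omega>. g \<omega> * tilt_integral (r * a) (r * c) (Y \<omega>) \<partial>M)"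
proof -
  interpret P: pair_sigma_finite lborel M ..
  let ?f = "\<lambda>u \<omega>. g \<omega> * (ennreal (tilt (r * u) (Y \<omega>)) * ennreal (1 / u) * indicator {a<..c} u)"
  have "(\<integral>\<^sup>+u\<in>{a<..c}. ennreal (1 / u) * (\<integral>\<^sup>+\<omega>. g \<omega> * ennreal (tilt (r * u) (Y \<omega>)) \<partial>M) \<partial>lborel) = (\<integral>\<^sup>+u. (\<integral>\<^sup>+\<omega>. ?f u \<omega> \<partial>M) \<partial>lborel)"
  proof (rule nn_integral_cong)
    fix u
    have "ennreal (1 / u) * (\<integral>\<^sup>+\<omega>. g \<omega> * ennreal (tilt (r * u) (Y \<omega>)) \<partial>M) * indicator {a<..c} u 
      = (\<integral>\<^sup>+\<omega>. (g \<omega> * ennreal (tilt (r * u) (Y \<omega>))) * (ennreal (1 / u) * indicator {a<..c} u) \<partial>M)"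
      by (subst nn_integral_multc) (simp_all add: ac_simps)
    then show "ennreal (1 / u) * (\<integral>\<^sup>+\<omega>. g \<omega> * ennreal (tilt (r * u) (Y \<omega>)) \<partial>M) * indicator {a<..c} u = (\<integral>\<^sup>+\<omega>. ?f u \<omega> \<partial>M)"
      by (simp add: mult.assoc)
  qed
  also have "\<dots> = (\<integral>\<^sup>+\<omega>. (\<integral>\<^sup>+u. ?f u \<omega> \<partial>lborel) \<partial>M)"
    by (rule P.Fubini'[symmetric]) measurable
  also have "\<dots> = (\<integral>\<^sup>+\<omega>. g \<omega> * tilt_integral (r * a) (r * c) (Y \<omega>) \<partial>M)"
  proof (rule nn_integral_cong)
    fix \<omega>
    have "(\<integral>\<^sup>+u. ?f u \<omega> \<partial>lborel) = g \<omega> * (\<integral>\<^sup>+u. ennreal (tilt (r * u) (Y \<omega>)) * ennreal (1 / u) * indicator {a<..c} u \<partial>lborel)"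
      by (rule nn_integral_cmult) measurable
    also have "(\<integral>\<^sup>+u. ennreal (tilt (r * u) (Y \<omega>)) * ennreal (1 / u) * indicator {a<..c} u \<partial>lborel) = tilt_integral (r * a) (r * c) (Y \<omega>)"
      unfolding tilt_integral_scale[OF r, symmetric] by (intro nn_integral_cong arg_cong2[where f="(*)"] refl) (simp add: ennreal_mult'[symmetric])
    finally show "(\<integral>\<^sup>+u. ?f u \<omega> \<partial>lborel) = g \<omega> * tilt_integral (r * a) (r * c) (Y \<omega>)" .
  qed
  finally show ?thesis .
qed

section \<open>The averaged identity on a grid and its two boundary terms\<close>

context
  fixes b N s assumes s: "stopping b N s"
begin

lemma before_tilt_integral_finite:
  assumes "0 < a" "a \<le> c" "c < K"
  shows "(\<integral>\<^sup>+\<omega>. indicator {\<omega>. j < grid_index m s \<omega>} \<omega> * tilt_integral a c (X (dyadic m j) \<omega>) \<partial>M) < \<infinity>"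
proof -
  have "(\<integral>\<^sup>+\<omega>. indicator {\<omega>. j < grid_index m s \<omega>} \<omega> * tilt_integral a c (X (dyadic m j) \<omega>) \<partial>M) \<le> (\<integral>\<^sup>+\<omega>. tilt_integral a c b \<partial>M)"
  proof (rule nn_integral_mono)
    fix \<omega> assume w: "\<omega> \<in> space M"
    show "indicator {\<omega>. j < grid_index m s \<omega>} \<omega> * tilt_integral a c (X (dyadic m j) \<omega>) \<le> tilt_integral a c b"
    proof (cases "j < grid_index m s \<omega>")
      case True
      have "tilt_integral a c (X (dyadic m j) \<omega>) \<le> tilt_integral a c b"
        unfolding tilt_integral_def
        by (intro nn_integral_mono) (use tilt_bounded X_before[OF s w True] assms in \<open>auto simp: indicator_def intro!: ennreal_leI divide_right_mono\<close>)
      then show ?thesis by (simp add: indicator_def)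
    qed simp
  qed
  also have "\<dots> < \<infinity>" using tilt_integral_finite[OF assms] by (simp add: emeasure_space_1)
  finally show ?thesis .
qed

text \<open>Averaging leaves a sum over \<open>(a, c]\<close> on the left and one over
  \<open>(decay m * a, decay m * c]\<close> on the right. Adding the piece
  \<open>(decay m * c, c]\<close> to both sides extends the right-hand range to
  \<open>(decay m * a, c]\<close>, which splits at \<open>a\<close>; the sum over
  \<open>(a, c]\<close> is finite and cancels. The two ranges need not overlap.\<close>

lemma tilt_integral_identity:
  assumes ac: "0 < a" "a \<le> c" "c < K"
  shows "(\<integral>\<^sup>+\<omega>. tilt_integral a c (X (dyadic m (grid_index m s \<omega>)) \<omega>) \<partial>M)
     + (\<Sum>j<N * 2^m. \<integral>\<^sup>+\<omega>. indicator {\<omega>. j < grid_index m s \<omega>} \<omega> * tilt_integral (decay m * c) c (X (dyadic m j) \<omega>) \<partial>M)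
   = tilt_integral a c x + (\<Sum>j<N * 2^m. \<integral>\<^sup>+\<omega>. indicator {\<omega>. j < grid_index m s \<omega>} \<omega> * tilt_integral (decay m * a) a (X (dyadic m j) \<omega>) \<partial>M)"
proof -
  note [measurable] = grid_index_measurable[OF s] X_grid_index_measurable[OF s]
  let ?I = "\<lambda>j \<omega>. indicator {\<omega>. j < grid_index m s \<omega>} \<omega> :: ennreal"
  let ?S = "\<lambda>p q. \<Sum>j<N * 2^m. \<integral>\<^sup>+\<omega>. ?I j \<omega> * tilt_integral p q (X (dyadic m j) \<omega>) \<partial>M"
  let ?w = "\<lambda>u. ennreal (1 / u) * indicator {a<..c} u"
  define E where "E u = (\<integral>\<^sup>+\<omega>. 1 * ennreal (tilt (1 * u) (X (dyadic m (grid_index m s \<omega>)) \<omega>)) \<partial>M)" for u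
  define B where "B r j u = (\<integral>\<^sup>+\<omega>. ?I j \<omega> * ennreal (tilt (r * u) (X (dyadic m j) \<omega>)) \<partial>M)" for r j u
  have [measurable]: "E \<in> borel_measurable borel" unfolding E_def by measurable
  have [measurable]: "B r j \<in> borel_measurable borel" for r j unfolding B_def by measurable
  have w: "(\<integral>\<^sup>+u\<in>{a<..c}. ennreal (1 / u) * H u \<partial>lborel) = (\<integral>\<^sup>+u. ?w u * H u \<partial>lborel)" for H
    by (simp add: ac_simps)
  have IE: "(\<integral>\<^sup>+u. ?w u * E u \<partial>lborel) = (\<integral>\<^sup>+\<omega>. tilt_integral a c (X (dyadic m (grid_index m s \<omega>)) \<omega>) \<partial>M)"
    using tilt_integral_Fubini[of 1 "\<lambda>_. 1" "\<lambda>\<omega>. X (dyadic m (grid_index m s \<omega>)) \<omega>" a c] unfolding w E_def by simp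
  have IB: "(\<integral>\<^sup>+u. ?w u * B r j u \<partial>lborel) = (\<integral>\<^sup>+\<omega>. ?I j \<omega> * tilt_integral (r * a) (r * c) (X (dyadic m j) \<omega>) \<partial>M)" if "0 < r" for r j
    using tilt_integral_Fubini[OF that, of "?I j" "X (dyadic m j)" a c] unfolding w B_def by simp
  have Ix: "(\<integral>\<^sup>+u. ?w u * ennreal (tilt u x) \<partial>lborel) = tilt_integral a c x"
    unfolding tilt_integral_def
  proof (rule nn_integral_cong)
    fix u show "?w u * ennreal (tilt u x) = ennreal (tilt u x / u) * indicator {a<..c} u"
      by (cases "u \<in> {a<..c}") (use ac in \<open>auto simp: ennreal_mult'[symmetric]\<close>)
  qed
  have pw: "?w u * (E u + (\<Sum>j<N * 2^m. B 1 j u)) = ?w u * (ennreal (tilt u x) + (\<Sum>j<N * 2^m. B (decay m) j u))" for u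
  proof (cases "u \<in> {a<..c}")
    case True
    then have "0 < u" "u < K" using ac by auto
    from Dynkin_grid_index[OF s this, of m] show ?thesis unfolding E_def B_def by simp
  qed simp
  have "(\<integral>\<^sup>+u. ?w u * (E u + (\<Sum>j<N * 2^m. B 1 j u)) \<partial>lborel) = (\<integral>\<^sup>+\<omega>. tilt_integral a c (X (dyadic m (grid_index m s \<omega>)) \<omega>) \<partial>M) + ?S a c"
    unfolding distrib_left sum_distrib_left
    by (subst nn_integral_add, measurable, subst nn_integral_sum, measurable) (simp only: IE IB zero_less_one mult_1)
  moreover have "(\<integral>\<^sup>+u. ?w u * (ennreal (tilt u x) + (\<Sum>j<N * 2^m. B (decay m) j u)) \<partial>lborel) = tilt_integral a c x + ?S (decay m * a) (decay m * c)"
    unfolding distrib_left sum_distrib_left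
    by (subst nn_integral_add, measurable, subst nn_integral_sum, measurable) (simp only: Ix IB decay_pos)
  ultimately have 1: "(\<integral>\<^sup>+\<omega>. tilt_integral a c (X (dyadic m (grid_index m s \<omega>)) \<omega>) \<partial>M) + ?S a c = tilt_integral a c x + ?S (decay m * a) (decay m * c)"
    unfolding pw by simp
  have c0: "0 < c" using ac by simp
  have le: "decay m * a \<le> a" "decay m * c \<le> c" "decay m * a \<le> decay m * c"
    using ac c0 mult_right_mono[OF decay_le_1[of m], of a] mult_right_mono[OF decay_le_1[of m], of c] by (auto simp: mult_left_mono less_imp_le)
  have split: "?S p r = ?S p q + ?S q r" if "p \<le> q" "q \<le> r" for p q r
  proof -
    have "(\<integral>\<^sup>+\<omega>. ?I j \<omega> * tilt_integral p r (X (dyadic m j) \<omega>) \<partial>M) = (\<integral>\<^sup>+\<omega>. ?I j \<omega> * tilt_integral p q (X (dyadic m j) \<omega>) \<partial>M) + (\<integral>\<^sup>+\<omega>. ?I j \<omega> * tilt_integral q r (X (dyadic m j) \<omega>) \<partial>M)" for j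
      unfolding tilt_integral_add[OF that] distrib_left by (rule nn_integral_add) measurable
    then show ?thesis by (simp only: sum.distrib)
  qed
  have fin: "?S a c \<noteq> \<infinity>"
    using before_tilt_integral_finite[OF ac, of _ m] by (simp add: less_top[symmetric])
  have alg: "P + b' = c' + q" if "P + R = c' + Q" "Q + b' = q + R" "R \<noteq> \<infinity>" for P R c' Q q b' :: ennreal
  proof -
    have "R + (P + b') = (P + R) + b'" by (simp only: ac_simps)
    also have "\<dots> = c' + (Q + b')" unfolding that(1) by (simp only: ac_simps)
    also have "\<dots> = R + (c' + q)" unfolding that(2) by (simp only: ac_simps)
    finally show ?thesis using that(3) by (simp add: ennreal_add_left_cancel)
  qed
  show ?thesis
    by (rule alg[OF 1 _ fin]) (simp only: split[OF le(3,2), symmetric] split[OF le(1) ac(2), symmetric])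
qed

lemma sum_before_nn:
  assumes [measurable]: "g \<in> borel_measurable M"
  shows "(\<Sum>j<N * 2^m. \<integral>\<^sup>+\<omega>. indicator {\<omega>. j < grid_index m s \<omega>} \<omega> * (g \<omega> * ennreal (\<beta> / 2^m)) \<partial>M) = ennreal \<beta> * (\<integral>\<^sup>+\<omega>. ennreal (dyadic m (grid_index m s \<omega>)) * g \<omega> \<partial>M)"
proof -
  note [measurable] = grid_index_measurable[OF s]
  have [measurable]: "(\<lambda>\<omega>. dyadic m (grid_index m s \<omega>)) \<in> borel_measurable M" unfolding dyadic_def by measurable
  have "(\<Sum>j<N * 2^m. \<integral>\<^sup>+\<omega>. indicator {\<omega>. j < grid_index m s \<omega>} \<omega> * (g \<omega> * ennreal (\<beta> / 2^m)) \<partial>M)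
    = (\<integral>\<^sup>+\<omega>. (\<Sum>j<N * 2^m. indicator {\<omega>. j < grid_index m s \<omega>} \<omega> * (g \<omega> * ennreal (\<beta> / 2^m))) \<partial>M)"
    by (rule nn_integral_sum[symmetric]) measurable
  also have "\<dots> = (\<integral>\<^sup>+\<omega>. ennreal \<beta> * (ennreal (dyadic m (grid_index m s \<omega>)) * g \<omega>) \<partial>M)"
  proof (rule nn_integral_cong)
    fix \<omega> assume w: "\<omega> \<in> space M"
    have "(\<Sum>j<N * 2^m. indicator {\<omega>. j < grid_index m s \<omega>} \<omega> :: ennreal) = (\<Sum>j<N * 2^m. ennreal (indicator {\<omega>. j < grid_index m s \<omega>} \<omega>))"
      by (simp add: ennreal_indicator)
    also have "\<dots> = ennreal (real (grid_index m s \<omega>))" using sum_before[OF s w, of m] by (subst sum_ennreal) auto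
    finally have "(\<Sum>j<N * 2^m. indicator {\<omega>. j < grid_index m s \<omega>} \<omega> * (g \<omega> * ennreal (\<beta> / 2^m))) = (ennreal (real (grid_index m s \<omega>)) * ennreal (\<beta> / 2^m)) * g \<omega>"
      unfolding sum_distrib_right[symmetric] by (simp only: ac_simps)
    also have "ennreal (real (grid_index m s \<omega>)) * ennreal (\<beta> / 2^m) = ennreal \<beta> * ennreal (dyadic m (grid_index m s \<omega>))"
      using beta_pos by (simp add: ennreal_mult[symmetric] dyadic_def mult.commute)
    finally show "(\<Sum>j<N * 2^m. indicator {\<omega>. j < grid_index m s \<omega>} \<omega> * (g \<omega> * ennreal (\<beta> / 2^m))) = ennreal \<beta> * (ennreal (dyadic m (grid_index m s \<omega>)) * g \<omega>)"
      by (simp only: mult.assoc)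
  qed
  also have "\<dots> = ennreal \<beta> * (\<integral>\<^sup>+\<omega>. ennreal (dyadic m (grid_index m s \<omega>)) * g \<omega> \<partial>M)"
    by (rule nn_integral_cmult) measurable
  finally show ?thesis .
qed

text \<open>Monotonicity in the position replaces every value before stopping by \<open>b\<close>.
  The estimate serves at both ends of the range of exponents: near 0 with \<open>A\<close> close to
  1, and near \<open>K\<close> with \<open>A\<close> close to 0.\<close>

lemma before_tilt_integral_upper:
  assumes a: "0 < a" "a < K" and A: "0 \<le> A" "\<And>u. decay m * a < u \<Longrightarrow> u \<le> a \<Longrightarrow> tilt u b \<le> A"
  shows "(\<Sum>j<N * 2^m. \<integral>\<^sup>+\<omega>. indicator {\<omega>. j < grid_index m s \<omega>} \<omega> * tilt_integral (decay m * a) a (X (dyadic m j) \<omega>) \<partial>M)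
     \<le> ennreal \<beta> * (\<integral>\<^sup>+\<omega>. ennreal (dyadic m (grid_index m s \<omega>)) * ennreal A \<partial>M)"
proof -
  have "(\<Sum>j<N * 2^m. \<integral>\<^sup>+\<omega>. indicator {\<omega>. j < grid_index m s \<omega>} \<omega> * tilt_integral (decay m * a) a (X (dyadic m j) \<omega>) \<partial>M)
    \<le> (\<Sum>j<N * 2^m. \<integral>\<^sup>+\<omega>. indicator {\<omega>. j < grid_index m s \<omega>} \<omega> * (ennreal A * ennreal (\<beta> / 2^m)) \<partial>M)"
  proof (intro sum_mono nn_integral_mono)
    fix j \<omega> assume w: "\<omega> \<in> space M"
    show "indicator {\<omega>. j < grid_index m s \<omega>} \<omega> * tilt_integral (decay m * a) a (X (dyadic m j) \<omega>) \<le> indicator {\<omega>. j < grid_index m s \<omega>} \<omega> * (ennreal A * ennreal (\<beta> / 2^m))"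
    proof (cases "j < grid_index m s \<omega>")
      case True
      have "tilt_integral (decay m * a) a (X (dyadic m j) \<omega>) \<le> ennreal A * ennreal (ln (a / (decay m * a)))"
      proof (rule tilt_integral_le)
        fix u assume u: "decay m * a < u" "u \<le> a"
        then have "0 \<le> u" using a by (meson less_imp_le less_trans mult_pos_pos decay_pos)
        from tilt_bounded[OF this X_before[OF s w True]] A(2)[OF u] show "tilt u (X (dyadic m j) \<omega>) \<le> A" by linarith
      qed (use a A(1) in \<open>auto intro: mult_pos_pos\<close>)
      then show ?thesis using ln_inverse_decay[OF a(1)] by (intro mult_left_mono) auto
    qed simp
  qed
  also have "\<dots> = ennreal \<beta> * (\<integral>\<^sup>+\<omega>. ennreal (dyadic m (grid_index m s \<omega>)) * ennreal A \<partial>M)"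
    by (rule sum_before_nn) simp
  finally show ?thesis .
qed

text \<open>The path has no deterministic lower bound, so a random one, \<open>- Z\<close>, is used.
  Its effect is the factor \<open>exp (- a * Z \<omega>)\<close>, which lies in
  \<open>[0, 1]\<close> and tends to 1 as \<open>a\<close> tends to 0; finiteness of
  \<open>Z\<close> is enough for that, without any moment.\<close>

lemma before_tilt_integral_lower:
  assumes a: "0 < a" "a < K" and A: "0 \<le> A" "\<And>u. 0 < u \<Longrightarrow> u \<le> a \<Longrightarrow> A \<le> exp (- phi u)"
    and Z [measurable]: "Z \<in> borel_measurable M" and Z0: "\<And>\<omega>. 0 \<le> Z \<omega>" and Zb: "\<And>\<omega> j. \<omega> \<in> space M \<Longrightarrow> dyadic m j \<le> real N \<Longrightarrow> - Z \<omega> \<le> X (dyadic m j) \<omega>"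
  shows "ennreal \<beta> * (\<integral>\<^sup>+\<omega>. ennreal (dyadic m (grid_index m s \<omega>)) * ennreal (A * exp (- a * Z \<omega>)) \<partial>M) \<le>
    (\<Sum>j<N * 2^m. \<integral>\<^sup>+\<omega>. indicator {\<omega>. j < grid_index m s \<omega>} \<omega> * tilt_integral (decay m * a) a (X (dyadic m j) \<omega>) \<partial>M)"
proof -
  have "ennreal \<beta> * (\<integral>\<^sup>+\<omega>. ennreal (dyadic m (grid_index m s \<omega>)) * ennreal (A * exp (- a * Z \<omega>)) \<partial>M) = 
     (\<Sum>j<N * 2^m. \<integral>\<^sup>+\<omega>. indicator {\<omega>. j < grid_index m s \<omega>} \<omega> * (ennreal (A * exp (- a * Z \<omega>)) * ennreal (\<beta> / 2^m)) \<partial>M)"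
    by (rule sum_before_nn[symmetric]) measurable
  also have "\<dots> \<le> (\<Sum>j<N * 2^m. \<integral>\<^sup>+\<omega>. indicator {\<omega>. j < grid_index m s \<omega>} \<omega> * tilt_integral (decay m * a) a (X (dyadic m j) \<omega>) \<partial>M)"
  proof (intro sum_mono nn_integral_mono)
    fix j \<omega> assume w: "\<omega> \<in> space M"
    show "indicator {\<omega>. j < grid_index m s \<omega>} \<omega> * (ennreal (A * exp (- a * Z \<omega>)) * ennreal (\<beta> / 2^m)) \<le> indicator {\<omega>. j < grid_index m s \<omega>} \<omega> * tilt_integral (decay m * a) a (X (dyadic m j) \<omega>)"
    proof (cases "j < grid_index m s \<omega>")
      case True
      then have "dyadic m j < s \<omega>" by (simp add: less_grid_index_iff)
      then have "dyadic m j \<le> real N" using stopping_range(2)[OF s w] by linarith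
      note Zj = Zb[OF w this]
      have "ennreal (A * exp (- a * Z \<omega>)) * ennreal (ln (a / (decay m * a))) \<le> tilt_integral (decay m * a) a (X (dyadic m j) \<omega>)"
      proof (rule tilt_integral_ge)
        fix u assume u: "decay m * a < u" "u \<le> a"
        then have u0: "0 < u" using a by (meson less_trans mult_pos_pos decay_pos)
        have "a * Z \<omega> \<ge> u * Z \<omega>" using u Z0 by (intro mult_right_mono)
        moreover have "u * X (dyadic m j) \<omega> \<ge> u * (- Z \<omega>)" using u0 Zj by (intro mult_left_mono) auto
        ultimately have "exp (- a * Z \<omega>) \<le> exp (u * X (dyadic m j) \<omega>)" by simp
        then have "A * exp (- a * Z \<omega>) \<le> exp (- phi u) * exp (u * X (dyadic m j) \<omega>)"
          using A(2)[OF u0 u(2)] A(1) by (intro mult_mono) auto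
        also have "\<dots> = tilt u (X (dyadic m j) \<omega>)" by (simp add: tilt_def exp_add[symmetric])
        finally show "A * exp (- a * Z \<omega>) \<le> tilt u (X (dyadic m j) \<omega>)" .
      qed (use a A(1) in \<open>auto intro: mult_pos_pos\<close>)
      then show ?thesis using ln_inverse_decay[OF a(1)] by (intro mult_left_mono) auto
    qed simp
  qed
  finally show ?thesis .
qed

end

end

section \<open>The limit of vanishing mesh\<close>

text \<open>\<open>ennreal\<close> sends negative reals to 0, so \<open>ennreal (q - p)\<close> is a
  positive part. The identity moves a signed difference across an equation between extended
  nonnegative numbers.\<close>

lemma ennreal_pos_part_swap:
  fixes p q :: real assumes "0 \<le> p" "0 \<le> q"
  shows "ennreal p + ennreal (q - p) = ennreal q + ennreal (p - q)"
proof (cases "p \<le> q")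
  case True
  then have "ennreal p + ennreal (q - p) = ennreal q" using assms by (subst ennreal_plus[symmetric]) auto
  then show ?thesis using True by (simp add: ennreal_neg)
next
  case False
  then have "ennreal q + ennreal (p - q) = ennreal p" using assms by (subst ennreal_plus[symmetric]) auto
  then show ?thesis using False by (simp add: ennreal_neg)
qed

context levy_ou
begin

lemma tilt_integral_le_exp:
  assumes "0 < a" "a \<le> c" "c < K"
  obtains C where "C \<ge> 0" "\<And>y. tilt_integral a c y \<le> ennreal (C * (1 + exp (c * y)))"
proof -
  obtain C where C: "C \<ge> 0" "\<And>u y. 0 \<le> u \<Longrightarrow> u < K \<Longrightarrow> tilt u y \<le> C * exp (u * y)" using tilt_le_uniform by blast
  have ln0: "0 \<le> ln (c / a)" using assms by simp
  show ?thesis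
  proof (rule that[of "C * ln (c / a)"])
    fix y
    have "tilt_integral a c y \<le> ennreal (C * (1 + exp (c * y))) * ennreal (ln (c / a))"
    proof (rule tilt_integral_le[OF assms(1,2)])
      fix u assume u: "a < u" "u \<le> c"
      have "tilt u y \<le> C * exp (u * y)" using C(2)[of u y] u assms by simp
      also have "\<dots> \<le> C * (1 + exp (c * y))" using exp_mult_le_one_plus[of u c y] u assms C(1) by (intro mult_left_mono) auto
      finally show "tilt u y \<le> C * (1 + exp (c * y))" .
    qed (use C(1) in \<open>auto intro: mult_nonneg_nonneg add_nonneg_nonneg\<close>)
    also have "\<dots> = ennreal (C * ln (c / a) * (1 + exp (c * y)))"
      using C(1) ln0 by (subst ennreal_mult[symmetric]) (auto intro!: mult_nonneg_nonneg add_nonneg_nonneg simp: ac_simps)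
    finally show "tilt_integral a c y \<le> ennreal (C * ln (c / a) * (1 + exp (c * y)))" .
  qed (use C ln0 in simp)
qed

lemma tilt_integral_tendsto:
  assumes ac: "0 < a" "a \<le> c" "c < K" and y: "y \<longlonglongrightarrow> l"
  shows "(\<lambda>n. tilt_integral a c (y n)) \<longlonglongrightarrow> tilt_integral a c l"
proof -
  obtain C where C: "C \<ge> 0" "\<And>u y. 0 \<le> u \<Longrightarrow> u < K \<Longrightarrow> tilt u y \<le> C * exp (u * y)" using tilt_le_uniform by blast
  obtain B where B: "\<And>n. \<bar>y n\<bar> \<le> B" using convergent_imp_Bseq[OF convergentI[OF y]] by (auto simp: Bseq_def)
  have B0: "0 \<le> B" using B[of 0] by linarith
  show ?thesis unfolding tilt_integral_def
  proof (rule nn_integral_dominated_convergence[where w="\<lambda>u. ennreal (C * exp (K * B)) * (ennreal (1 / u) * indicator {a<..c} u)"])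
    show "AE u in lborel. ennreal (tilt u (y n) / u) * indicator {a<..c} u \<le> ennreal (C * exp (K * B)) * (ennreal (1 / u) * indicator {a<..c} u)" for n
    proof (rule AE_I2)
      fix u
      show "ennreal (tilt u (y n) / u) * indicator {a<..c} u \<le> ennreal (C * exp (K * B)) * (ennreal (1 / u) * indicator {a<..c} u)"
      proof (cases "u \<in> {a<..c}")
        case True
        then have u: "0 < u" "u < K" using ac by auto
        have "u * y n \<le> K * B" using u B[of n] B0 by (intro order_trans[OF mult_left_mono[of "y n" B] mult_right_mono]) auto
        then have "tilt u (y n) \<le> C * exp (K * B)" using C(1) u by (intro order_trans[OF C(2)] mult_left_mono) auto
        then have "tilt u (y n) / u \<le> C * exp (K * B) * (1 / u)" using u by (simp add: divide_right_mono)
        then have "ennreal (tilt u (y n) / u) \<le> ennreal (C * exp (K * B)) * ennreal (1 / u)"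
          using u C(1) by (subst ennreal_mult[symmetric]) (auto intro: ennreal_leI)
        then show ?thesis using True by simp
      qed simp
    qed
    have "(\<integral>\<^sup>+u. ennreal (C * exp (K * B)) * (ennreal (1 / u) * indicator {a<..c} u) \<partial>lborel) = ennreal (C * exp (K * B)) * ennreal (ln (c / a))"
      by (subst nn_integral_cmult) (simp_all add: nn_integral_inverse ac)
    then show "(\<integral>\<^sup>+u. ennreal (C * exp (K * B)) * (ennreal (1 / u) * indicator {a<..c} u) \<partial>lborel) < \<infinity>"
      by (simp add: ennreal_mult_less_top)
    show "AE u in lborel. (\<lambda>n. ennreal (tilt u (y n) / u) * indicator {a<..c} u) \<longlonglongrightarrow> ennreal (tilt u l / u) * indicator {a<..c} u"
    proof (rule AE_I2)
      fix u
      have "u \<in> {a<..c} \<Longrightarrow> (\<lambda>n. ennreal (tilt u (y n) / u)) \<longlonglongrightarrow> ennreal (tilt u l / u)"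
        unfolding tilt_def using ac by (intro tendsto_ennrealI tendsto_intros y) auto
      then show "(\<lambda>n. ennreal (tilt u (y n) / u) * indicator {a<..c} u) \<longlonglongrightarrow> ennreal (tilt u l / u) * indicator {a<..c} u"
        by (cases "u \<in> {a<..c}") auto
    qed
  qed measurable
qed

context
  fixes b N s assumes s: "stopping b N s"
begin

lemma tilt_integral_limit:
  assumes ac: "0 < a" "a \<le> c" "c < K"
  shows "(\<lambda>m. \<integral>\<^sup>+\<omega>. tilt_integral a c (X (dyadic m (grid_index m s \<omega>)) \<omega>) \<partial>M) \<longlonglongrightarrow> (\<integral>\<^sup>+\<omega>. tilt_integral a c (X (s \<omega>) \<omega>) \<partial>M)"
proof -
  define F where "F y = enn2real (tilt_integral a c y)" for y
  have FF: "tilt_integral a c y = ennreal (F y)" for y using tilt_integral_finite[OF ac, of y] by (simp add: F_def)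
  have F0: "0 \<le> F y" for y by (simp add: F_def)
  obtain C where C: "C \<ge> 0" "\<And>y. tilt_integral a c y \<le> ennreal (C * (1 + exp (c * y)))" using tilt_integral_le_exp[OF ac] by blast
  have Fb: "\<bar>F y\<bar> \<le> C * (1 + exp (c * y))" for y
    using C(2)[of y] C(1) F0[of y] unfolding FF by (subst (asm) ennreal_le_iff) (auto intro!: mult_nonneg_nonneg add_nonneg_nonneg)
  have cF: "continuous_on UNIV F"
    by (rule continuous_on_sequentiallyI) 
       (use tilt_integral_tendsto[OF ac] tilt_integral_finite[OF ac] in \<open>auto simp: F_def intro!: tendsto_enn2real\<close>)
  note ul = grid_index_limit[OF s _ ac(3) cF Fb C(1)]
  have c0: "0 < c" using ac by simp
  have "(\<integral>\<^sup>+\<omega>. tilt_integral a c (X (dyadic m (grid_index m s \<omega>)) \<omega>) \<partial>M) = ennreal (expectation (\<lambda>\<omega>. F (X (dyadic m (grid_index m s \<omega>)) \<omega>)))" for m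
    unfolding FF by (rule nn_integral_eq_integral[OF ul(2)[OF c0]]) (simp add: F0)
  moreover have "(\<integral>\<^sup>+\<omega>. tilt_integral a c (X (s \<omega>) \<omega>) \<partial>M) = ennreal (expectation (\<lambda>\<omega>. F (X (s \<omega>) \<omega>)))"
    unfolding FF by (rule nn_integral_eq_integral[OF ul(1)[OF c0]]) (simp add: F0)
  ultimately show ?thesis using ul(3)[OF c0] by (simp add: tendsto_ennrealI)
qed

lemma stopping_integrable: "integrable M s"
  by (rule integrable_const_bound[where B="real N"]) (use stopping_range[OF s] stopping_measurable[OF s] in auto)

lemma nn_stopping: "(\<integral>\<^sup>+\<omega>. ennreal (s \<omega>) \<partial>M) = ennreal (expectation s)"
  by (rule nn_integral_eq_integral[OF stopping_integrable]) (use stopping_range[OF s] in auto)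

lemma expectation_stopping_nonneg: "0 \<le> expectation s"
  by (rule integral_nonneg_AE) (use stopping_range[OF s] in auto)

text \<open>The boundary term at \<open>c\<close> is nonnegative and is dropped. The one at
  \<open>a\<close> is at most \<open>\<beta> * A\<close> times the expected discretised time, which
  exceeds that of \<open>s\<close> by at most \<open>(1/2)^m\<close>.\<close>

lemma tilt_integral_upper_bound:
  assumes ac: "0 < a" "a \<le> c" "c < K" and A: "0 \<le> A" "\<And>u. 0 < u \<Longrightarrow> u \<le> a \<Longrightarrow> tilt u b \<le> A"
  shows "(\<integral>\<^sup>+\<omega>. tilt_integral a c (X (s \<omega>) \<omega>) \<partial>M) \<le> tilt_integral a c x + ennreal (\<beta> * A) * (\<integral>\<^sup>+\<omega>. ennreal (s \<omega>) \<partial>M)"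
proof -
  have aK: "a < K" using ac by simp
  have m: "(\<integral>\<^sup>+\<omega>. tilt_integral a c (X (dyadic m (grid_index m s \<omega>)) \<omega>) \<partial>M) \<le> tilt_integral a c x + ennreal (\<beta> * A * (expectation s + (1/2)^m))" for m
  proof -
    have "(\<integral>\<^sup>+\<omega>. tilt_integral a c (X (dyadic m (grid_index m s \<omega>)) \<omega>) \<partial>M) \<le> (\<integral>\<^sup>+\<omega>. tilt_integral a c (X (dyadic m (grid_index m s \<omega>)) \<omega>) \<partial>M)
      + (\<Sum>j<N * 2^m. \<integral>\<^sup>+\<omega>. indicator {\<omega>. j < grid_index m s \<omega>} \<omega> * tilt_integral (decay m * c) c (X (dyadic m j) \<omega>) \<partial>M)"
      by (rule add_increasing2) auto
    also have "\<dots> = tilt_integral a c x + (\<Sum>j<N * 2^m. \<integral>\<^sup>+\<omega>. indicator {\<omega>. j < grid_index m s \<omega>} \<omega> * tilt_integral (decay m * a) a (X (dyadic m j) \<omega>) \<partial>M)"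
      by (rule tilt_integral_identity[OF s ac])
    also have "\<dots> \<le> tilt_integral a c x + ennreal \<beta> * (\<integral>\<^sup>+\<omega>. ennreal (dyadic m (grid_index m s \<omega>)) * ennreal A \<partial>M)"
    proof (intro add_left_mono before_tilt_integral_upper[OF s ac(1) aK A(1)])
      fix u assume "decay m * a < u" "u \<le> a"
      moreover have "0 < decay m * a" using ac by simp
      ultimately show "tilt u b \<le> A" by (intro A(2)) linarith+
    qed
    also have "(\<integral>\<^sup>+\<omega>. ennreal (dyadic m (grid_index m s \<omega>)) * ennreal A \<partial>M) \<le> (\<integral>\<^sup>+\<omega>. ennreal ((s \<omega> + (1/2)^m) * A) \<partial>M)"
    proof (rule nn_integral_mono)
      fix \<omega> assume "\<omega> \<in> space M"
      from dyadic_grid_index(2)[OF s this, of m] A(1) have "dyadic m (grid_index m s \<omega>) * A \<le> (s \<omega> + (1/2)^m) * A"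
        by (intro mult_right_mono) (auto simp: power_divide)
      then show "ennreal (dyadic m (grid_index m s \<omega>)) * ennreal A \<le> ennreal ((s \<omega> + (1/2)^m) * A)"
        using A(1) by (subst ennreal_mult[symmetric]) (auto intro: ennreal_leI)
    qed
    also have "(\<integral>\<^sup>+\<omega>. ennreal ((s \<omega> + (1/2)^m) * A) \<partial>M) = ennreal (expectation (\<lambda>\<omega>. (s \<omega> + (1/2)^m) * A))"
      by (rule nn_integral_eq_integral) (use stopping_integrable stopping_range[OF s] A in \<open>auto intro!: AE_I2 mult_nonneg_nonneg add_nonneg_nonneg\<close>)
    also have "expectation (\<lambda>\<omega>. (s \<omega> + (1/2)^m) * A) = (expectation s + (1/2)^m) * A"
      using stopping_integrable by (simp add: prob_space)
    also have "ennreal \<beta> * ennreal ((expectation s + (1/2)^m) * A) = ennreal (\<beta> * A * (expectation s + (1/2)^m))"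
      using beta_pos A(1) expectation_stopping_nonneg by (subst ennreal_mult[symmetric]) (auto simp: ac_simps intro!: mult_nonneg_nonneg add_nonneg_nonneg)
    finally show ?thesis by (simp add: mult_left_mono add_left_mono)
  qed
  have "(\<lambda>m. \<beta> * A * (expectation s + (1/2)^m)) \<longlonglongrightarrow> \<beta> * A * (expectation s + 0)"
    by (intro tendsto_intros LIMSEQ_power_zero) simp
  then have "(\<lambda>m. tilt_integral a c x + ennreal (\<beta> * A * (expectation s + (1/2)^m))) \<longlonglongrightarrow> tilt_integral a c x + ennreal (\<beta> * A * (expectation s + 0))"
    by (intro tendsto_add tendsto_const tendsto_ennrealI)
  from LIMSEQ_le[OF tilt_integral_limit[OF ac] this] m
  have "(\<integral>\<^sup>+\<omega>. tilt_integral a c (X (s \<omega>) \<omega>) \<partial>M) \<le> tilt_integral a c x + ennreal (\<beta> * A * (expectation s + 0))" by blast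
  also have "ennreal (\<beta> * A * (expectation s + 0)) = ennreal (\<beta> * A) * (\<integral>\<^sup>+\<omega>. ennreal (s \<omega>) \<partial>M)"
    unfolding nn_stopping using beta_pos A(1) expectation_stopping_nonneg by (subst ennreal_mult[symmetric]) auto
  finally show ?thesis .
qed

text \<open>Here the boundary term at \<open>c\<close> has to be kept. It is at most
  \<open>\<beta> * B * real N\<close>, and \<open>B\<close> can be taken small when \<open>k\<close>
  and \<open>c\<close> are close to \<open>K\<close>. For a fine mesh the range
  \<open>(decay m * c, c]\<close> lies in \<open>(k, c]\<close>, so the bound by \<open>B\<close> is
  asked only there.\<close>

lemma tilt_integral_lower_bound:
  assumes ac: "0 < a" "a \<le> c" "c < K" and A: "0 \<le> A" "\<And>u. 0 < u \<Longrightarrow> u \<le> a \<Longrightarrow> A \<le> exp (- phi u)"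
    and B: "0 \<le> B" "0 < k" "k < c" "\<And>u. k < u \<Longrightarrow> u \<le> c \<Longrightarrow> tilt u b \<le> B"
    and Z [measurable]: "Z \<in> borel_measurable M" and Z0: "\<And>\<omega>. 0 \<le> Z \<omega>" and Zb: "\<And>\<omega> m j. \<omega> \<in> space M \<Longrightarrow> dyadic m j \<le> real N \<Longrightarrow> - Z \<omega> \<le> X (dyadic m j) \<omega>"
  shows "tilt_integral a c x + ennreal \<beta> * (\<integral>\<^sup>+\<omega>. ennreal (s \<omega>) * ennreal (A * exp (- a * Z \<omega>)) \<partial>M)
     \<le> (\<integral>\<^sup>+\<omega>. tilt_integral a c (X (s \<omega>) \<omega>) \<partial>M) + ennreal (\<beta> * B * real N)"
proof -
  have aK: "a < K" using ac by simp
  have c0: "0 < c" using ac by simp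
  have m: "tilt_integral a c x + ennreal \<beta> * (\<integral>\<^sup>+\<omega>. ennreal (s \<omega>) * ennreal (A * exp (- a * Z \<omega>)) \<partial>M)
     \<le> (\<integral>\<^sup>+\<omega>. tilt_integral a c (X (dyadic m (grid_index m s \<omega>)) \<omega>) \<partial>M) + ennreal (\<beta> * B * real N)" if k: "k < decay m * c" for m
  proof -
    have "tilt_integral a c x + ennreal \<beta> * (\<integral>\<^sup>+\<omega>. ennreal (s \<omega>) * ennreal (A * exp (- a * Z \<omega>)) \<partial>M)
      \<le> tilt_integral a c x + ennreal \<beta> * (\<integral>\<^sup>+\<omega>. ennreal (dyadic m (grid_index m s \<omega>)) * ennreal (A * exp (- a * Z \<omega>)) \<partial>M)"
      using dyadic_grid_index(1)[OF s, of _ m] by (intro add_left_mono mult_left_mono nn_integral_mono mult_right_mono ennreal_leI) auto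
    also have "\<dots> \<le> tilt_integral a c x + (\<Sum>j<N * 2^m. \<integral>\<^sup>+\<omega>. indicator {\<omega>. j < grid_index m s \<omega>} \<omega> * tilt_integral (decay m * a) a (X (dyadic m j) \<omega>) \<partial>M)"
      using before_tilt_integral_lower[OF s ac(1) aK A Z Z0 Zb] by (intro add_left_mono)
    also have "\<dots> = (\<integral>\<^sup>+\<omega>. tilt_integral a c (X (dyadic m (grid_index m s \<omega>)) \<omega>) \<partial>M)
      + (\<Sum>j<N * 2^m. \<integral>\<^sup>+\<omega>. indicator {\<omega>. j < grid_index m s \<omega>} \<omega> * tilt_integral (decay m * c) c (X (dyadic m j) \<omega>) \<partial>M)"
      by (rule tilt_integral_identity[OF s ac, symmetric])
    also have "\<dots> \<le> (\<integral>\<^sup>+\<omega>. tilt_integral a c (X (dyadic m (grid_index m s \<omega>)) \<omega>) \<partial>M) + ennreal \<beta> * (\<integral>\<^sup>+\<omega>. ennreal (dyadic m (grid_index m s \<omega>)) * ennreal B \<partial>M)"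
      using k B(4) by (intro add_left_mono before_tilt_integral_upper[OF s c0 ac(3) B(1)]) auto
    also have "(\<integral>\<^sup>+\<omega>. ennreal (dyadic m (grid_index m s \<omega>)) * ennreal B \<partial>M) \<le> (\<integral>\<^sup>+\<omega>. ennreal (real N) * ennreal B \<partial>M)"
    proof (intro nn_integral_mono mult_right_mono ennreal_leI)
      fix \<omega> assume "\<omega> \<in> space M"
      from grid_index_le[OF s this, of m] have "dyadic m (grid_index m s \<omega>) \<le> dyadic m (N * 2^m)" by simp
      then show "dyadic m (grid_index m s \<omega>) \<le> real N" by (simp add: dyadic_def)
    qed simp
    also have "(\<integral>\<^sup>+\<omega>. ennreal (real N) * ennreal B \<partial>M) = ennreal (real N) * ennreal B" by (simp add: emeasure_space_1)
    also have "ennreal \<beta> * (ennreal (real N) * ennreal B) = ennreal (\<beta> * B * real N)"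
      using beta_pos B(1) by (simp add: ennreal_mult[symmetric] ac_simps)
    finally show ?thesis by (simp add: mult_left_mono add_left_mono)
  qed
  have "(\<lambda>m. \<beta> * (1/2)^m) \<longlonglongrightarrow> \<beta> * 0" by (intro tendsto_mult tendsto_const LIMSEQ_power_zero) simp
  then have "(\<lambda>m. exp (- (\<beta> * (1/2)^m)) * c) \<longlonglongrightarrow> exp (- (\<beta> * 0)) * c"
    by (rule tendsto_mult[OF tendsto_exp[OF tendsto_minus] tendsto_const])
  then have "(\<lambda>m. decay m * c) \<longlonglongrightarrow> c" by (simp add: decay_def power_divide)
  then have ev: "eventually (\<lambda>m. k < decay m * c) sequentially" using B(3) by (rule order_tendstoD)
  show ?thesis
  proof (rule tendsto_lowerbound[OF tendsto_add[OF tilt_integral_limit[OF ac] tendsto_const]])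
    show "eventually (\<lambda>m. tilt_integral a c x + ennreal \<beta> * (\<integral>\<^sup>+\<omega>. ennreal (s \<omega>) * ennreal (A * exp (- a * Z \<omega>)) \<partial>M)
     \<le> (\<integral>\<^sup>+\<omega>. tilt_integral a c (X (dyadic m (grid_index m s \<omega>)) \<omega>) \<partial>M) + ennreal (\<beta> * B * real N)) sequentially"
      using ev by eventually_elim (rule m)
  qed simp
qed

end

text \<open>The positive part of \<open>G\<close>, with \<open>loss\<close> as its negative part.
  The integrand has the sign of \<open>y - x\<close> and \<open>ennreal\<close> cuts off negative
  values, so for every \<open>y\<close> at least one of the two is 0.\<close>

definition gain :: "real \<Rightarrow> ennreal" where
  "gain y = (\<integral>\<^sup>+u\<in>{0<..<K}. ennreal ((exp (u * y) - exp (u * x)) * exp (- phi u) / u) \<partial>lborel)"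

definition loss :: "real \<Rightarrow> ennreal" where
  "loss y = (\<integral>\<^sup>+u\<in>{0<..<K}. ennreal ((exp (u * x) - exp (u * y)) * exp (- phi u) / u) \<partial>lborel)"

text \<open>The offset 3 gives \<open>epsn n < K / 2 < kapn n\<close> for every \<open>n\<close>, so
  each truncated range is nonempty and contains \<open>K / 2\<close>.\<close>

definition epsn :: "nat \<Rightarrow> real" where "epsn n = K / (real n + 3)"
definition kapn :: "nat \<Rightarrow> real" where "kapn n = K - K / (real n + 3)"

lemma epsn_kapn: "0 < epsn n" "epsn n \<le> kapn n" "kapn n < K"
  using K_pos by (auto simp: epsn_def kapn_def field_simps)

lemma epsn_tendsto: "epsn \<longlonglongrightarrow> 0" and kapn_tendsto: "kapn \<longlonglongrightarrow> K"
proof -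
  have "filterlim (\<lambda>n. real n + 3) at_top sequentially"
    by (rule filterlim_tendsto_add_at_top[OF tendsto_const[of 3] filterlim_real_sequentially, THEN filterlim_cong[THEN iffD1, rotated 3]])
       (auto simp: add.commute)
  then have 1: "(\<lambda>n. K / (real n + 3)) \<longlonglongrightarrow> 0" by (intro real_tendsto_divide_at_top[OF tendsto_const])
  then show "epsn \<longlonglongrightarrow> 0" by (simp add: epsn_def[abs_def])
  from tendsto_diff[OF tendsto_const[of K] 1] show "kapn \<longlonglongrightarrow> K" by (simp add: kapn_def[abs_def])
qed

lemma epsn_antimono: "n \<le> n' \<Longrightarrow> epsn n' \<le> epsn n" and kapn_mono: "n \<le> n' \<Longrightarrow> kapn n \<le> kapn n'"
  using K_pos by (auto simp: epsn_def kapn_def intro!: divide_left_mono)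

text \<open>Monotone convergence in \<open>u\<close> and then in \<open>\<omega>\<close>, as the
  truncated ranges increase to \<open>(0, K)\<close>. The factor \<open>g\<close> will be 1 or the
  indicator of an event of the past.\<close>

lemma truncated_tendsto:
  fixes f :: "real \<Rightarrow> real \<Rightarrow> ennreal"
  assumes [measurable]: "(\<lambda>p. f (fst p) (snd p)) \<in> borel_measurable (borel \<Otimes>\<^sub>M borel)" "Y \<in> borel_measurable M" "g \<in> borel_measurable M"
  shows "(\<lambda>n. \<integral>\<^sup>+\<omega>. g \<omega> * (\<integral>\<^sup>+u\<in>{epsn n<..kapn n}. f u (Y \<omega>) \<partial>lborel) \<partial>M) \<longlonglongrightarrow> (\<integral>\<^sup>+\<omega>. g \<omega> * (\<integral>\<^sup>+u\<in>{0<..<K}. f u (Y \<omega>) \<partial>lborel) \<partial>M)"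
proof -
  have [measurable]: "(\<lambda>p. f (fst p) (Y (snd p))) \<in> borel_measurable (borel \<Otimes>\<^sub>M M)"
    using measurable_compose[of "\<lambda>p. (fst p, Y (snd p))" "borel \<Otimes>\<^sub>M M" "borel \<Otimes>\<^sub>M borel", OF _ assms(1)] by simp
  have [measurable]: "(\<lambda>u. f u y) \<in> borel_measurable borel" for y
    using measurable_compose[of "\<lambda>u. (u, y)" borel "borel \<Otimes>\<^sub>M borel", OF _ assms(1)] by simp
  have [measurable]: "(\<lambda>p. f (snd p) (Y (fst p))) \<in> borel_measurable (M \<Otimes>\<^sub>M lborel)"
    using measurable_compose[of "\<lambda>p. (snd p, Y (fst p))" "M \<Otimes>\<^sub>M lborel" "borel \<Otimes>\<^sub>M borel", OF _ assms(1)] by simp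
  have [measurable]: "(\<lambda>p. indicator {epsn n<..kapn n} (snd p) :: ennreal) \<in> borel_measurable (M \<Otimes>\<^sub>M lborel)" for n
    by (rule measurable_compose[OF measurable_snd]) simp
  have sub: "{epsn n<..kapn n} \<subseteq> {epsn n'<..kapn n'}" if "n \<le> n'" for n n'
    using epsn_antimono[OF that] kapn_mono[OF that] by auto
  have inc1: "incseq (\<lambda>n u. f u y * indicator {epsn n<..kapn n} u)" for y
    unfolding incseq_def le_fun_def
  proof (intro allI impI mult_left_mono)
    fix m n u assume "m \<le> (n :: nat)"
    from sub[OF this] show "indicator {epsn m<..kapn m} u \<le> (indicator {epsn n<..kapn n} u :: ennreal)"
      by (auto simp: indicator_def)
  qed simp
  have sup: "(SUP n. f u y * indicator {epsn n<..kapn n} u) = f u y * indicator {0<..<K} u" for u y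
  proof (rule antisym)
    show "(SUP n. f u y * indicator {epsn n<..kapn n} u) \<le> f u y * indicator {0<..<K} u"
    proof (rule SUP_least)
      fix n
      show "f u y * indicator {epsn n<..kapn n} u \<le> f u y * indicator {0<..<K} u"
        using epsn_kapn[of n] by (auto simp: indicator_def)
    qed
    show "f u y * indicator {0<..<K} u \<le> (SUP n. f u y * indicator {epsn n<..kapn n} u)"
    proof (cases "u \<in> {0<..<K}")
      case True
      have "eventually (\<lambda>n. epsn n < u \<and> u < kapn n) sequentially"
        using order_tendstoD(2)[OF epsn_tendsto, of u] order_tendstoD(1)[OF kapn_tendsto, of u] True
        by (auto intro: eventually_conj)
      then obtain n where "epsn n < u" "u < kapn n" by (auto simp: eventually_sequentially)
      then show ?thesis using True by (intro SUP_upper2[of n]) (auto simp: indicator_def)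
    qed simp
  qed
  have inner: "(\<integral>\<^sup>+u\<in>{0<..<K}. f u y \<partial>lborel) = (SUP n. \<integral>\<^sup>+u\<in>{epsn n<..kapn n}. f u y \<partial>lborel)" for y
    unfolding sup[symmetric] by (rule nn_integral_monotone_convergence_SUP[OF inc1]) measurable
  have inc2: "incseq (\<lambda>n \<omega>. g \<omega> * (\<integral>\<^sup>+u\<in>{epsn n<..kapn n}. f u (Y \<omega>) \<partial>lborel))"
    unfolding incseq_def le_fun_def
    by (intro allI impI mult_left_mono, rule nn_integral_mono) (use inc1 in \<open>simp_all add: incseq_def le_fun_def\<close>)
  have "(\<integral>\<^sup>+\<omega>. g \<omega> * (\<integral>\<^sup>+u\<in>{0<..<K}. f u (Y \<omega>) \<partial>lborel) \<partial>M) = (SUP n. \<integral>\<^sup>+\<omega>. g \<omega> * (\<integral>\<^sup>+u\<in>{epsn n<..kapn n}. f u (Y \<omega>) \<partial>lborel) \<partial>M)"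
    unfolding inner SUP_mult_left_ennreal by (rule nn_integral_monotone_convergence_SUP[OF inc2]) measurable
  moreover have "incseq (\<lambda>n. \<integral>\<^sup>+\<omega>. g \<omega> * (\<integral>\<^sup>+u\<in>{epsn n<..kapn n}. f u (Y \<omega>) \<partial>lborel) \<partial>M)"
    unfolding incseq_def by (rule allI, rule allI, rule impI, rule nn_integral_mono) (use inc2 in \<open>simp add: incseq_def le_fun_def\<close>)
  ultimately show ?thesis using LIMSEQ_SUP by simp
qed

text \<open>The supremum of the negative parts runs over countably many times, hence is measurable,
  and it is finite because paths are bounded on compact intervals.\<close>

lemma dyadic_lower_bound:
  obtains Z where "Z \<in> borel_measurable M" "\<And>\<omega>. 0 \<le> Z \<omega>" "\<And>\<omega> m j. \<omega> \<in> space M \<Longrightarrow> dyadic m j \<le> real N \<Longrightarrow> - Z \<omega> \<le> X (dyadic m j) \<omega>"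
proof -
  define I where "I = {p :: nat \<times> nat. dyadic (fst p) (snd p) \<le> real N}"
  define Z where "Z \<omega> = (SUP p\<in>I. ennreal (- X (dyadic (fst p) (snd p)) \<omega>))" for \<omega>
  have "Z \<in> borel_measurable M" unfolding Z_def by (rule borel_measurable_SUP) auto
  moreover have "- enn2real (Z \<omega>) \<le> X (dyadic m j) \<omega>" if w: "\<omega> \<in> space M" and j: "dyadic m j \<le> real N" for \<omega> m j
  proof -
    obtain B where B: "\<And>t. t \<in> {0..real N} \<Longrightarrow> \<bar>X t \<omega>\<bar> \<le> B" using X_bounded[OF w] by blast
    have "Z \<omega> \<le> ennreal B" unfolding Z_def
    proof (rule SUP_least)
      fix p assume "p \<in> I"
      then have "\<bar>X (dyadic (fst p) (snd p)) \<omega>\<bar> \<le> B" by (intro B) (auto simp: I_def)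
      then show "ennreal (- X (dyadic (fst p) (snd p)) \<omega>) \<le> ennreal B" by (intro ennreal_leI) auto
    qed
    then have fin: "Z \<omega> < top" by (rule le_less_trans) simp
    have "ennreal (- X (dyadic m j) \<omega>) \<le> Z \<omega>"
      unfolding Z_def by (rule SUP_upper2[of "(m, j)"]) (use j in \<open>auto simp: I_def\<close>)
    then have "ennreal (- X (dyadic m j) \<omega>) \<le> ennreal (enn2real (Z \<omega>))" using fin by simp
    then have "- X (dyadic m j) \<omega> \<le> enn2real (Z \<omega>)" by (cases "- X (dyadic m j) \<omega> \<ge> 0") (auto simp: ennreal_le_iff intro: order_trans[OF _ enn2real_nonneg])
    then show ?thesis by simp
  qed
  ultimately show ?thesis by (intro that[of "\<lambda>\<omega>. enn2real (Z \<omega>)"]) auto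
qed

lemma tilt_near_0: assumes "r > 0" shows "eventually (\<lambda>u. tilt u b \<le> 1 + r) (at_right 0)"
    and exp_phi_near_0: "eventually (\<lambda>u. 1 - r \<le> exp (- phi u)) (at_right 0)"
proof -
  have "((\<lambda>u. exp (u * b - phi u)) \<longlongrightarrow> exp (0 * b - 0)) (at_right 0)"
    by (intro tendsto_intros phi_tendsto_0)
  from order_tendstoD(2)[OF this, of "1 + r"] assms show "eventually (\<lambda>u. tilt u b \<le> 1 + r) (at_right 0)"
    by (auto simp: tilt_def elim!: eventually_mono)
  have "((\<lambda>u. exp (- phi u)) \<longlongrightarrow> exp (- 0)) (at_right 0)"
    by (intro tendsto_intros phi_tendsto_0)
  from order_tendstoD(1)[OF this, of "1 - r"] assms show "eventually (\<lambda>u. 1 - r \<le> exp (- phi u)) (at_right 0)"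
    by (auto elim!: eventually_mono)
qed

lemma tilt_near_K: assumes "r > 0" shows "eventually (\<lambda>u. tilt u b \<le> r) (at_left K)"
proof -
  have "((\<lambda>u. exp (- phi u)) \<longlongrightarrow> 0) (at_left K)"
    by (rule filterlim_compose[OF exp_at_bot filterlim_compose[OF filterlim_uminus_at_bot_at_top phi_lim]])
  then have "((\<lambda>u. exp (u * b) * exp (- phi u)) \<longlongrightarrow> exp (K * b) * 0) (at_left K)"
    by (intro tendsto_intros)
  from order_tendstoD(2)[OF this, of r] assms show ?thesis
    by (auto simp: tilt_def exp_add[symmetric] elim!: eventually_mono)
qed

text \<open>This is \<open>E G(X s) = \<beta> * E s\<close> with the negative part moved to the
  right, where its expectation may be infinite. The mesh limit has been taken for each fixed range
  of exponents; now the range grows to \<open>(0, K)\<close>, and the boundary densities tend to 1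
  at 0 and to 0 at \<open>K\<close>.\<close>

lemma stopping_identity:
  assumes s: "stopping b N s"
  shows "(\<integral>\<^sup>+\<omega>. gain (X (s \<omega>) \<omega>) \<partial>M) = ennreal \<beta> * (\<integral>\<^sup>+\<omega>. ennreal (s \<omega>) \<partial>M) + (\<integral>\<^sup>+\<omega>. loss (X (s \<omega>) \<omega>) \<partial>M)"
proof -
  note [measurable] = X_stopping_measurable[OF s] stopping_measurable[OF s]
  let ?gp = "\<lambda>u y. ennreal ((exp (u * y) - exp (u * x)) * exp (- phi u) / u)"
  let ?gm = "\<lambda>u y. ennreal ((exp (u * x) - exp (u * y)) * exp (- phi u) / u)"
  define P where "P n = (\<integral>\<^sup>+\<omega>. (\<integral>\<^sup>+u\<in>{epsn n<..kapn n}. ?gp u (X (s \<omega>) \<omega>) \<partial>lborel) \<partial>M)" for n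
  define Q where "Q n = (\<integral>\<^sup>+\<omega>. (\<integral>\<^sup>+u\<in>{epsn n<..kapn n}. ?gm u (X (s \<omega>) \<omega>) \<partial>lborel) \<partial>M)" for n
  define F where "F n = (\<integral>\<^sup>+\<omega>. tilt_integral (epsn n) (kapn n) (X (s \<omega>) \<omega>) \<partial>M)" for n
  define x0 where "x0 n = tilt_integral (epsn n) (kapn n) x" for n
  let ?P = "\<integral>\<^sup>+\<omega>. gain (X (s \<omega>) \<omega>) \<partial>M" and ?Q = "\<integral>\<^sup>+\<omega>. loss (X (s \<omega>) \<omega>) \<partial>M"
  have P: "P \<longlonglongrightarrow> ?P" 
    using truncated_tendsto[of ?gp "\<lambda>\<omega>. X (s \<omega>) \<omega>" "\<lambda>_. 1"] by (simp add: P_def[abs_def] gain_def)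
  have Q: "Q \<longlonglongrightarrow> ?Q" 
    using truncated_tendsto[of ?gm "\<lambda>\<omega>. X (s \<omega>) \<omega>" "\<lambda>_. 1"] by (simp add: Q_def[abs_def] loss_def)
  have x0: "x0 n \<noteq> top" for n using tilt_integral_finite[OF epsn_kapn] by (simp add: x0_def less_top)
  \<comment> \<open>Gain and loss are differences from the reference integral at \<open>x\<close>.
    That integral, \<open>x0 n\<close>, grows without bound in \<open>n\<close>, but each
    \<open>x0 n\<close> is finite, so it can be cancelled before the limit.\<close>
  have FQ: "F n + Q n = x0 n + P n" for n
  proof -
    have pw: "tilt_integral (epsn n) (kapn n) y + (\<integral>\<^sup>+u\<in>{epsn n<..kapn n}. ?gm u y \<partial>lborel) = x0 n + (\<integral>\<^sup>+u\<in>{epsn n<..kapn n}. ?gp u y \<partial>lborel)" for y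
    proof -
      have "tilt_integral (epsn n) (kapn n) y + (\<integral>\<^sup>+u\<in>{epsn n<..kapn n}. ?gm u y \<partial>lborel) = 
         (\<integral>\<^sup>+u. ennreal (tilt u y / u) * indicator {epsn n<..kapn n} u + ?gm u y * indicator {epsn n<..kapn n} u \<partial>lborel)"
        unfolding tilt_integral_def by (rule nn_integral_add[symmetric]) measurable
      also have "\<dots> = (\<integral>\<^sup>+u. ennreal (tilt u x / u) * indicator {epsn n<..kapn n} u + ?gp u y * indicator {epsn n<..kapn n} u \<partial>lborel)"
      proof (rule nn_integral_cong)
        fix u
        have "ennreal (tilt u y / u) + ?gm u y = ennreal (tilt u x / u) + ?gp u y" if "u \<in> {epsn n<..kapn n}"
        proof -
          have u: "0 < u" using that epsn_kapn(1)[of n] by auto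
          have m: "(exp (u * z) - exp (u * y)) * exp (- phi u) / u = tilt u z / u - tilt u y / u" for y z
            by (simp add: tilt_def exp_diff exp_minus divide_inverse algebra_simps)
          show ?thesis unfolding m by (rule ennreal_pos_part_swap) (use u in auto)
        qed
        then show "ennreal (tilt u y / u) * indicator {epsn n<..kapn n} u + ?gm u y * indicator {epsn n<..kapn n} u
           = ennreal (tilt u x / u) * indicator {epsn n<..kapn n} u + ?gp u y * indicator {epsn n<..kapn n} u"
          by (cases "u \<in> {epsn n<..kapn n}") auto
      qed
      also have "\<dots> = x0 n + (\<integral>\<^sup>+u\<in>{epsn n<..kapn n}. ?gp u y \<partial>lborel)"
        unfolding tilt_integral_def x0_def by (rule nn_integral_add) measurable
      finally show ?thesis .
    qed
    have "F n + Q n = (\<integral>\<^sup>+\<omega>. tilt_integral (epsn n) (kapn n) (X (s \<omega>) \<omega>) + (\<integral>\<^sup>+u\<in>{epsn n<..kapn n}. ?gm u (X (s \<omega>) \<omega>) \<partial>lborel) \<partial>M)"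
      unfolding F_def Q_def by (rule nn_integral_add[symmetric]) measurable
    also have "\<dots> = (\<integral>\<^sup>+\<omega>. x0 n \<partial>M) + P n"
      unfolding pw P_def by (rule nn_integral_add) measurable
    finally show ?thesis by (simp add: emeasure_space_1)
  qed
  have Es: "(\<integral>\<^sup>+\<omega>. ennreal (s \<omega>) \<partial>M) = ennreal (expectation s)" by (rule nn_stopping[OF s])
  have Es0: "0 \<le> expectation s" by (rule expectation_stopping_nonneg[OF s])
  have upper: "?P \<le> ennreal (\<beta> * (1 + r) * expectation s) + ?Q" if r: "r > 0" for r
  proof -
    obtain d where d: "d > 0" "\<And>u. 0 < u \<Longrightarrow> u < d \<Longrightarrow> tilt u b \<le> 1 + r"
      using tilt_near_0(1)[where b=b, OF r] unfolding eventually_at_right_field by auto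
    have "eventually (\<lambda>n. P n \<le> ennreal (\<beta> * (1 + r) * expectation s) + Q n) sequentially"
      using order_tendstoD(2)[OF epsn_tendsto d(1)]
    proof eventually_elim
      case (elim n)
      have "F n \<le> x0 n + ennreal (\<beta> * (1 + r)) * (\<integral>\<^sup>+\<omega>. ennreal (s \<omega>) \<partial>M)"
        unfolding F_def x0_def using elim d r by (intro tilt_integral_upper_bound[OF s] epsn_kapn) auto
      also have "ennreal (\<beta> * (1 + r)) * (\<integral>\<^sup>+\<omega>. ennreal (s \<omega>) \<partial>M) = ennreal (\<beta> * (1 + r) * expectation s)"
        unfolding Es using beta_pos r Es0 by (subst ennreal_mult[symmetric]) auto
      finally have "x0 n + P n \<le> x0 n + (ennreal (\<beta> * (1 + r) * expectation s) + Q n)"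
        unfolding FQ[symmetric] add.assoc[symmetric] by (rule add_right_mono)
      then show ?case using x0[of n] by (simp add: ennreal_add_left_cancel_le)
    qed
    then show ?thesis
      by (intro tendsto_le[OF sequentially_bot tendsto_add[OF tendsto_const Q] P])
  qed
  \<comment> \<open>The error \<open>\<beta> * r * real N\<close> pays for the boundary term at
    \<open>K\<close>. It depends on the time horizon \<open>N\<close>, which is fixed here, and
    vanishes with \<open>r\<close>.\<close>
  have lower: "ennreal (\<beta> * (1 - r) * expectation s) + ?Q \<le> ?P + ennreal (\<beta> * r * real N)" if r: "0 < r" "r < 1" for r
  proof -
    obtain d where d: "d > 0" "\<And>u. 0 < u \<Longrightarrow> u < d \<Longrightarrow> 1 - r \<le> exp (- phi u)"
      using exp_phi_near_0[OF r(1)] unfolding eventually_at_right_field by auto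
    obtain k0 where k0: "k0 < K" "\<And>u. k0 < u \<Longrightarrow> u < K \<Longrightarrow> tilt u b \<le> r"
      using tilt_near_K[where b=b, OF r(1)] unfolding eventually_at_left_field by auto
    define k where "k = max k0 (K/2)"
    have k: "0 < k" "k < K" "k0 \<le> k" using k0 K_pos by (auto simp: k_def)
    obtain Z where Z: "Z \<in> borel_measurable M" "\<And>\<omega>. 0 \<le> Z \<omega>" "\<And>\<omega> m j. \<omega> \<in> space M \<Longrightarrow> dyadic m j \<le> real N \<Longrightarrow> - Z \<omega> \<le> X (dyadic m j) \<omega>"
      using dyadic_lower_bound by metis
    note [measurable] = Z(1)
    let ?R = "\<lambda>n. \<integral>\<^sup>+\<omega>. ennreal (s \<omega>) * ennreal ((1 - r) * exp (- epsn n * Z \<omega>)) \<partial>M"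
    have R: "?R \<longlonglongrightarrow> (\<integral>\<^sup>+\<omega>. ennreal (s \<omega>) * ennreal ((1 - r) * exp (- 0 * Z \<omega>)) \<partial>M)"
    proof (rule nn_integral_dominated_convergence[where w="\<lambda>\<omega>. ennreal (s \<omega>)"])
      show "AE \<omega> in M. ennreal (s \<omega>) * ennreal ((1 - r) * exp (- epsn n * Z \<omega>)) \<le> ennreal (s \<omega>)" for n
      proof (rule AE_I2)
        fix \<omega>
        have "exp (- epsn n * Z \<omega>) \<le> 1" using epsn_kapn(1)[of n] Z(2)[of \<omega>] by simp
        then have "(1 - r) * exp (- epsn n * Z \<omega>) \<le> 1 * 1" using r by (intro mult_mono) auto
        from ennreal_leI[OF this] have le1: "ennreal ((1 - r) * exp (- epsn n * Z \<omega>)) \<le> 1" by (simp only: mult_1 ennreal_1)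
        show "ennreal (s \<omega>) * ennreal ((1 - r) * exp (- epsn n * Z \<omega>)) \<le> ennreal (s \<omega>)"
          using mult_left_mono[OF le1, of "ennreal (s \<omega>)"] by (simp only: mult_1_right zero_le)
      qed
      show "AE \<omega> in M. (\<lambda>n. ennreal (s \<omega>) * ennreal ((1 - r) * exp (- epsn n * Z \<omega>))) \<longlonglongrightarrow> ennreal (s \<omega>) * ennreal ((1 - r) * exp (- 0 * Z \<omega>))"
        by (intro AE_I2 ennreal_tendsto_cmult tendsto_ennrealI tendsto_intros epsn_tendsto) auto
    qed (auto simp: Es)
    have R0: "(\<integral>\<^sup>+\<omega>. ennreal (s \<omega>) * ennreal ((1 - r) * exp (- 0 * Z \<omega>)) \<partial>M) = ennreal ((1 - r) * expectation s)"
      using r Es0 by (simp add: nn_integral_multc Es ennreal_mult[symmetric] mult.commute)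
    have "eventually (\<lambda>n. ennreal \<beta> * ?R n + Q n \<le> P n + ennreal (\<beta> * r * real N)) sequentially"
      using order_tendstoD(2)[OF epsn_tendsto d(1)] order_tendstoD(1)[OF kapn_tendsto k(2)]
    proof eventually_elim
      case (elim n)
      have "x0 n + ennreal \<beta> * ?R n \<le> F n + ennreal (\<beta> * r * real N)"
        unfolding F_def x0_def
      proof (rule tilt_integral_lower_bound[OF s epsn_kapn _ _ _ k(1) elim(2) _ Z])
        fix u assume "k < u" "u \<le> kapn n"
        then show "tilt u b \<le> r" using k(3) epsn_kapn(3)[of n] by (intro k0(2)) auto
      qed (use elim(1) d r in auto)
      then have "(x0 n + ennreal \<beta> * ?R n) + Q n \<le> (F n + ennreal (\<beta> * r * real N)) + Q n" by (rule add_right_mono)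
      also have "\<dots> = (F n + Q n) + ennreal (\<beta> * r * real N)" by (simp only: ac_simps)
      finally have "x0 n + (ennreal \<beta> * ?R n + Q n) \<le> x0 n + (P n + ennreal (\<beta> * r * real N))"
        unfolding FQ by (simp only: add.assoc)
      then show ?case using x0[of n] by (simp add: ennreal_add_left_cancel_le)
    qed
    then have "ennreal \<beta> * ennreal ((1 - r) * expectation s) + ?Q \<le> ?P + ennreal (\<beta> * r * real N)"
      by (intro tendsto_le[OF sequentially_bot tendsto_add[OF P tendsto_const] tendsto_add[OF ennreal_tendsto_cmult[OF _ R[unfolded R0]] Q]]) auto
    then show ?thesis using beta_pos r Es0 by (simp add: ennreal_mult[symmetric] mult.assoc)
  qed
  \<comment> \<open>The errors \<open>r\<close> run through the powers of 1/2 from 1/2 on, because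
    the lower estimate requires \<open>r < 1\<close>.\<close>
  have half: "(\<lambda>k. (1/2::real)^Suc k) \<longlonglongrightarrow> 0"
    by (rule LIMSEQ_Suc[OF LIMSEQ_power_zero]) simp
  have h: "0 < (1/2::real)^Suc k" "(1/2::real)^Suc k < 1" for k
    by (simp_all add: power_less_one_iff del: power_Suc)
  have "?P \<le> ennreal (\<beta> * (1 + 0) * expectation s) + ?Q"
  proof (rule LIMSEQ_le_const)
    show "(\<lambda>k. ennreal (\<beta> * (1 + (1/2)^Suc k) * expectation s) + ?Q) \<longlonglongrightarrow> ennreal (\<beta> * (1 + 0) * expectation s) + ?Q"
      by (intro tendsto_add[OF tendsto_ennrealI tendsto_const] tendsto_mult tendsto_add tendsto_const half)
  qed (use upper[OF h(1)] in blast)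
  moreover have "ennreal (\<beta> * (1 - 0) * expectation s) + ?Q \<le> ?P + ennreal (\<beta> * 0 * real N)"
  proof (rule LIMSEQ_le)
    show "(\<lambda>k. ennreal (\<beta> * (1 - (1/2)^Suc k) * expectation s) + ?Q) \<longlonglongrightarrow> ennreal (\<beta> * (1 - 0) * expectation s) + ?Q"
      by (intro tendsto_add[OF tendsto_ennrealI tendsto_const] tendsto_mult tendsto_diff tendsto_const half)
    show "(\<lambda>k. ?P + ennreal (\<beta> * (1/2)^Suc k * real N)) \<longlonglongrightarrow> ?P + ennreal (\<beta> * 0 * real N)"
      by (intro tendsto_add[OF tendsto_const tendsto_ennrealI] tendsto_mult tendsto_const half)
  qed (use lower[OF h] in blast)
  ultimately have "?P = ennreal (\<beta> * expectation s) + ?Q" by (intro antisym) simp_all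
  also have "ennreal (\<beta> * expectation s) = ennreal \<beta> * (\<integral>\<^sup>+\<omega>. ennreal (s \<omega>) \<partial>M)"
    unfolding Es using beta_pos Es0 by (simp add: ennreal_mult)
  finally show ?thesis .
qed

end

section \<open>First passage and quasi-left-continuity\<close>

lemma dyadic_approx_above:
  assumes "0 \<le> q"
  shows "\<exists>p. (\<forall>m. q \<le> dyadic m (p m)) \<and> (\<lambda>m. dyadic m (p m)) \<longlonglongrightarrow> q"
proof -
  define p where "p m = nat \<lceil>q * 2^m\<rceil>" for m :: nat
  have r: "real (p m) = of_int \<lceil>q * 2^m\<rceil>" for m using assms by (simp add: p_def of_nat_nat)
  have 1: "q \<le> dyadic m (p m)" for m unfolding dyadic_def r by (simp add: field_simps)
  have "of_int \<lceil>q * 2^m\<rceil> \<le> q * 2^m + 1" for m by linarith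
  then have 2: "dyadic m (p m) \<le> q + (1/2)^m" for m unfolding dyadic_def r by (simp add: field_simps)
  have "(\<lambda>m. dyadic m (p m)) \<longlonglongrightarrow> q"
  proof (rule tendsto_sandwich[OF _ _ tendsto_const])
    show "(\<lambda>m. q + (1/2)^m) \<longlonglongrightarrow> q"
      using tendsto_add[OF tendsto_const LIMSEQ_power_zero[of "1/2::real"], of q] by simp
  qed (intro always_eventually allI 1 2)+
  with 1 show ?thesis by blast
qed

context levy_ou
begin

text \<open>The running supremum of \<open>X\<close> over \<open>[0, t]\<close> is at least \<open>c\<close>. Unlike the event that the level has been
  attained, this is determined by countably many times.\<close>

definition reach :: "real \<Rightarrow> real \<Rightarrow> 'a \<Rightarrow> bool" where
  "reach c t \<omega> \<longleftrightarrow> (\<forall>c'<c. \<exists>q. 0 \<le> q \<and> q \<le> t \<and> c' < X q \<omega>)"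

text \<open>Inserting \<open>real N\<close> truncates the time at \<open>N\<close> and at the same
  time makes the infimum that of a nonempty set.\<close>

definition first_reach :: "real \<Rightarrow> nat \<Rightarrow> 'a \<Rightarrow> real" where
  "first_reach c N \<omega> = Inf (insert (real N) {t. 0 \<le> t \<and> reach c t \<omega>})"

lemma reach_mono: "reach c t \<omega> \<Longrightarrow> t \<le> t' \<Longrightarrow> reach c t' \<omega>"
  unfolding reach_def by (meson order_trans)

lemma reach_antimono: "reach c t \<omega> \<Longrightarrow> c' \<le> c \<Longrightarrow> reach c' t \<omega>"
  unfolding reach_def by (meson less_le_trans)

lemma reachI: "0 \<le> t \<Longrightarrow> c \<le> X t \<omega> \<Longrightarrow> reach c t \<omega>"
  unfolding reach_def by (meson order_refl less_le_trans)

lemma not_reachD: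
  assumes "\<not> reach c t \<omega>" obtains c' where "c' < c" "\<And>q. 0 \<le> q \<Longrightarrow> q \<le> t \<Longrightarrow> X q \<omega> \<le> c'"
  using assms unfolding reach_def by (meson not_le)

lemma not_reach_less: "\<not> reach c t \<omega> \<Longrightarrow> 0 \<le> q \<Longrightarrow> q \<le> t \<Longrightarrow> X q \<omega> < c"
  using not_reachD by (metis le_less_trans)

text \<open>If the supremum over \<open>[0, t]\<close> is below \<open>c\<close>, right continuity
  at \<open>t\<close> keeps it below \<open>c\<close> a little longer. Consequently the infimum of
  the times at which a level has been reached is itself such a time.\<close>

lemma reach_closed:
  assumes w: "\<omega> \<in> space M" and t: "0 \<le> t" and nr: "\<not> reach c t \<omega>"
  shows "\<exists>d>t. \<not> reach c d \<omega>"
proof -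
  obtain c' where c': "c' < c" "\<And>q. 0 \<le> q \<Longrightarrow> q \<le> t \<Longrightarrow> X q \<omega> \<le> c'" using not_reachD[OF nr] by blast
  define c'' where "c'' = (c' + c) / 2"
  have c'': "c' < c''" "c'' < c" using c' by (auto simp: c''_def)
  have "X t \<omega> < c''" using c'(2)[of t] t c'' by auto
  from order_tendstoD(2)[OF X_right[OF w t] this] obtain d where d: "d > t" "\<And>q. t < q \<Longrightarrow> q < d \<Longrightarrow> X q \<omega> < c''"
    unfolding eventually_at_right_field by auto
  have "\<not> reach c ((t + d) / 2) \<omega>"
  proof
    assume "reach c ((t + d) / 2) \<omega>"
    then obtain q where q: "0 \<le> q" "q \<le> (t + d) / 2" "c'' < X q \<omega>" unfolding reach_def using c'' by blast
    show False
    proof (cases "q \<le> t")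
      case True then show False using c'(2)[of q] q c'' by auto
    next
      case False
      then have "t < q" "q < d" using q(2) d(1) by simp_all
      then show False using d(2)[of q] q(3) by simp
    qed
  qed
  then show ?thesis using d(1) by (intro exI[of _ "(t + d) / 2"]) auto
qed

lemma first_reach_bdd: "bdd_below (insert (real N) {t. 0 \<le> t \<and> reach c t \<omega>})"
  by (rule bdd_belowI[of _ 0]) auto

lemma first_reach_range: "0 \<le> first_reach c N \<omega>" "first_reach c N \<omega> \<le> real N"
proof -
  show "0 \<le> first_reach c N \<omega>" unfolding first_reach_def by (rule cInf_greatest) auto
  show "first_reach c N \<omega> \<le> real N" unfolding first_reach_def by (rule cInf_lower[OF _ first_reach_bdd]) simp
qed

lemma first_reach_le: "0 \<le> t \<Longrightarrow> reach c t \<omega> \<Longrightarrow> first_reach c N \<omega> \<le> t"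
  unfolding first_reach_def by (rule cInf_lower[OF _ first_reach_bdd]) simp

lemma less_first_reach_iff:
  assumes w: "\<omega> \<in> space M" and t: "0 \<le> t"
  shows "t < first_reach c N \<omega> \<longleftrightarrow> t < real N \<and> \<not> reach c t \<omega>"
proof
  assume "t < first_reach c N \<omega>"
  then show "t < real N \<and> \<not> reach c t \<omega>" using first_reach_range(2)[of c N \<omega>] first_reach_le[OF t, of c \<omega> N] by auto
next
  assume a: "t < real N \<and> \<not> reach c t \<omega>"
  then obtain d where d: "d > t" "\<not> reach c d \<omega>" using reach_closed[OF w t] by blast
  have "min d (real N) \<le> first_reach c N \<omega>" unfolding first_reach_def
  proof (rule cInf_greatest)
    fix r assume "r \<in> insert (real N) {t. 0 \<le> t \<and> reach c t \<omega>}"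
    then show "min d (real N) \<le> r" using d(2) reach_mono[of c r \<omega> d] by (cases "d \<le> r") auto
  qed simp
  then show "t < first_reach c N \<omega>" using a d by auto
qed

lemma reach_first_reach: assumes "\<omega> \<in> space M" "reach c (real N) \<omega>" shows "reach c (first_reach c N \<omega>) \<omega>"
  using less_first_reach_iff[OF assms(1) first_reach_range(1), of c N \<omega> c N] first_reach_range(2)[of c N \<omega>] assms(2)
  by (cases "first_reach c N \<omega> < real N") auto

lemma first_reach_not_reach: assumes "\<omega> \<in> space M" "\<not> reach c (real N) \<omega>" shows "first_reach c N \<omega> = real N"
proof (rule antisym[OF first_reach_range(2)])
  show "real N \<le> first_reach c N \<omega>" unfolding first_reach_def
  proof (rule cInf_greatest)
    fix r assume "r \<in> insert (real N) {t. 0 \<le> t \<and> reach c t \<omega>}"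
    then show "real N \<le> r" using assms(2) reach_mono[of c r \<omega> "real N"] by (cases "real N \<le> r") auto
  qed simp
qed

lemma first_reach_stable: assumes "reach c (real N) \<omega>" "N \<le> N'" shows "first_reach c N' \<omega> = first_reach c N \<omega>"
proof -
  have "Inf (insert (real k) {t. 0 \<le> t \<and> reach c t \<omega>}) = Inf {t. 0 \<le> t \<and> reach c t \<omega>}" if "N \<le> k" for k
  proof -
    have "reach c (real k) \<omega>" using reach_mono[OF assms(1)] that by simp
    then show ?thesis by (simp add: insert_absorb)
  qed
  then show ?thesis unfolding first_reach_def using assms(2) by simp
qed

lemma first_reach_mono_time: "N \<le> N' \<Longrightarrow> first_reach c N \<omega> \<le> first_reach c N' \<omega>"
proof -
  assume le: "N \<le> N'"
  show ?thesis unfolding first_reach_def[of c N']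
  proof (rule cInf_greatest)
    fix r assume "r \<in> insert (real N') {t. 0 \<le> t \<and> reach c t \<omega>}"
    then show "first_reach c N \<omega> \<le> r" using first_reach_range(2)[of c N \<omega>] le first_reach_le[of r c \<omega> N] by auto
  qed simp
qed

lemma first_reach_mono_level: "c \<le> c' \<Longrightarrow> first_reach c N \<omega> \<le> first_reach c' N \<omega>"
  unfolding first_reach_def by (rule cInf_superset_mono[OF _ first_reach_bdd]) (auto intro: reach_antimono)

text \<open>A time before \<open>dyadic m k\<close> at which \<open>X\<close> exceeds
  \<open>c - 1 / (real n + 1)\<close> can be moved to the right onto a dyadic time that is still
  before \<open>dyadic m k\<close>, by right continuity; the end point itself is dyadic. So the grid
  values up to \<open>dyadic m k\<close> decide the event.\<close>

lemma reach_past: "{\<omega>\<in>space M. reach c (dyadic m k) \<omega>} \<in> sets (past (dyadic m k))"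
proof -
  have eq: "{\<omega>\<in>space M. reach c (dyadic m k) \<omega>} = {\<omega>\<in>space (past (dyadic m k)). \<forall>n::nat. \<exists>p\<in>{p. dyadic (fst p) (snd p) \<le> dyadic m k}. c - 1 / (real n + 1) < X (dyadic (fst p) (snd p)) \<omega>}"
  proof (intro Collect_cong conj_cong, simp, intro iffI allI)
    fix \<omega> n assume "\<omega> \<in> space (past (dyadic m k))" and r: "reach c (dyadic m k) \<omega>"
    then have w: "\<omega> \<in> space M" by simp
    let ?c = "c - 1 / (real n + 1)"
    have "?c < c" by simp
    then obtain q where q: "0 \<le> q" "q \<le> dyadic m k" "?c < X q \<omega>" using r unfolding reach_def by blast
    show "\<exists>p\<in>{p. dyadic (fst p) (snd p) \<le> dyadic m k}. ?c < X (dyadic (fst p) (snd p)) \<omega>"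
    proof (cases "q = dyadic m k")
      case True then show ?thesis using q by (intro bexI[of _ "(m, k)"]) auto
    next
      case False
      obtain p where p: "\<And>n. q \<le> dyadic n (p n)" "(\<lambda>n. dyadic n (p n)) \<longlonglongrightarrow> q" using dyadic_approx_above[OF q(1)] by blast
      have "(\<lambda>n. X (dyadic n (p n)) \<omega>) \<longlonglongrightarrow> X q \<omega>" by (rule right_continuous_seq[OF X_right[OF w q(1)] p(2,1)])
      from order_tendstoD(1)[OF this q(3)] order_tendstoD(2)[OF p(2), of "dyadic m k"] False q(2)
      have "eventually (\<lambda>n. ?c < X (dyadic n (p n)) \<omega> \<and> dyadic n (p n) < dyadic m k) sequentially" by (auto intro: eventually_conj)
      then obtain n where "?c < X (dyadic n (p n)) \<omega>" "dyadic n (p n) < dyadic m k" by (auto simp: eventually_sequentially)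
      then show ?thesis by (intro bexI[of _ "(n, p n)"]) auto
    qed
  next
    fix \<omega> assume h: "\<forall>n::nat. \<exists>p\<in>{p. dyadic (fst p) (snd p) \<le> dyadic m k}. c - 1 / (real n + 1) < X (dyadic (fst p) (snd p)) \<omega>"
    show "reach c (dyadic m k) \<omega>" unfolding reach_def
    proof (intro allI impI)
      fix c' assume "c' < c"
      then obtain n where "inverse (real (Suc n)) < c - c'" using reals_Archimedean[of "c - c'"] by auto
      then have "c' < c - 1 / (real n + 1)" by (simp add: inverse_eq_divide add.commute)
      with h show "\<exists>q. 0 \<le> q \<and> q \<le> dyadic m k \<and> c' < X q \<omega>" by (meson dyadic_nonneg less_trans mem_Collect_eq)
    qed
  qed
  have [measurable]: "X (dyadic (fst p) (snd p)) \<in> borel_measurable (past (dyadic m k))" if "p \<in> {p. dyadic (fst p) (snd p) \<le> dyadic m k}" for p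
    using that by (intro X_past) auto
  have S: "(\<Union>p\<in>{p. dyadic (fst p) (snd p) \<le> dyadic m k}. {\<omega>\<in>space (past (dyadic m k)). c - 1 / (real n + 1) < X (dyadic (fst p) (snd p)) \<omega>}) \<in> sets (past (dyadic m k))" for n :: nat
    by (rule sets.countable_UN'') (auto simp del: space_past)
  have "(\<Inter>n. \<Union>p\<in>{p. dyadic (fst p) (snd p) \<le> dyadic m k}. {\<omega>\<in>space (past (dyadic m k)). c - 1 / (real n + 1) < X (dyadic (fst p) (snd p)) \<omega>}) \<in> sets (past (dyadic m k))"
    by (rule sets.countable_INT') (use S in auto)
  also have "(\<Inter>n. \<Union>p\<in>{p. dyadic (fst p) (snd p) \<le> dyadic m k}. {\<omega>\<in>space (past (dyadic m k)). c - 1 / (real n + 1) < X (dyadic (fst p) (snd p)) \<omega>})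
     = {\<omega>\<in>space (past (dyadic m k)). \<forall>n::nat. \<exists>p\<in>{p. dyadic (fst p) (snd p) \<le> dyadic m k}. c - 1 / (real n + 1) < X (dyadic (fst p) (snd p)) \<omega>}"
    by blast
  finally have "{\<omega>\<in>space (past (dyadic m k)). \<forall>n::nat. \<exists>p\<in>{p. dyadic (fst p) (snd p) \<le> dyadic m k}. c - 1 / (real n + 1) < X (dyadic (fst p) (snd p)) \<omega>} \<in> sets (past (dyadic m k))" .
  then show ?thesis unfolding eq .
qed

lemma reach_sets [measurable]: "{\<omega>\<in>space M. reach c (real N) \<omega>} \<in> sets M"
  using reach_past[of c 0 N] sets_past_subset by (auto simp: dyadic_def)

text \<open>Levels below \<open>b\<close> are allowed so that their passage times all share the
  constants attached to \<open>b\<close> and \<open>N\<close>.\<close>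

lemma stopping_first_reach: assumes "c \<le> b" shows "stopping b N (first_reach c N)"
  unfolding stopping_def
proof (intro conjI ballI allI impI)
  fix m k
  have "{\<omega>\<in>space M. dyadic m k < first_reach c N \<omega>} = (if dyadic m k < real N then space (past (dyadic m k)) - {\<omega>\<in>space M. reach c (dyadic m k) \<omega>} else {})"
    using less_first_reach_iff[OF _ dyadic_nonneg, of _ m k c N] by auto
  also have "\<dots> \<in> sets (past (dyadic m k))" using sets.compl_sets[OF reach_past[of c m k]] by simp
  finally show "{\<omega>\<in>space M. dyadic m k < first_reach c N \<omega>} \<in> sets (past (dyadic m k))" .
next
  fix \<omega> q assume w: "\<omega> \<in> space M" and q: "0 \<le> q \<and> q < first_reach c N \<omega>"
  then have "\<not> reach c q \<omega>" using less_first_reach_iff[OF w, of q c N] by auto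
  then show "X q \<omega> \<le> b" using not_reach_less[of c q \<omega> q] q assms by auto
qed (simp_all add: first_reach_range)

text \<open>If the supremum up to \<open>t\<close> is below \<open>b\<close>, it is below
  \<open>c j\<close> for large \<open>j\<close>, so those levels have not been passed by
  \<open>t\<close> either. Here passage by supremum matters: a path that merely avoids
  \<open>b\<close> may come arbitrarily close to it.\<close>

lemma first_reach_level_limit:
  assumes w: "\<omega> \<in> space M" and c: "c \<longlonglongrightarrow> b" "\<And>j. c j < b"
  shows "(\<lambda>j. first_reach (c j) N \<omega>) \<longlonglongrightarrow> first_reach b N \<omega>"
proof (rule increasing_tendsto)
  show "eventually (\<lambda>j. first_reach (c j) N \<omega> \<le> first_reach b N \<omega>) sequentially"
    using c(2) by (intro always_eventually allI first_reach_mono_level less_imp_le)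
  fix t assume t: "t < first_reach b N \<omega>"
  show "eventually (\<lambda>j. t < first_reach (c j) N \<omega>) sequentially"
  proof (cases "0 \<le> t")
    case False
    then show ?thesis by (intro always_eventually allI less_le_trans[OF _ first_reach_range(1)]) simp
  next
    case True
    then have tN: "t < real N" "\<not> reach b t \<omega>" using less_first_reach_iff[OF w True] t by auto
    obtain c' where c': "c' < b" "\<And>q. 0 \<le> q \<Longrightarrow> q \<le> t \<Longrightarrow> X q \<omega> \<le> c'" using not_reachD[OF tN(2)] by blast
    show ?thesis using order_tendstoD(1)[OF c(1) c'(1)]
    proof eventually_elim
      case (elim j)
      then have "\<not> reach (c j) t \<omega>" using c'(2) unfolding reach_def by (meson not_less)
      then show ?case using less_first_reach_iff[OF w True] tN by auto
    qed
  qed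
qed

text \<open>Either some lower level is passed at the same time as \<open>b\<close>, and then the
  sequence is eventually constant; or all lower levels are passed strictly earlier, and then the
  limit is a left limit of the path, which equals \<open>b\<close>. Only in the second case could a
  jump at the passage time do harm.\<close>

lemma first_reach_path_limit:
  assumes w: "\<omega> \<in> space M" and c: "c \<longlonglongrightarrow> b" "\<And>j. c j < b" "mono c"
  shows "\<exists>l. (\<lambda>j. X (first_reach (c j) N \<omega>) \<omega>) \<longlonglongrightarrow> l \<and> (l = b \<or> l = X (first_reach b N \<omega>) \<omega> \<and> (reach b (first_reach b N \<omega>) \<omega> \<longrightarrow> b \<le> l))"
proof (cases "\<exists>j0. first_reach (c j0) N \<omega> = first_reach b N \<omega>")
  case True
  then obtain j0 where j0: "first_reach (c j0) N \<omega> = first_reach b N \<omega>" by blast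
  have "first_reach (c j) N \<omega> = first_reach b N \<omega>" if "j \<ge> j0" for j
    using first_reach_mono_level[OF monoD[OF c(3) that], of N \<omega>] first_reach_mono_level[OF less_imp_le[OF c(2)], of j N \<omega>] j0 by simp
  then have "eventually (\<lambda>j. X (first_reach (c j) N \<omega>) \<omega> = X (first_reach b N \<omega>) \<omega>) sequentially"
    unfolding eventually_sequentially by (intro exI[of _ j0]) auto
  then have "(\<lambda>j. X (first_reach (c j) N \<omega>) \<omega>) \<longlonglongrightarrow> X (first_reach b N \<omega>) \<omega>" by (rule tendsto_eventually)
  \<comment> \<open>Before this time the path stays below \<open>c j0 < b\<close>, so a supremum of
    at least \<open>b\<close> can only come from the value at the time itself.\<close>
  moreover have "b \<le> X (first_reach b N \<omega>) \<omega>" if r: "reach b (first_reach b N \<omega>) \<omega>"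
  proof (rule ccontr)
    assume "\<not> b \<le> X (first_reach b N \<omega>) \<omega>"
    then have "max (X (first_reach b N \<omega>) \<omega>) (c j0) < b" using c(2)[of j0] by simp
    then obtain q where q: "0 \<le> q" "q \<le> first_reach b N \<omega>" "max (X (first_reach b N \<omega>) \<omega>) (c j0) < X q \<omega>" using r unfolding reach_def by blast
    then have "q < first_reach (c j0) N \<omega>" using j0 by (cases "q = first_reach b N \<omega>") auto
    then have "\<not> reach (c j0) q \<omega>" using less_first_reach_iff[OF w q(1)] by blast
    from not_reach_less[OF this q(1)] q(3) show False by simp
  qed
  ultimately show ?thesis by blast
next
  case False
  let ?s = "first_reach b N \<omega>"
  have lt: "first_reach (c j) N \<omega> < ?s" for j
    using False first_reach_mono_level[OF less_imp_le[OF c(2)], of j N \<omega>] by (metis order_less_le)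
  have s0: "0 < ?s" using lt[of 0] first_reach_range(1)[of "c 0" N \<omega>] by linarith
  obtain l where l: "((\<lambda>q. X q \<omega>) \<longlongrightarrow> l) (at_left ?s)" using X_left[OF w s0] by blast
  have "filterlim (\<lambda>j. first_reach (c j) N \<omega>) (at_left ?s) sequentially"
    using first_reach_level_limit[OF w c(1,2)] lt by (auto simp: filterlim_at less_imp_neq intro!: always_eventually)
  from filterlim_compose[OF l this] have lim: "(\<lambda>j. X (first_reach (c j) N \<omega>) \<omega>) \<longlonglongrightarrow> l" .
  have below: "X q \<omega> < b" if "0 \<le> q" "q < ?s" for q
    using less_first_reach_iff[OF w that(1), of b N] that not_reach_less[of b q \<omega> q] by auto
  have "l \<le> b"
  proof (rule tendsto_upperbound[OF l])
    show "eventually (\<lambda>q. X q \<omega> \<le> b) (at_left ?s)"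
      unfolding eventually_at_left_field using s0 below by (intro exI[of _ 0]) (auto intro: less_imp_le)
  qed simp
  \<comment> \<open>A left limit below \<open>b\<close> would keep the path under one level less
    than \<open>b\<close> on all of \<open>[0, ?s)\<close>: close to \<open>?s\<close> because of
    the limit, and up to \<open>p\<close> because \<open>b\<close> is not reached by then. But a
    level \<open>c j\<close> beyond it is reached strictly before \<open>?s\<close>.\<close>
  moreover have "\<not> l < b"
  proof
    assume lb: "l < b"
    define l' where "l' = (l + b) / 2"
    have l': "l < l'" "l' < b" using lb by (auto simp: l'_def)
    obtain d where d: "d < ?s" "\<And>q. d < q \<Longrightarrow> q < ?s \<Longrightarrow> X q \<omega> < l'"
      using order_tendstoD(2)[OF l l'(1)] unfolding eventually_at_left_field by auto
    define p where "p = max 0 ((d + ?s) / 2)"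
    have p: "0 \<le> p" "p < ?s" "d < p" using d s0 by (auto simp: p_def less_max_iff_disj)
    have "\<not> reach b p \<omega>" using less_first_reach_iff[OF w p(1)] p(2) by blast
    then obtain c' where c': "c' < b" "\<And>q. 0 \<le> q \<Longrightarrow> q \<le> p \<Longrightarrow> X q \<omega> \<le> c'" using not_reachD by blast
    have "max c' l' < b" using c' l' by simp
    from order_tendstoD(1)[OF c(1) this] obtain j where j: "max c' l' < c j" by (auto simp: eventually_sequentially)
    have "first_reach (c j) N \<omega> < real N" using lt[of j] first_reach_range(2)[of b N \<omega>] by linarith
    then have "reach (c j) (first_reach (c j) N \<omega>) \<omega>" using less_first_reach_iff[OF w first_reach_range(1), of "c j" N \<omega> "c j" N] by blast
    then obtain q where q: "0 \<le> q" "q \<le> first_reach (c j) N \<omega>" "max c' l' < X q \<omega>" unfolding reach_def using j by blast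
    have "q < ?s" using q(2) lt[of j] by linarith
    then show False using c'(2)[of q] d(2)[of q] q(1,3) p(3) by (cases "q \<le> p") auto
  qed
  ultimately have "l = b" by simp
  with lim show ?thesis by blast
qed

text \<open>On a common grid Dynkin's formula gives both expectations, and the sums differ only over
  the steps between the two times, each step contributing at most \<open>C / 2^m\<close>. So close
  expected times have close moments, even though a path may jump in between.\<close>

lemma stopping_compare:
  assumes u: "0 < u" "u < K"
  shows "\<exists>C. \<forall>s s'. stopping b N s \<longrightarrow> stopping b N s' \<longrightarrow> (\<forall>\<omega>\<in>space M. s' \<omega> \<le> s \<omega>) \<longrightarrow>
    \<bar>expectation (\<lambda>\<omega>. tilt u (X (s \<omega>) \<omega>)) - expectation (\<lambda>\<omega>. tilt u (X (s' \<omega>) \<omega>))\<bar> \<le> C * (expectation s - expectation s')"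
proof -
  obtain C where C: "C \<ge> 0" "\<And>m y. y \<le> b \<Longrightarrow> \<bar>tilt (decay m * u) y - tilt u y\<bar> \<le> C / 2^m"
    using tilt_increment_bound[OF u, of b] by metis
  show ?thesis
  proof (intro exI[of _ C] allI impI)
    fix s s' assume s: "stopping b N s" and s': "stopping b N s'" and "\<forall>\<omega>\<in>space M. s' \<omega> \<le> s \<omega>"
    then have le: "\<And>\<omega>. \<omega> \<in> space M \<Longrightarrow> s' \<omega> \<le> s \<omega>" by blast
    let ?E = "\<lambda>s m. expectation (\<lambda>\<omega>. tilt u (X (dyadic m (grid_index m s \<omega>)) \<omega>))"
    let ?g = "\<lambda>m j \<omega>. tilt (decay m * u) (X (dyadic m j) \<omega>) - tilt u (X (dyadic m j) \<omega>)"
    let ?i = "\<lambda>s m j \<omega>. indicat_real {\<omega>. j < grid_index m s \<omega>} \<omega>"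
    have grid_index_le': "grid_index m s' \<omega> \<le> grid_index m s \<omega>" if "\<omega> \<in> space M" for m \<omega>
      unfolding grid_index_def using le[OF that] by (intro nat_mono ceiling_mono mult_right_mono) auto
    have int: "integrable M (\<lambda>\<omega>. \<Sum>j<N * 2^m. ?i r m j \<omega> * ?g m j \<omega>)" if "stopping b N r" for r m
      unfolding right_diff_distrib
      by (intro Bochner_Integration.integrable_sum Bochner_Integration.integrable_diff before_integrable[OF that])
         (use u in \<open>simp_all add: less_imp_le\<close>)
    have bnd: "\<bar>?E s m - ?E s' m\<bar> \<le> C * (expectation s + (1/2)^m - expectation s')" for m
    proof -
      have eq: "?E s m - ?E s' m = expectation (\<lambda>\<omega>. (\<Sum>j<N * 2^m. ?i s m j \<omega> * ?g m j \<omega>) - (\<Sum>j<N * 2^m. ?i s' m j \<omega> * ?g m j \<omega>))"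
        using Dynkin_real(2)[OF s u, of m] Dynkin_real(2)[OF s' u, of m] Bochner_Integration.integral_diff[OF int[OF s, of m] int[OF s', of m]] by linarith
      have "\<bar>?E s m - ?E s' m\<bar> \<le> expectation (\<lambda>\<omega>. \<bar>(\<Sum>j<N * 2^m. ?i s m j \<omega> * ?g m j \<omega>) - (\<Sum>j<N * 2^m. ?i s' m j \<omega> * ?g m j \<omega>)\<bar>)"
        unfolding eq by (rule integral_abs_bound)
      also have "\<dots> \<le> expectation (\<lambda>\<omega>. C * (s \<omega> + (1/2)^m - s' \<omega>))"
      proof (rule integral_mono)
        show "integrable M (\<lambda>\<omega>. \<bar>(\<Sum>j<N * 2^m. ?i s m j \<omega> * ?g m j \<omega>) - (\<Sum>j<N * 2^m. ?i s' m j \<omega> * ?g m j \<omega>)\<bar>)"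
          by (rule integrable_abs[OF Bochner_Integration.integrable_diff[OF int[OF s] int[OF s']]])
        show "integrable M (\<lambda>\<omega>. C * (s \<omega> + (1/2)^m - s' \<omega>))"
          using stopping_integrable[OF s] stopping_integrable[OF s'] by simp
        fix \<omega> assume w: "\<omega> \<in> space M"
        have "\<bar>(\<Sum>j<N * 2^m. ?i s m j \<omega> * ?g m j \<omega>) - (\<Sum>j<N * 2^m. ?i s' m j \<omega> * ?g m j \<omega>)\<bar>
           = \<bar>\<Sum>j<N * 2^m. (?i s m j \<omega> - ?i s' m j \<omega>) * ?g m j \<omega>\<bar>"
          by (simp add: sum_subtractf left_diff_distrib)
        also have "\<dots> \<le> (\<Sum>j<N * 2^m. (?i s m j \<omega> - ?i s' m j \<omega>) * (C / 2^m))"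
        proof (rule order_trans[OF sum_abs sum_mono])
          fix j
          show "\<bar>(?i s m j \<omega> - ?i s' m j \<omega>) * ?g m j \<omega>\<bar> \<le> (?i s m j \<omega> - ?i s' m j \<omega>) * (C / 2^m)"
          proof (cases "j < grid_index m s \<omega>")
            case True
            have nn: "0 \<le> ?i s m j \<omega> - ?i s' m j \<omega>" using True by (simp add: indicator_def)
            show ?thesis unfolding abs_mult abs_of_nonneg[OF nn]
              by (rule mult_left_mono[OF C(2)[OF X_before[OF s w True]] nn])
          next
            case False
            then have "\<not> j < grid_index m s' \<omega>" using grid_index_le'[OF w, of m] by simp
            then show ?thesis using False by simp
          qed
        qed
        also have "\<dots> = (real (grid_index m s \<omega>) - real (grid_index m s' \<omega>)) * (C / 2^m)"
          using sum_before[OF s w, of m] sum_before[OF s' w, of m] by (simp only: sum_distrib_right[symmetric] sum_subtractf)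
        also have "\<dots> = C * (dyadic m (grid_index m s \<omega>) - dyadic m (grid_index m s' \<omega>))" by (simp add: dyadic_def field_simps)
        also have "\<dots> \<le> C * (s \<omega> + (1/2)^m - s' \<omega>)"
          using dyadic_grid_index[OF s w, of m] dyadic_grid_index[OF s' w, of m] C(1) by (intro mult_left_mono) (auto simp: power_divide)
        finally show "\<bar>(\<Sum>j<N * 2^m. ?i s m j \<omega> * ?g m j \<omega>) - (\<Sum>j<N * 2^m. ?i s' m j \<omega> * ?g m j \<omega>)\<bar> \<le> C * (s \<omega> + (1/2)^m - s' \<omega>)" .
      qed
      also have "\<dots> = C * (expectation s + (1/2)^m - expectation s')"
        using stopping_integrable[OF s] stopping_integrable[OF s'] by (simp add: prob_space)
      finally show ?thesis .
    qed
    have cont: "continuous_on UNIV (tilt u)" unfolding tilt_def[abs_def] by (intro continuous_intros)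
    have bd: "\<bar>tilt u y\<bar> \<le> exp (- phi u) * (1 + exp (u * y))" for y
      by (simp add: tilt_def exp_diff exp_minus divide_inverse distrib_left mult.commute)
    have lim: "?E r \<longlonglongrightarrow> expectation (\<lambda>\<omega>. tilt u (X (r \<omega>) \<omega>))" if "stopping b N r" for r
      by (rule grid_index_limit(3)[OF that u cont bd]) simp
    have "(\<lambda>m. C * (expectation s + (1/2)^m - expectation s')) \<longlonglongrightarrow> C * (expectation s + 0 - expectation s')"
      by (intro tendsto_mult tendsto_add tendsto_diff tendsto_const LIMSEQ_power_zero) simp
    from LIMSEQ_le[OF tendsto_rabs[OF tendsto_diff[OF lim[OF s] lim[OF s']]] this] bnd
    show "\<bar>expectation (\<lambda>\<omega>. tilt u (X (s \<omega>) \<omega>)) - expectation (\<lambda>\<omega>. tilt u (X (s' \<omega>) \<omega>))\<bar> \<le> C * (expectation s - expectation s')"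
      by auto
  qed
qed

text \<open>Quasi-left-continuity at one particular time, from exponential moments alone. Let
  \<open>l\<close> be the limit of the positions at the passages of lower levels. The expected
  passage times converge, so the comparison of stopping times gives \<open>l\<close> and the
  position at the passage of \<open>b\<close> equal moments for every exponent in
  \<open>(0, K)\<close>.\<close>

lemma reach_level_AE: "AE \<omega> in M. reach b (first_reach b N \<omega>) \<omega> \<longrightarrow> b \<le> X (first_reach b N \<omega>) \<omega>"
proof -
  define c where "c j = b - 1 / (real j + 1)" for j :: nat
  have clim: "c \<longlonglongrightarrow> b"
    using tendsto_diff[OF tendsto_const[of b] LIMSEQ_inverse_real_of_nat] unfolding c_def[abs_def] by (simp add: inverse_eq_divide add.commute)
  have clt: "c j < b" for j by (simp add: c_def)
  have cmono: "mono c" unfolding c_def by (rule monoI) (simp add: frac_le)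
  note st = stopping_first_reach[OF less_imp_le[OF clt], of N]
  have sb: "stopping b N (first_reach b N)" by (rule stopping_first_reach) simp
  define l where "l \<omega> = lim (\<lambda>j. X (first_reach (c j) N \<omega>) \<omega>)" for \<omega>
  have l: "(\<lambda>j. X (first_reach (c j) N \<omega>) \<omega>) \<longlonglongrightarrow> l \<omega>" "l \<omega> = b \<or> l \<omega> = X (first_reach b N \<omega>) \<omega> \<and> (reach b (first_reach b N \<omega>) \<omega> \<longrightarrow> b \<le> l \<omega>)"
    if w: "\<omega> \<in> space M" for \<omega>
  proof -
    obtain l0 where l0: "(\<lambda>j. X (first_reach (c j) N \<omega>) \<omega>) \<longlonglongrightarrow> l0" "l0 = b \<or> l0 = X (first_reach b N \<omega>) \<omega> \<and> (reach b (first_reach b N \<omega>) \<omega> \<longrightarrow> b \<le> l0)"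
      using first_reach_path_limit[OF w clim clt cmono] by blast
    have "l \<omega> = l0" unfolding l_def using l0(1) by (rule limI)
    then show "(\<lambda>j. X (first_reach (c j) N \<omega>) \<omega>) \<longlonglongrightarrow> l \<omega>" "l \<omega> = b \<or> l \<omega> = X (first_reach b N \<omega>) \<omega> \<and> (reach b (first_reach b N \<omega>) \<omega> \<longrightarrow> b \<le> l \<omega>)"
      using l0 by simp_all
  qed
  have lm [measurable]: "l \<in> borel_measurable M"
    by (rule borel_measurable_LIMSEQ_real[OF l(1) X_stopping_measurable[OF st]])
  note [measurable] = X_stopping_measurable[OF sb]
  have eq: "integrable M (\<lambda>\<omega>. tilt u (l \<omega>)) \<and> integrable M (\<lambda>\<omega>. tilt u (X (first_reach b N \<omega>) \<omega>)) \<and> expectation (\<lambda>\<omega>. tilt u (l \<omega>)) = expectation (\<lambda>\<omega>. tilt u (X (first_reach b N \<omega>) \<omega>))"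
    if u: "0 < u" "u < K" for u
  proof -
    define u' where "u' = (u + K) / 2"
    have u': "u < u'" "0 < u'" "u' < K" using u by (auto simp: u'_def)
    define v where "v = (u' + K) / 2"
    have v: "u' < v" "0 < v" "v < K" using u' by (auto simp: v_def)
    obtain C where C: "C \<ge> 0" "\<And>s m. stopping b N s \<Longrightarrow> (\<integral>\<^sup>+\<omega>. ennreal (exp (u' * X (dyadic m (grid_index m s \<omega>)) \<omega>)) \<partial>M) \<le> ennreal C"
      using stopping_moment_bound[OF u'(2,3), of b N] by metis
    \<comment> \<open>The moment bound on the grids survives the limit of the mesh. Its constant is
      the same for all levels, so it is uniform in \<open>j\<close>.\<close>
    have mom: "(\<integral>\<^sup>+\<omega>. ennreal (exp (u' * X (first_reach (c j) N \<omega>) \<omega>)) \<partial>M) \<le> ennreal C" for j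
    proof -
      have co: "continuous_on UNIV (\<lambda>y. exp (u' * y))" by (intro continuous_intros)
      have bd: "\<bar>exp (u' * y)\<bar> \<le> 1 * (1 + exp (u' * y))" for y by simp
      note ul = grid_index_limit[OF st u'(2,3) co bd]
      have "expectation (\<lambda>\<omega>. exp (u' * X (dyadic m (grid_index m (first_reach (c j) N) \<omega>)) \<omega>)) \<le> C" for m
        using C(2)[OF st, of m j] C(1) ul(2)[of m j] by (subst (asm) nn_integral_eq_integral) auto
      then have "expectation (\<lambda>\<omega>. exp (u' * X (first_reach (c j) N \<omega>) \<omega>)) \<le> C"
        using LIMSEQ_le_const2[OF ul(3)[of j]] by auto
      then show ?thesis using ul(1)[of j] by (subst nn_integral_eq_integral) (auto intro: ennreal_leI)
    qed
    have bd: "\<bar>tilt u y\<bar> \<le> exp (- phi u) * (1 + exp (u * y))" for y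
      by (simp add: tilt_def exp_diff exp_minus divide_inverse distrib_left mult.commute)
    have el: "AE \<omega> in M. (\<lambda>j. tilt u (X (first_reach (c j) N \<omega>) \<omega>)) \<longlonglongrightarrow> tilt u (l \<omega>)"
      unfolding tilt_def by (intro AE_I2 tendsto_intros l(1))
    have m1: "(\<lambda>\<omega>. tilt u (X (first_reach (c j) N \<omega>) \<omega>)) \<in> borel_measurable M" for j
      by (rule measurable_compose[OF X_stopping_measurable[OF st]]) simp
    have m2: "(\<lambda>\<omega>. tilt u (l \<omega>)) \<in> borel_measurable M" by measurable
    note ui = exp_moment_convergence[where f="\<lambda>j \<omega>. tilt u (X (first_reach (c j) N \<omega>) \<omega>)" and g="\<lambda>\<omega>. tilt u (l \<omega>)" 
       and Y="\<lambda>j \<omega>. X (first_reach (c j) N \<omega>) \<omega>" and u=u and u'=u' and c="exp (- phi u)" and C=C, OF m1 X_stopping_measurable[OF st] m2 el u(1) u'(1) exp_ge_zero C(1) bd mom]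
    have cont: "continuous_on UNIV (tilt u)" unfolding tilt_def[abs_def] by (intro continuous_intros)
    have intb: "integrable M (\<lambda>\<omega>. tilt u (X (first_reach b N \<omega>) \<omega>))" by (rule grid_index_limit(1)[OF sb u cont bd]) simp
    obtain D where D: "\<forall>s s'. stopping b N s \<longrightarrow> stopping b N s' \<longrightarrow> (\<forall>\<omega>\<in>space M. s' \<omega> \<le> s \<omega>) \<longrightarrow>
    \<bar>expectation (\<lambda>\<omega>. tilt u (X (s \<omega>) \<omega>)) - expectation (\<lambda>\<omega>. tilt u (X (s' \<omega>) \<omega>))\<bar> \<le> D * (expectation s - expectation s')"
      using stopping_compare[OF u, of b N] by (elim exE)
    have Dj: "\<bar>expectation (\<lambda>\<omega>. tilt u (X (first_reach b N \<omega>) \<omega>)) - expectation (\<lambda>\<omega>. tilt u (X (first_reach (c j) N \<omega>) \<omega>))\<bar> \<le> D * (expectation (first_reach b N) - expectation (first_reach (c j) N))" for j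
      using first_reach_mono_level[OF less_imp_le[OF clt]] by (intro D[rule_format] sb st)
    have "(\<lambda>j. expectation (first_reach (c j) N)) \<longlonglongrightarrow> expectation (first_reach b N)"
    proof (rule integral_dominated_convergence[where w="\<lambda>_. real N"])
      show "AE \<omega> in M. (\<lambda>j. first_reach (c j) N \<omega>) \<longlonglongrightarrow> first_reach b N \<omega>" using first_reach_level_limit[OF _ clim clt] by (intro AE_I2)
      show "AE \<omega> in M. norm (first_reach (c j) N \<omega>) \<le> real N" for j using first_reach_range by (intro AE_I2) (simp add: abs_of_nonneg)
    qed (use stopping_measurable[OF st] stopping_measurable[OF sb] in auto)
    then have "(\<lambda>j. D * (expectation (first_reach b N) - expectation (first_reach (c j) N))) \<longlonglongrightarrow> D * (expectation (first_reach b N) - expectation (first_reach b N))"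
      by (intro tendsto_intros)
    then have z: "(\<lambda>j. D * (expectation (first_reach b N) - expectation (first_reach (c j) N))) \<longlonglongrightarrow> 0" by simp
    have "(\<lambda>j. expectation (\<lambda>\<omega>. tilt u (X (first_reach b N \<omega>) \<omega>)) - expectation (\<lambda>\<omega>. tilt u (X (first_reach (c j) N \<omega>) \<omega>))) \<longlonglongrightarrow> 0"
      by (rule tendsto_rabs_zero_cancel, rule tendsto_sandwich[OF _ _ tendsto_const z])
         (use Dj in \<open>auto intro!: always_eventually\<close>)
    moreover have "(\<lambda>j. expectation (\<lambda>\<omega>. tilt u (X (first_reach b N \<omega>) \<omega>)) - expectation (\<lambda>\<omega>. tilt u (X (first_reach (c j) N \<omega>) \<omega>)))
       \<longlonglongrightarrow> expectation (\<lambda>\<omega>. tilt u (X (first_reach b N \<omega>) \<omega>)) - expectation (\<lambda>\<omega>. tilt u (l \<omega>))"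
      by (intro tendsto_diff tendsto_const ui(3))
    ultimately have "expectation (\<lambda>\<omega>. tilt u (X (first_reach b N \<omega>) \<omega>)) - expectation (\<lambda>\<omega>. tilt u (l \<omega>)) = 0" by (rule LIMSEQ_unique[symmetric])
    then show ?thesis using ui(2) intb by simp
  qed
  \<comment> \<open>The two variables differ only where the first one equals \<open>b\<close>, so equal expectations for the
    exponents \<open>u\<close> and \<open>2 u\<close> give \<open>E (W - V)\<^sup>2 = 0\<close>.\<close>
  define u where "u = K / 3"
  have u: "0 < u" "u < K" "0 < 2 * u" "2 * u < K" using K_pos by (auto simp: u_def)
  define V W where "V \<omega> = exp (u * l \<omega>)" and "W \<omega> = exp (u * X (first_reach b N \<omega>) \<omega>)" for \<omega>
  have raw: "integrable M (\<lambda>\<omega>. exp (v * l \<omega>)) \<and> integrable M (\<lambda>\<omega>. exp (v * X (first_reach b N \<omega>) \<omega>)) \<and> expectation (\<lambda>\<omega>. exp (v * l \<omega>)) = expectation (\<lambda>\<omega>. exp (v * X (first_reach b N \<omega>) \<omega>))"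
    if "0 < v" "v < K" for v
  proof -
    have "exp (v * y) = exp (phi v) * tilt v y" for y by (simp add: tilt_def exp_add[symmetric])
    then show ?thesis using eq[OF that] by simp
  qed
  have sq: "V \<omega>^2 = exp (2 * u * l \<omega>)" "W \<omega>^2 = exp (2 * u * X (first_reach b N \<omega>) \<omega>)" for \<omega>
    by (simp_all add: V_def W_def power2_eq_square exp_add[symmetric])
  have i: "integrable M V" "integrable M W" "expectation V = expectation W" using raw[OF u(1,2)] unfolding V_def W_def by auto
  have i2: "integrable M (\<lambda>\<omega>. V \<omega>^2)" "integrable M (\<lambda>\<omega>. W \<omega>^2)" "expectation (\<lambda>\<omega>. V \<omega>^2) = expectation (\<lambda>\<omega>. W \<omega>^2)"
    using raw[OF u(3,4)] unfolding sq by auto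
  have pw: "(W \<omega> - V \<omega>)^2 = W \<omega>^2 - V \<omega>^2 - 2 * exp (u * b) * (W \<omega> - V \<omega>)" if "\<omega> \<in> space M" for \<omega>
  proof -
    have "(V \<omega> - exp (u * b)) * (W \<omega> - V \<omega>) = 0" using l(2)[OF that] by (auto simp: V_def W_def)
    then have "V \<omega> * (W \<omega> - V \<omega>) = exp (u * b) * (W \<omega> - V \<omega>)" by (simp add: left_diff_distrib)
    moreover have "(W \<omega> - V \<omega>)^2 = W \<omega>^2 - V \<omega>^2 - 2 * (V \<omega> * (W \<omega> - V \<omega>))" by (simp add: power2_eq_square algebra_simps)
    ultimately show ?thesis by simp
  qed
  have "expectation (\<lambda>\<omega>. (W \<omega> - V \<omega>)^2) = expectation (\<lambda>\<omega>. W \<omega>^2 - V \<omega>^2 - 2 * exp (u * b) * (W \<omega> - V \<omega>))"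
    by (rule Bochner_Integration.integral_cong) (auto simp: pw)
  also have "\<dots> = 0" using i i2 by simp
  finally have 0: "expectation (\<lambda>\<omega>. (W \<omega> - V \<omega>)^2) = 0" .
  have "integrable M (\<lambda>\<omega>. (W \<omega> - V \<omega>)^2)"
    by (rule Bochner_Integration.integrable_cong[OF refl pw, THEN iffD2]) (use i i2 in auto)
  from integral_nonneg_eq_0_iff_AE[OF this] 0 have "AE \<omega> in M. (W \<omega> - V \<omega>)^2 = 0" by simp
  then show ?thesis
  proof (rule AE_mp, intro AE_I2 impI)
    fix \<omega> assume w: "\<omega> \<in> space M" and "(W \<omega> - V \<omega>)^2 = 0" and r: "reach b (first_reach b N \<omega>) \<omega>"
    then have "l \<omega> = X (first_reach b N \<omega>) \<omega>" using u(1) by (simp add: V_def W_def)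
    then show "b \<le> X (first_reach b N \<omega>) \<omega>" using l(2)[OF w] r by auto
  qed
qed

end

section \<open>A Wald estimate for the negative part\<close>

text \<open>For \<open>y < 0\<close> the left side is exactly 1, and for \<open>y \<ge> 0\<close>
  convexity of the exponential gives 1 plus a term of order \<open>u\<close>. That factor
  \<open>u\<close> later cancels the singularity of \<open>du / u\<close>.\<close>

lemma exp_convex_bound:
  fixes u k y :: real assumes "0 \<le> u" "u \<le> k" "0 < k"
  shows "(1 - exp (- (u * max 0 (- y)))) + exp (u * y) \<le> 1 + u / k * exp (k * y)"
proof (cases "0 \<le> y")
  case True
  have "exp ((1 - u/k) *\<^sub>R 0 + (u/k) *\<^sub>R (k * y)) \<le> (1 - u/k) * exp 0 + (u/k) * exp (k * y)"
    by (rule convex_onD[OF exp_convex]) (use assms in auto)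
  then have "exp (u * y) \<le> 1 - u / k + u / k * exp (k * y)" using assms by simp
  moreover have "0 \<le> u / k" using assms by simp
  ultimately show ?thesis using True by (simp add: max_def)
next
  case False
  then have "max 0 (- y) = - y" by simp
  then show ?thesis using assms by simp
qed

text \<open>Expanding \<open>(1 - exp (- a)) * (1 - exp (- b)) \<ge> 0\<close> gives the case
  \<open>c = a + b\<close>.\<close>

lemma one_minus_exp_subadd:
  fixes a b :: real assumes "0 \<le> a" "0 \<le> b" "c \<le> a + b"
  shows "1 - exp (- c) \<le> (1 - exp (- a)) + (1 - exp (- b))"
proof -
  have "0 \<le> (1 - exp (- a)) * (1 - exp (- b))" using assms by (intro mult_nonneg_nonneg) auto
  then have "exp (- a) + exp (- b) \<le> 1 + exp (- a) * exp (- b)" by (simp add: algebra_simps)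
  moreover have "exp (- a) * exp (- b) \<le> exp (- c)" using assms(3) by (simp add: exp_add[symmetric])
  ultimately show ?thesis by linarith
qed

lemma exp_minus_one_le_mult: fixes u k a :: real assumes "0 \<le> a" "0 \<le> u" "u \<le> k" shows "exp (u * a) - 1 \<le> (a * exp (k * a)) * u"
proof -
  have "1 - exp (- (u * a)) \<le> u * a" using exp_ge_add_one_self[of "- (u * a)"] by linarith
  then have "exp (u * a) * (1 - exp (- (u * a))) \<le> exp (u * a) * (u * a)" by (rule mult_left_mono) simp
  also have "\<dots> \<le> exp (k * a) * (u * a)" using assms by (intro mult_right_mono) (auto intro: mult_right_mono)
  finally show ?thesis by (simp add: right_diff_distrib exp_minus_inverse mult_exp_exp ac_simps)
qed

lemma ennreal_le_plus: "0 \<le> a \<Longrightarrow> 0 \<le> b \<Longrightarrow> p \<le> a + b \<Longrightarrow> ennreal p \<le> ennreal a + ennreal b"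
  by (simp add: ennreal_plus[symmetric] ennreal_leI del: ennreal_plus)

lemma ennreal_plus_le_plus: "0 \<le> a \<Longrightarrow> 0 \<le> b \<Longrightarrow> 0 \<le> c \<Longrightarrow> 0 \<le> d \<Longrightarrow> a + b \<le> c + d \<Longrightarrow> ennreal a + ennreal b \<le> ennreal c + ennreal d"
  by (simp add: ennreal_plus[symmetric] ennreal_leI del: ennreal_plus)

section \<open>Integrals with weight \<open>exp (- phi u) / u\<close> and the subadditive
  majorant\<close>

context levy_ou
begin

text \<open>The factor \<open>u\<close> in the bound removes the singularity at 0, and what remains
  is a bounded weight on an interval of finite length.\<close>

lemma weighted_integral_finite:
  assumes D: "0 \<le> D" "\<And>u. 0 < u \<Longrightarrow> u < K \<Longrightarrow> g u \<le> D * u"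
  shows "(\<integral>\<^sup>+u\<in>{0<..<K}. ennreal (g u * exp (- phi u) / u) \<partial>lborel) < \<infinity>"
proof -
  obtain C where C: "C \<ge> 0" "\<And>u. 0 \<le> u \<Longrightarrow> u < K \<Longrightarrow> exp (- phi u) \<le> C" using phi_bounded_below by blast
  have "(\<integral>\<^sup>+u\<in>{0<..<K}. ennreal (g u * exp (- phi u) / u) \<partial>lborel) \<le> (\<integral>\<^sup>+u. ennreal (D * C) * indicator {0<..<K} u \<partial>lborel)"
  proof (rule nn_integral_mono)
    fix u
    show "ennreal (g u * exp (- phi u) / u) * indicator {0<..<K} u \<le> ennreal (D * C) * indicator {0<..<K} u"
    proof (cases "u \<in> {0<..<K}")
      case True
      then have u: "0 < u" "u < K" by auto
      have "g u * exp (- phi u) \<le> D * u * exp (- phi u)" using D(2)[OF u] by (rule mult_right_mono) simp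
      also have "\<dots> \<le> D * u * C" using C(2)[of u] D(1) u by (intro mult_left_mono) auto
      finally have "g u * exp (- phi u) / u \<le> D * C" using u by (simp add: pos_divide_le_eq ac_simps)
      then show ?thesis using True by (simp add: ennreal_leI)
    qed simp
  qed
  also have "\<dots> = ennreal (D * C) * ennreal K" using K_pos by (subst nn_integral_cmult_indicator) auto
  also have "\<dots> < \<infinity>" by (simp add: ennreal_mult_less_top)
  finally show ?thesis .
qed

lemma gain_mono: assumes "y \<le> z" shows "gain y \<le> gain z"
  unfolding gain_def
proof (intro nn_integral_mono)
  fix u
  show "ennreal ((exp (u * y) - exp (u * x)) * exp (- phi u) / u) * indicator {0<..<K} u \<le> ennreal ((exp (u * z) - exp (u * x)) * exp (- phi u) / u) * indicator {0<..<K} u"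
    using assms by (cases "u \<in> {0<..<K}") (auto intro!: ennreal_leI divide_right_mono mult_right_mono)
qed

lemma gain_finite: assumes "x \<le> b" shows "gain b < \<infinity>"
  unfolding gain_def
proof (rule weighted_integral_finite)
  fix u assume u: "0 < u" "u < K"
  have "exp (u * b) - exp (u * x) = exp (u * x) * (exp (u * (b - x)) - 1)" by (simp add: right_diff_distrib exp_add[symmetric])
  also have "\<dots> \<le> exp (K * \<bar>x\<bar>) * (((b - x) * exp (K * (b - x))) * u)"
  proof (rule mult_mono)
    have "u * x \<le> u * \<bar>x\<bar>" using u by (intro mult_left_mono) auto
    also have "\<dots> \<le> K * \<bar>x\<bar>" using u by (intro mult_right_mono) auto
    finally show "exp (u * x) \<le> exp (K * \<bar>x\<bar>)" by simp
    show "exp (u * (b - x)) - 1 \<le> (b - x) * exp (K * (b - x)) * u" by (rule exp_minus_one_le_mult) (use u assms in auto)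
  qed (use u assms in auto)
  finally show "exp (u * b) - exp (u * x) \<le> (exp (K * \<bar>x\<bar>) * ((b - x) * exp (K * (b - x)))) * u" by (simp add: ac_simps)
qed (use assms in auto)

text \<open>Depends on the negative part of \<open>y\<close> only, is subadditive, and dominates
  \<open>loss\<close> up to an additive constant. It grows like the logarithm of
  \<open>\<bar>y\<bar>\<close> as \<open>y\<close> tends to minus infinity.\<close>

definition deficit :: "real \<Rightarrow> ennreal" where
  "deficit y = (\<integral>\<^sup>+u\<in>{0<..<K}. ennreal ((1 - exp (- (u * max 0 (- y)))) * exp (- phi u) / u) \<partial>lborel)"

lemma deficit_measurable [measurable]: "deficit \<in> borel_measurable borel" unfolding deficit_def[abs_def] by measurable
lemma gain_measurable [measurable]: "gain \<in> borel_measurable borel" unfolding gain_def[abs_def] by measurable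
lemma loss_measurable [measurable]: "loss \<in> borel_measurable borel" unfolding loss_def[abs_def] by measurable

lemma deficit_finite: "deficit y < \<infinity>"
  unfolding deficit_def
proof (rule weighted_integral_finite)
  fix u
  show "1 - exp (- (u * max 0 (- y))) \<le> max 0 (- y) * u" 
    using exp_ge_add_one_self[of "- (u * max 0 (- y))"] by (simp add: mult.commute)
qed simp

text \<open>Contraction by \<open>r\<close> can only shrink the negative part, and
  \<open>1 - exp (- t)\<close> is increasing and subadditive in \<open>t \<ge> 0\<close>. The form
  \<open>r * y + z\<close> is that of one step of the process.\<close>

lemma deficit_subadditive: assumes r: "0 \<le> r" "r \<le> 1" shows "deficit (r * y + z) \<le> deficit y + deficit z"
proof -
  have "deficit (r * y + z) \<le> (\<integral>\<^sup>+u. ennreal ((1 - exp (- (u * max 0 (- y)))) * exp (- phi u) / u) * indicator {0<..<K} u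
       + ennreal ((1 - exp (- (u * max 0 (- z)))) * exp (- phi u) / u) * indicator {0<..<K} u \<partial>lborel)"
    unfolding deficit_def
  proof (rule nn_integral_mono)
    fix u
    show "ennreal ((1 - exp (- (u * max 0 (- (r * y + z))))) * exp (- phi u) / u) * indicator {0<..<K} u \<le> 
      ennreal ((1 - exp (- (u * max 0 (- y)))) * exp (- phi u) / u) * indicator {0<..<K} u
       + ennreal ((1 - exp (- (u * max 0 (- z)))) * exp (- phi u) / u) * indicator {0<..<K} u"
    proof (cases "u \<in> {0<..<K}")
      case True
      then have u: "0 < u" by simp
      have "r * (- y) \<le> max 0 (- y)"
      proof (cases "y \<le> 0")
        case True then show ?thesis using r mult_right_mono[of r 1 "- y"] by simp
      next
        case False then show ?thesis using r by (simp add: max_def mult_nonneg_nonneg)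
      qed
      then have "max 0 (- (r * y + z)) \<le> max 0 (- y) + max 0 (- z)" by auto
      from mult_left_mono[OF this, of u] u have "u * max 0 (- (r * y + z)) \<le> u * max 0 (- y) + u * max 0 (- z)" by (simp add: distrib_left)
      then have "1 - exp (- (u * max 0 (- (r * y + z)))) \<le> (1 - exp (- (u * max 0 (- y)))) + (1 - exp (- (u * max 0 (- z))))"
        using u by (intro one_minus_exp_subadd) auto
      then have "(1 - exp (- (u * max 0 (- (r * y + z))))) * exp (- phi u) / u \<le> (1 - exp (- (u * max 0 (- y)))) * exp (- phi u) / u + (1 - exp (- (u * max 0 (- z)))) * exp (- phi u) / u"
        using u by (subst add_divide_distrib[symmetric], subst distrib_right[symmetric]) (intro divide_right_mono mult_right_mono, auto)
      moreover have "0 \<le> (1 - exp (- (u * max 0 (- y)))) * exp (- phi u) / u" "0 \<le> (1 - exp (- (u * max 0 (- z)))) * exp (- phi u) / u"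
        using u by (auto intro!: divide_nonneg_pos mult_nonneg_nonneg)
      ultimately show ?thesis using True by (simp add: ennreal_le_plus)
    qed simp
  qed
  also have "\<dots> = deficit y + deficit z" unfolding deficit_def by (rule nn_integral_add) measurable
  finally show ?thesis .
qed

text \<open>Comparing both exponentials with 1 separates a part of order \<open>u\<close> that
  depends on \<open>x\<close> alone from the integrand of the deficit.\<close>

lemma loss_le: obtains c0 where "c0 < \<infinity>" "\<And>y. loss y \<le> c0 + deficit y"
proof -
  define c0 where "c0 = (\<integral>\<^sup>+u\<in>{0<..<K}. ennreal ((exp (u * max 0 x) - 1) * exp (- phi u) / u) \<partial>lborel)"
  show ?thesis
  proof (rule that[of c0])
    show "c0 < \<infinity>" unfolding c0_def
      by (rule weighted_integral_finite[where D="max 0 x * exp (K * max 0 x)"]) (auto intro!: exp_minus_one_le_mult)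
    fix y
    have "loss y \<le> (\<integral>\<^sup>+u. ennreal ((exp (u * max 0 x) - 1) * exp (- phi u) / u) * indicator {0<..<K} u
       + ennreal ((1 - exp (- (u * max 0 (- y)))) * exp (- phi u) / u) * indicator {0<..<K} u \<partial>lborel)"
      unfolding loss_def
    proof (rule nn_integral_mono)
      fix u
      show "ennreal ((exp (u * x) - exp (u * y)) * exp (- phi u) / u) * indicator {0<..<K} u \<le> 
        ennreal ((exp (u * max 0 x) - 1) * exp (- phi u) / u) * indicator {0<..<K} u
         + ennreal ((1 - exp (- (u * max 0 (- y)))) * exp (- phi u) / u) * indicator {0<..<K} u"
      proof (cases "u \<in> {0<..<K}")
        case True
        then have u: "0 < u" by simp
        have "exp (u * x) \<le> exp (u * max 0 x)" using u by (simp add: mult_left_mono)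
        moreover have "exp (- (u * max 0 (- y))) \<le> exp (u * y)" using mult_left_mono[of "- y" "max 0 (- y)" u] u by simp
        ultimately have "exp (u * x) - exp (u * y) \<le> (exp (u * max 0 x) - 1) + (1 - exp (- (u * max 0 (- y))))" by linarith
        then have "(exp (u * x) - exp (u * y)) * exp (- phi u) / u \<le> (exp (u * max 0 x) - 1) * exp (- phi u) / u + (1 - exp (- (u * max 0 (- y)))) * exp (- phi u) / u"
          using u by (subst add_divide_distrib[symmetric], subst distrib_right[symmetric]) (intro divide_right_mono mult_right_mono, auto)
        moreover have "0 \<le> (exp (u * max 0 x) - 1) * exp (- phi u) / u" "0 \<le> (1 - exp (- (u * max 0 (- y)))) * exp (- phi u) / u"
          using u by (auto intro!: divide_nonneg_pos mult_nonneg_nonneg)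
        ultimately show ?thesis using True by (simp add: ennreal_le_plus)
      qed simp
    qed
    also have "\<dots> = c0 + deficit y" unfolding deficit_def c0_def by (rule nn_integral_add) measurable
    finally show "loss y \<le> c0 + deficit y" .
  qed
qed

text \<open>On a past event, \<open>tilt u\<close> averaged over the innovation becomes
  \<open>tilt (decay m * u) 0\<close>, and scale invariance of \<open>du / u\<close> turns this into
  a shift of the range.\<close>

lemma innovation_tilt_integral:
  assumes a: "0 < a" "a \<le> k" "k < K" and A: "A \<in> sets (past (dyadic m i))"
  shows "(\<integral>\<^sup>+\<omega>. indicator A \<omega> * tilt_integral a k (innovation m i \<omega>) \<partial>M) = emeasure M A * tilt_integral (decay m * a) (decay m * k) 0"
proof -
  have Am [measurable]: "A \<in> sets M" using A sets_past_subset by auto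
  have "(\<integral>\<^sup>+\<omega>. indicator A \<omega> * tilt_integral a k (innovation m i \<omega>) \<partial>M) = (\<integral>\<^sup>+u\<in>{a<..k}. ennreal (1 / u) * (\<integral>\<^sup>+\<omega>. indicator A \<omega> * ennreal (tilt (1 * u) (innovation m i \<omega>)) \<partial>M) \<partial>lborel)"
    using tilt_integral_Fubini[of 1 "indicator A" "innovation m i" a k] by simp
  also have "\<dots> = (\<integral>\<^sup>+u. emeasure M A * (ennreal (tilt (decay m * u) 0 / u) * indicator {a<..k} u) \<partial>lborel)"
  proof (rule nn_integral_cong)
    fix u
    show "ennreal (1 / u) * (\<integral>\<^sup>+\<omega>. indicator A \<omega> * ennreal (tilt (1 * u) (innovation m i \<omega>)) \<partial>M) * indicator {a<..k} u = emeasure M A * (ennreal (tilt (decay m * u) 0 / u) * indicator {a<..k} u)"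
    proof (cases "u \<in> {a<..k}")
      case True
      then have u: "0 < u" "u < K" using a by auto
      have "(\<integral>\<^sup>+\<omega>. indicator A \<omega> * ennreal (tilt (1 * u) (innovation m i \<omega>)) \<partial>M) = (\<integral>\<^sup>+\<omega>. indicator A \<omega> * ennreal (exp (u * innovation m i \<omega>)) * ennreal (exp (- phi u)) \<partial>M)"
        by (rule nn_integral_cong) (simp add: tilt_def mult.assoc ennreal_mult[symmetric] exp_add[symmetric])
      also have "\<dots> = emeasure M A * ennreal (exp (phi u - phi (decay m * u))) * ennreal (exp (- phi u))"
        by (subst nn_integral_multc) (simp_all add: innovation_past_sets[OF u A])
      also have "\<dots> = emeasure M A * ennreal (tilt (decay m * u) 0)"
        by (simp add: tilt_def mult.assoc ennreal_mult[symmetric] exp_add[symmetric])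
      finally have "ennreal (1 / u) * (\<integral>\<^sup>+\<omega>. indicator A \<omega> * ennreal (tilt (1 * u) (innovation m i \<omega>)) \<partial>M) = emeasure M A * (ennreal (1 / u) * ennreal (tilt (decay m * u) 0))"
        by (simp only: ac_simps)
      also have "ennreal (1 / u) * ennreal (tilt (decay m * u) 0) = ennreal (tilt (decay m * u) 0 / u)"
        using u by (subst ennreal_mult[symmetric]) auto
      finally show ?thesis using True by simp
    qed simp
  qed
  also have "\<dots> = emeasure M A * (\<integral>\<^sup>+u\<in>{a<..k}. ennreal (tilt (decay m * u) 0 / u) \<partial>lborel)"
    by (rule nn_integral_cmult) measurable
  also have "(\<integral>\<^sup>+u\<in>{a<..k}. ennreal (tilt (decay m * u) 0 / u) \<partial>lborel) = tilt_integral (decay m * a) (decay m * k) 0"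
    by (rule tilt_integral_scale) simp
  finally show ?thesis .
qed

text \<open>The point is a bound independent of \<open>a\<close>. Truncated deficit and tilt
  integral together are at most the tilt integral at 0 plus a multiple of
  \<open>exp (k * y)\<close>. In expectation the tilt integral becomes the one at 0 over the range
  shifted towards 0; cancelling it leaves at most the piece \<open>(decay m * k, k]\<close>.\<close>

lemma innovation_deficit_truncated:
  assumes a: "0 < a" "a \<le> k" "k < K" and A: "A \<in> sets (past (dyadic m i))" and C: "C \<ge> 0" "\<And>u. 0 \<le> u \<Longrightarrow> u < K \<Longrightarrow> exp (- phi u) \<le> C"
  shows "(\<integral>\<^sup>+\<omega>. indicator A \<omega> * (\<integral>\<^sup>+u\<in>{a<..k}. ennreal ((1 - exp (- (u * max 0 (- innovation m i \<omega>)))) * exp (- phi u) / u) \<partial>lborel) \<partial>M)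
    \<le> (tilt_integral (decay m * k) k 0 + ennreal C * ennreal (exp (phi k - phi (decay m * k)))) * emeasure M A"
proof -
  have Am [measurable]: "A \<in> sets M" using A sets_past_subset by auto
  have k0: "0 < k" using a by simp
  let ?v = "\<lambda>y. \<integral>\<^sup>+u\<in>{a<..k}. ennreal ((1 - exp (- (u * max 0 (- y)))) * exp (- phi u) / u) \<partial>lborel"
  have pw: "?v y + tilt_integral a k y \<le> tilt_integral a k 0 + ennreal C * ennreal (exp (k * y))" for y
  proof -
    have "?v y + tilt_integral a k y = (\<integral>\<^sup>+u. ennreal ((1 - exp (- (u * max 0 (- y)))) * exp (- phi u) / u) * indicator {a<..k} u + ennreal (tilt u y / u) * indicator {a<..k} u \<partial>lborel)"
      unfolding tilt_integral_def by (rule nn_integral_add[symmetric]) measurable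
    also have "\<dots> \<le> (\<integral>\<^sup>+u. ennreal (tilt u 0 / u) * indicator {a<..k} u + ennreal (C / k * exp (k * y)) * indicator {a<..k} u \<partial>lborel)"
    proof (rule nn_integral_mono)
      fix u
      show "ennreal ((1 - exp (- (u * max 0 (- y)))) * exp (- phi u) / u) * indicator {a<..k} u + ennreal (tilt u y / u) * indicator {a<..k} u
        \<le> ennreal (tilt u 0 / u) * indicator {a<..k} u + ennreal (C / k * exp (k * y)) * indicator {a<..k} u"
      proof (cases "u \<in> {a<..k}")
        case True
        then have u: "0 < u" "u \<le> k" "u < K" using a by auto
        let ?E = "exp (- phi u)"
        have "((1 - exp (- (u * max 0 (- y)))) + exp (u * y)) * ?E \<le> (1 + u / k * exp (k * y)) * ?E"
          using exp_convex_bound[of u k y] u k0 by (intro mult_right_mono) auto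
        also have "\<dots> = ?E + u / k * exp (k * y) * ?E" by (simp add: distrib_right)
        also have "\<dots> \<le> ?E + u / k * exp (k * y) * C"
          using C(2)[of u] u k0 by (intro add_left_mono mult_left_mono) auto
        finally have "(((1 - exp (- (u * max 0 (- y)))) + exp (u * y)) * ?E) / u \<le> (?E + u / k * exp (k * y) * C) / u"
          using u by (intro divide_right_mono) auto
        then have "(1 - exp (- (u * max 0 (- y)))) * ?E / u + tilt u y / u \<le> tilt u 0 / u + C / k * exp (k * y)"
        proof -
          have 1: "tilt u y = exp (u * y) * ?E" "tilt u 0 = ?E" by (simp_all add: tilt_def exp_add[symmetric])
          assume h: "(((1 - exp (- (u * max 0 (- y)))) + exp (u * y)) * ?E) / u \<le> (?E + u / k * exp (k * y) * C) / u"
          have "(?E + u / k * exp (k * y) * C) / u = ?E / u + C / k * exp (k * y)"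
            using u by (simp add: add_divide_distrib)
          with h show ?thesis unfolding 1 by (simp only: distrib_right add_divide_distrib)
        qed
        moreover have "0 \<le> (1 - exp (- (u * max 0 (- y)))) * ?E / u" using u by (intro divide_nonneg_pos mult_nonneg_nonneg) auto
        ultimately have "ennreal ((1 - exp (- (u * max 0 (- y)))) * ?E / u) + ennreal (tilt u y / u) \<le> ennreal (tilt u 0 / u) + ennreal (C / k * exp (k * y))"
          using u k0 C(1) by (intro ennreal_plus_le_plus) auto
        then show ?thesis using True by simp
      qed simp
    qed
    also have "\<dots> = tilt_integral a k 0 + (\<integral>\<^sup>+u. ennreal (C / k * exp (k * y)) * indicator {a<..k} u \<partial>lborel)"
      unfolding tilt_integral_def by (rule nn_integral_add) measurable
    also have "(\<integral>\<^sup>+u. ennreal (C / k * exp (k * y)) * indicator {a<..k} u \<partial>lborel) = ennreal (C / k * exp (k * y)) * ennreal (k - a)"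
      using a by (subst nn_integral_cmult_indicator) auto
    also have "\<dots> \<le> ennreal (C / k * exp (k * y)) * ennreal k" using a by (intro mult_left_mono ennreal_leI) auto
    also have "\<dots> = ennreal C * ennreal (exp (k * y))" using k0 C(1) by (simp add: ennreal_mult[symmetric])
    finally show ?thesis by (simp add: add_left_mono)
  qed
  let ?F = "tilt_integral (decay m * a) (decay m * k) 0"
  have rk: "0 < decay m * k" "decay m * k < K" using decay_mult[OF k0 a(3)] by auto
  have ra: "0 < decay m * a" "decay m * a \<le> decay m * k" using a by (auto simp: mult_left_mono less_imp_le)
  have r1: "decay m * a \<le> a" "decay m * k \<le> k"
    using mult_right_mono[OF decay_le_1[of m], of a] mult_right_mono[OF decay_le_1[of m], of k] a by simp_all
  have Fin: "?F < \<infinity>" by (rule tilt_integral_finite[OF ra rk(2)])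
  have Fle: "tilt_integral a k 0 \<le> ?F + tilt_integral (decay m * k) k 0"
    using tilt_integral_add[OF r1(1) a(2), of 0] tilt_integral_add[OF ra(2) r1(2), of 0] by (metis add_increasing zero_le order_refl)
  have "(\<integral>\<^sup>+\<omega>. indicator A \<omega> * ?v (innovation m i \<omega>) \<partial>M) + emeasure M A * ?F
     = (\<integral>\<^sup>+\<omega>. indicator A \<omega> * ?v (innovation m i \<omega>) + indicator A \<omega> * tilt_integral a k (innovation m i \<omega>) \<partial>M)"
    unfolding innovation_tilt_integral[OF a A, symmetric] by (rule nn_integral_add[symmetric]) measurable
  also have "\<dots> \<le> (\<integral>\<^sup>+\<omega>. indicator A \<omega> * tilt_integral a k 0 + ennreal C * (indicator A \<omega> * ennreal (exp (k * innovation m i \<omega>))) \<partial>M)"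
    using pw by (intro nn_integral_mono) (simp split: split_indicator)
  also have "\<dots> = (\<integral>\<^sup>+\<omega>. indicator A \<omega> * tilt_integral a k 0 \<partial>M) + (\<integral>\<^sup>+\<omega>. ennreal C * (indicator A \<omega> * ennreal (exp (k * innovation m i \<omega>))) \<partial>M)"
    by (rule nn_integral_add) measurable
  also have "\<dots> = emeasure M A * tilt_integral a k 0 + ennreal C * (emeasure M A * ennreal (exp (phi k - phi (decay m * k))))"
    by (simp add: nn_integral_multc nn_integral_cmult innovation_past_sets[OF k0 a(3) A])
  also have "\<dots> \<le> emeasure M A * (?F + tilt_integral (decay m * k) k 0) + ennreal C * (emeasure M A * ennreal (exp (phi k - phi (decay m * k))))"
    using Fle by (intro add_right_mono mult_left_mono) auto
  also have "\<dots> = (tilt_integral (decay m * k) k 0 + ennreal C * ennreal (exp (phi k - phi (decay m * k)))) * emeasure M A + emeasure M A * ?F"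
    by (simp add: distrib_left distrib_right ac_simps)
  finally have "emeasure M A * ?F + (\<integral>\<^sup>+\<omega>. indicator A \<omega> * ?v (innovation m i \<omega>) \<partial>M) \<le> emeasure M A * ?F + (tilt_integral (decay m * k) k 0 + ennreal C * ennreal (exp (phi k - phi (decay m * k)))) * emeasure M A"
    by (simp only: ac_simps)
  moreover have "emeasure M A * ?F \<noteq> top" using Fin by (simp add: ennreal_mult_eq_top_iff emeasure_eq_measure)
  ultimately show ?thesis by (simp add: ennreal_add_left_cancel_le)
qed

text \<open>One constant for all steps and all past events is what a Wald argument needs. Exponents
  above \<open>k = K / 2\<close> contribute at most a constant, since the weight is bounded there;
  those below are the limit of the truncated estimate.\<close>

lemma innovation_deficit_bound: obtains C where "C < \<infinity>" "\<And>i A. A \<in> sets (past (dyadic m i)) \<Longrightarrow> (\<integral>\<^sup>+\<omega>. indicator A \<omega> * deficit (innovation m i \<omega>) \<partial>M) \<le> C * emeasure M A"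
proof -
  obtain C where C: "C \<ge> 0" "\<And>u. 0 \<le> u \<Longrightarrow> u < K \<Longrightarrow> exp (- phi u) \<le> C" using phi_bounded_below by blast
  define k where "k = K / 2"
  have k: "0 < k" "k < K" using K_pos by (auto simp: k_def)
  define C1 where "C1 = tilt_integral (decay m * k) k 0 + ennreal C * ennreal (exp (phi k - phi (decay m * k)))"
  define C2 where "C2 = ennreal (C / k) * ennreal K"
  have C1: "C1 < \<infinity>" unfolding C1_def
    using tilt_integral_finite[of "decay m * k" k 0] k mult_right_mono[OF decay_le_1[of m], of k] by (simp add: ennreal_mult_less_top)
  have C2: "C2 < \<infinity>" unfolding C2_def by (simp add: ennreal_mult_less_top)
  let ?w = "\<lambda>u y. ennreal ((1 - exp (- (u * max 0 (- y)))) * exp (- phi u) / u)"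
  show ?thesis
  proof (rule that[of "C1 + C2"])
    show "C1 + C2 < \<infinity>" using C1 C2 by simp
    fix i A assume A: "A \<in> sets (past (dyadic m i))"
    have Am [measurable]: "A \<in> sets M" using A sets_past_subset by auto
    have split: "deficit y \<le> (\<integral>\<^sup>+u\<in>{0<..<K}. ?w u y * indicator {..k} u \<partial>lborel) + C2" for y
    proof -
      have "deficit y \<le> (\<integral>\<^sup>+u. (?w u y * indicator {..k} u) * indicator {0<..<K} u + ennreal (C / k) * indicator {0<..<K} u \<partial>lborel)"
        unfolding deficit_def
      proof (rule nn_integral_mono)
        fix u
        show "?w u y * indicator {0<..<K} u \<le> (?w u y * indicator {..k} u) * indicator {0<..<K} u + ennreal (C / k) * indicator {0<..<K} u"
        proof (cases "u \<in> {0<..<K} \<and> k < u")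
          case True
          then have u: "0 < u" "u < K" "k < u" by auto
          have "(1 - exp (- (u * max 0 (- y)))) * exp (- phi u) \<le> 1 * C"
            using C u by (intro mult_mono) auto
          then have "(1 - exp (- (u * max 0 (- y)))) * exp (- phi u) / u \<le> C / u" using u by (simp add: divide_right_mono)
          also have "\<dots> \<le> C / k" using u k C by (intro divide_left_mono) auto
          finally show ?thesis using u by (simp add: ennreal_leI)
        qed (auto simp: indicator_def)
      qed
      also have "\<dots> = (\<integral>\<^sup>+u\<in>{0<..<K}. ?w u y * indicator {..k} u \<partial>lborel) + (\<integral>\<^sup>+u. ennreal (C / k) * indicator {0<..<K} u \<partial>lborel)"
        by (rule nn_integral_add) measurable
      also have "(\<integral>\<^sup>+u. ennreal (C / k) * indicator {0<..<K} u \<partial>lborel) = C2"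
        unfolding C2_def using K_pos by (subst nn_integral_cmult_indicator) auto
      finally show ?thesis .
    qed
    have lim: "(\<lambda>n. \<integral>\<^sup>+\<omega>. indicator A \<omega> * (\<integral>\<^sup>+u\<in>{epsn n<..kapn n}. ?w u (innovation m i \<omega>) * indicator {..k} u \<partial>lborel) \<partial>M)
       \<longlonglongrightarrow> (\<integral>\<^sup>+\<omega>. indicator A \<omega> * (\<integral>\<^sup>+u\<in>{0<..<K}. ?w u (innovation m i \<omega>) * indicator {..k} u \<partial>lborel) \<partial>M)"
      by (rule truncated_tendsto[where f="\<lambda>u y. ?w u y * indicator {..k} u"]) measurable
    have le: "(\<integral>\<^sup>+\<omega>. indicator A \<omega> * (\<integral>\<^sup>+u\<in>{epsn n<..kapn n}. ?w u (innovation m i \<omega>) * indicator {..k} u \<partial>lborel) \<partial>M) \<le> C1 * emeasure M A" for n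
    proof -
      have kn: "epsn n \<le> k" "k \<le> kapn n" using K_pos by (auto simp: epsn_def kapn_def k_def field_simps)
      have "(\<integral>\<^sup>+u\<in>{epsn n<..kapn n}. ?w u y * indicator {..k} u \<partial>lborel) = (\<integral>\<^sup>+u\<in>{epsn n<..k}. ?w u y \<partial>lborel)" for y
        by (rule nn_integral_cong) (use kn in \<open>auto simp: indicator_def\<close>)
      then show ?thesis unfolding C1_def using innovation_deficit_truncated[OF epsn_kapn(1) kn(1) k(2) A C] by simp
    qed
    have "(\<integral>\<^sup>+\<omega>. indicator A \<omega> * deficit (innovation m i \<omega>) \<partial>M) \<le> (\<integral>\<^sup>+\<omega>. indicator A \<omega> * (\<integral>\<^sup>+u\<in>{0<..<K}. ?w u (innovation m i \<omega>) * indicator {..k} u \<partial>lborel) + C2 * indicator A \<omega> \<partial>M)"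
      using split by (intro nn_integral_mono) (simp split: split_indicator)
    also have "\<dots> = (\<integral>\<^sup>+\<omega>. indicator A \<omega> * (\<integral>\<^sup>+u\<in>{0<..<K}. ?w u (innovation m i \<omega>) * indicator {..k} u \<partial>lborel) \<partial>M) + C2 * emeasure M A"
      by (subst nn_integral_add) (simp_all add: nn_integral_cmult)
    also have "\<dots> \<le> C1 * emeasure M A + C2 * emeasure M A"
      by (intro add_right_mono LIMSEQ_le_const2[OF lim]) (use le in blast)
    finally show "(\<integral>\<^sup>+\<omega>. indicator A \<omega> * deficit (innovation m i \<omega>) \<partial>M) \<le> (C1 + C2) * emeasure M A" by (simp add: distrib_right)
  qed
qed

end

section \<open>The expected hitting time\<close>

context levy_ou
begin

lemma loss_eq_0: "x \<le> y \<Longrightarrow> loss y = 0"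
  unfolding loss_def
  by (rule nn_integral_0_iff_AE[THEN iffD2], measurable)
     (auto intro!: AE_I2 simp: indicator_def ennreal_eq_0_iff divide_le_0_iff mult_le_0_iff)

lemma deficit_X_le: "\<omega> \<in> space M \<Longrightarrow> deficit (X (dyadic m N) \<omega>) \<le> deficit x + (\<Sum>i<N. deficit (innovation m i \<omega>))"
proof (induction N)
  case 0 then show ?case by (simp add: X_0)
next
  case (Suc N)
  have "deficit (X (dyadic m (Suc N)) \<omega>) \<le> deficit (X (dyadic m N) \<omega>) + deficit (innovation m N \<omega>)"
    unfolding X_step by (rule deficit_subadditive) (simp_all add: less_imp_le)
  also have "\<dots> \<le> (deficit x + (\<Sum>i<N. deficit (innovation m i \<omega>))) + deficit (innovation m N \<omega>)" using Suc by (intro add_right_mono) auto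
  finally show ?case by (simp add: add.assoc)
qed

lemma first_reach_le_hit_time: "ennreal (first_reach b N \<omega>) \<le> hit_time X b \<omega>"
  unfolding hit_time_def
proof (rule Inf_greatest)
  fix r assume "r \<in> {ennreal t | t. t > 0 \<and> X t \<omega> \<ge> b}"
  then obtain t where t: "r = ennreal t" "t > 0" "b \<le> X t \<omega>" by auto
  then have "first_reach b N \<omega> \<le> t" by (intro first_reach_le reachI) auto
  then show "ennreal (first_reach b N \<omega>) \<le> r" using t by (simp add: ennreal_leI)
qed

lemma hit_time_eq_first_reach:
  assumes w: "\<omega> \<in> space M" and bx: "x < b" and r: "reach b (real N) \<omega>" and good: "reach b (first_reach b N \<omega>) \<omega> \<longrightarrow> b \<le> X (first_reach b N \<omega>) \<omega>"
  shows "hit_time X b \<omega> = ennreal (first_reach b N \<omega>)" "b \<le> X (first_reach b N \<omega>) \<omega>"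
proof -
  show le: "b \<le> X (first_reach b N \<omega>) \<omega>" using good reach_first_reach[OF w r] by blast
  \<comment> \<open>\<open>hit_time\<close> admits positive times only; the strict inequality
    \<open>x < b\<close> rules out the time 0.\<close>
  have "first_reach b N \<omega> \<noteq> 0" using le X_0[OF w] bx by auto
  then have "0 < first_reach b N \<omega>" using first_reach_range(1)[of b N \<omega>] by simp
  with le have "hit_time X b \<omega> \<le> ennreal (first_reach b N \<omega>)" unfolding hit_time_def by (intro Inf_lower) auto
  then show "hit_time X b \<omega> = ennreal (first_reach b N \<omega>)" using first_reach_le_hit_time by (rule antisym)
qed

lemma hit_time_infinite: assumes "\<And>N. \<not> reach b (real N) \<omega>" shows "hit_time X b \<omega> = \<infinity>"
proof -
  have False if t: "t > 0" "b \<le> X t \<omega>" for t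
  proof -
    obtain N where "t \<le> real N" using real_arch_simple by blast
    then show False using reach_mono[OF reachI[of t b \<omega>], of "real N"] t assms by auto
  qed
  then have empty: "{ennreal t | t. t > 0 \<and> X t \<omega> \<ge> b} = {}" by blast
  show ?thesis unfolding hit_time_def empty by simp
qed

text \<open>If \<open>b\<close> is not reached by \<open>Suc n\<close>, the truncated time is
  \<open>Suc n\<close> itself and has grown by at least 1; the 1 on the right accounts for the index
  0. In expectation this bounds the sum of the probabilities of not having reached the level by an
  expected time.\<close>

lemma sum_not_reach_le:
  assumes w: "\<omega> \<in> space M"
  shows "(\<Sum>i<Suc n. indicator {\<omega>. \<not> reach b (real i) \<omega>} \<omega>) \<le> 1 + first_reach b n \<omega>"
proof (induction n)
  case 0 then show ?case using first_reach_range(1)[of b 0 \<omega>] by (simp add: indicator_def)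
next
  case (Suc n)
  show ?case
  proof (cases "reach b (real (Suc n)) \<omega>")
    case True
    then show ?thesis using Suc.IH first_reach_mono_time[of n "Suc n" b \<omega>] by simp
  next
    case False
    then have "first_reach b (Suc n) \<omega> = real (Suc n)" by (rule first_reach_not_reach[OF w])
    then show ?thesis using Suc.IH first_reach_range(2)[of b n \<omega>] False by simp
  qed
qed

theorem hitting_time_identity:
  assumes bx: "x < b"
  shows "ennreal \<beta> * (\<integral>\<^sup>+\<omega>. hit_time X b \<omega> \<partial>M) = 
    (\<integral>\<^sup>+\<omega>. (if hit_time X b \<omega> = \<infinity> then \<infinity> else gain (X (enn2real (hit_time X b \<omega>)) \<omega>)) \<partial>M)"
proof -
  define H where "H \<omega> = (if hit_time X b \<omega> = \<infinity> then \<infinity> else gain (X (enn2real (hit_time X b \<omega>)) \<omega>))" for \<omega>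
  define Q where "Q N = {\<omega>\<in>space M. \<not> reach b (real N) \<omega>}" for N
  have Q [measurable]: "Q N \<in> sets M" for N
  proof -
    have "Q N = space M - {\<omega>\<in>space M. reach b (real N) \<omega>}" by (auto simp: Q_def)
    then show ?thesis by auto
  qed
  have QFil: "Q N \<in> sets (past (dyadic 0 N))" for N
  proof -
    have "Q N = space (past (dyadic 0 N)) - {\<omega>\<in>space M. reach b (dyadic 0 N) \<omega>}" by (auto simp: Q_def dyadic_def)
    also have "\<dots> \<in> sets (past (dyadic 0 N))" by (rule sets.compl_sets[OF reach_past])
    finally show ?thesis .
  qed
  have Qdec: "decseq Q" unfolding Q_def decseq_def by (auto intro: reach_mono)
  define never where "never = (\<Inter>N. Q N)"
  have never [measurable]: "never \<in> sets M" unfolding never_def by measurable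
  have st: "stopping b N (first_reach b N)" for N by (rule stopping_first_reach) simp
  note [measurable] = X_stopping_measurable[OF st] stopping_measurable[OF st]
  have good: "AE \<omega> in M. \<forall>N. reach b (first_reach b N \<omega>) \<omega> \<longrightarrow> b \<le> X (first_reach b N \<omega>) \<omega>"
    unfolding AE_all_countable using reach_level_AE by blast
  have Hinf: "hit_time X b \<omega> = \<infinity>" if "\<omega> \<in> never" for \<omega>
    using that by (intro hit_time_infinite) (auto simp: never_def Q_def)
  show ?thesis
  proof (cases "emeasure M never = 0")
    \<comment> \<open>On \<open>never\<close> the integrands on both sides are infinite, so a
      positive probability settles the identity at once.\<close>
    case False
    have inf: "(\<integral>\<^sup>+\<omega>. \<infinity> * indicator never \<omega> \<partial>M) = \<infinity>"
      using False by (subst nn_integral_cmult_indicator) (auto simp: ennreal_top_mult)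
    have "(\<integral>\<^sup>+\<omega>. \<infinity> * indicator never \<omega> \<partial>M) \<le> (\<integral>\<^sup>+\<omega>. hit_time X b \<omega> \<partial>M)"
      by (rule nn_integral_mono) (auto simp: indicator_def Hinf)
    moreover have "(\<integral>\<^sup>+\<omega>. \<infinity> * indicator never \<omega> \<partial>M) \<le> (\<integral>\<^sup>+\<omega>. H \<omega> \<partial>M)"
      by (rule nn_integral_mono) (auto simp: indicator_def Hinf H_def)
    ultimately show ?thesis unfolding inf using beta_pos by (simp add: H_def[abs_def] top_unique ennreal_mult_top)
  next
    case True
    have hit: "AE \<omega> in M. \<exists>N. reach b (real N) \<omega>"
      by (rule AE_I[OF _ True never]) (auto simp: never_def Q_def)
    \<comment> \<open>\<open>A N\<close> collects the gain of the paths that have reached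
      \<open>b\<close> by time \<open>N\<close> and increases to the right-hand side.
      \<open>W N\<close> is the loss of the paths that have not, and has to vanish in the
      limit.\<close>
    define A where "A N = (\<integral>\<^sup>+\<omega>. indicator (space M - Q N) \<omega> * gain (X (first_reach b N \<omega>) \<omega>) \<partial>M)" for N
    define W where "W N = (\<integral>\<^sup>+\<omega>. indicator (Q N) \<omega> * loss (X (dyadic 0 N) \<omega>) \<partial>M)" for N
    let ?S = "\<integral>\<^sup>+\<omega>. hit_time X b \<omega> \<partial>M" and ?H = "\<integral>\<^sup>+\<omega>. H \<omega> \<partial>M"
    let ?s = "\<lambda>N. \<integral>\<^sup>+\<omega>. ennreal (first_reach b N \<omega>) \<partial>M"
    have S: "?s \<longlonglongrightarrow> ?S"
    proof -
      have inc: "incseq (\<lambda>N \<omega>. ennreal (first_reach b N \<omega>))"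
        unfolding incseq_def le_fun_def by (auto intro!: ennreal_leI first_reach_mono_time)
      have "AE \<omega> in M. hit_time X b \<omega> = (SUP N. ennreal (first_reach b N \<omega>))"
        using good hit
      proof (rule AE_mp[OF _ AE_mp], intro AE_I2 impI)
        fix \<omega> assume w: "\<omega> \<in> space M" and "\<exists>N. reach b (real N) \<omega>" and g: "\<forall>N. reach b (first_reach b N \<omega>) \<omega> \<longrightarrow> b \<le> X (first_reach b N \<omega>) \<omega>"
        then obtain N where "reach b (real N) \<omega>" by blast
        from hit_time_eq_first_reach(1)[OF w bx this g[rule_format, THEN impI]] have "hit_time X b \<omega> \<le> (SUP N. ennreal (first_reach b N \<omega>))"
          by (intro SUP_upper2[of N]) auto
        then show "hit_time X b \<omega> = (SUP N. ennreal (first_reach b N \<omega>))"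
          by (rule antisym) (rule SUP_least, rule first_reach_le_hit_time)
      qed
      then have "?S = (\<integral>\<^sup>+\<omega>. (SUP N. ennreal (first_reach b N \<omega>)) \<partial>M)" by (rule nn_integral_cong_AE)
      also have "\<dots> = (SUP N. ?s N)" by (rule nn_integral_monotone_convergence_SUP[OF inc]) measurable
      finally have "?S = (SUP N. ?s N)" .
      moreover have "incseq ?s" unfolding incseq_def by (intro allI impI nn_integral_mono ennreal_leI first_reach_mono_time)
      ultimately show ?thesis using LIMSEQ_SUP by simp
    qed
    have AH: "A \<longlonglongrightarrow> ?H"
    proof -
      let ?f = "\<lambda>N \<omega>. indicator (space M - Q N) \<omega> * gain (X (first_reach b N \<omega>) \<omega>)"
      have mono: "?f N \<omega> \<le> ?f N' \<omega>" if "N \<le> N'" for N N' \<omega>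
      proof (cases "\<omega> \<in> space M - Q N")
        case in_R: True
        then have r: "reach b (real N) \<omega>" by (auto simp: Q_def)
        have "reach b (real N') \<omega>" using reach_mono[OF r] that by simp
        then show ?thesis using in_R first_reach_stable[OF r that] by (simp add: Q_def)
      qed simp
      have inc: "incseq ?f" unfolding incseq_def le_fun_def using mono by blast
      have "AE \<omega> in M. H \<omega> = (SUP N. ?f N \<omega>)"
        using good hit
      proof (rule AE_mp[OF _ AE_mp], intro AE_I2 impI)
        fix \<omega> assume w: "\<omega> \<in> space M" and "\<exists>N. reach b (real N) \<omega>" and g: "\<forall>N. reach b (first_reach b N \<omega>) \<omega> \<longrightarrow> b \<le> X (first_reach b N \<omega>) \<omega>"
        then obtain N0 where N0: "reach b (real N0) \<omega>" by blast
        have eq: "H \<omega> = gain (X (first_reach b N \<omega>) \<omega>)" if "reach b (real N) \<omega>" for N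
          using hit_time_eq_first_reach(1)[OF w bx that g[rule_format, THEN impI]] first_reach_range(1)[of b N \<omega>] by (simp add: H_def)
        show "H \<omega> = (SUP N. ?f N \<omega>)"
        proof (rule antisym)
          show "H \<omega> \<le> (SUP N. ?f N \<omega>)" using N0 w eq[OF N0] by (intro SUP_upper2[of N0]) (auto simp: Q_def)
          show "(SUP N. ?f N \<omega>) \<le> H \<omega>"
            by (rule SUP_least) (use eq in \<open>auto simp: Q_def indicator_def\<close>)
        qed
      qed
      then have "?H = (\<integral>\<^sup>+\<omega>. (SUP N. ?f N \<omega>) \<partial>M)" by (rule nn_integral_cong_AE)
      also have "\<dots> = (SUP N. A N)" unfolding A_def by (rule nn_integral_monotone_convergence_SUP[OF inc]) measurable
      finally have "?H = (SUP N. A N)" .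
      moreover have "incseq A" unfolding incseq_def A_def using mono by (intro allI impI nn_integral_mono)
      ultimately show ?thesis using LIMSEQ_SUP by simp
    qed
    have P0: "(\<lambda>N. emeasure M (Q N)) \<longlonglongrightarrow> 0"
    proof -
      have "range Q \<subseteq> sets M" using Q by auto
      from Lim_emeasure_decseq[OF this Qdec] have "(\<lambda>N. emeasure M (Q N)) \<longlonglongrightarrow> emeasure M never"
        unfolding never_def by simp
      then show ?thesis unfolding True .
    qed
    \<comment> \<open>Paths that have not reached \<open>b\<close> by time \<open>N\<close> are
      below \<open>b\<close> at that time, so their gain is at most the finite number
      \<open>gain b\<close>.\<close>
    have I1: "(\<integral>\<^sup>+\<omega>. gain (X (first_reach b N \<omega>) \<omega>) \<partial>M) \<le> A N + gain b * emeasure M (Q N)" for N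
    proof -
      have "(\<integral>\<^sup>+\<omega>. gain (X (first_reach b N \<omega>) \<omega>) \<partial>M) \<le> (\<integral>\<^sup>+\<omega>. indicator (space M - Q N) \<omega> * gain (X (first_reach b N \<omega>) \<omega>) + gain b * indicator (Q N) \<omega> \<partial>M)"
      proof (rule nn_integral_mono)
        fix \<omega> assume w: "\<omega> \<in> space M"
        show "gain (X (first_reach b N \<omega>) \<omega>) \<le> indicator (space M - Q N) \<omega> * gain (X (first_reach b N \<omega>) \<omega>) + gain b * indicator (Q N) \<omega>"
        proof (cases "\<omega> \<in> Q N")
          case in_Q: True
          then have nr: "\<not> reach b (real N) \<omega>" by (auto simp: Q_def)
          have "X (first_reach b N \<omega>) \<omega> < b" unfolding first_reach_not_reach[OF w nr] by (rule not_reach_less[OF nr]) auto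
          then show ?thesis using in_Q gain_mono[of "X (first_reach b N \<omega>) \<omega>" b] by simp
        qed (use w in simp)
      qed
      also have "\<dots> = A N + gain b * emeasure M (Q N)" unfolding A_def
        by (subst nn_integral_add) (simp_all add: nn_integral_cmult)
      finally show ?thesis .
    qed
    have I1': "A N \<le> (\<integral>\<^sup>+\<omega>. gain (X (first_reach b N \<omega>) \<omega>) \<partial>M)" for N
      unfolding A_def by (intro nn_integral_mono) (simp split: split_indicator)
    \<comment> \<open>Once \<open>b\<close> is reached, the position is at least
      \<open>b > x\<close> and the loss is 0; only paths stopped at the horizon \<open>N\<close>
      contribute.\<close>
    have I2: "(\<integral>\<^sup>+\<omega>. loss (X (first_reach b N \<omega>) \<omega>) \<partial>M) \<le> W N" for N
      unfolding W_def
    proof (rule nn_integral_mono_AE, rule AE_mp[OF good], intro AE_I2 impI)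
      fix \<omega> assume w: "\<omega> \<in> space M" and g: "\<forall>N. reach b (first_reach b N \<omega>) \<omega> \<longrightarrow> b \<le> X (first_reach b N \<omega>) \<omega>"
      show "loss (X (first_reach b N \<omega>) \<omega>) \<le> indicator (Q N) \<omega> * loss (X (dyadic 0 N) \<omega>)"
      proof (cases "reach b (real N) \<omega>")
        case r: True
        then have "b \<le> X (first_reach b N \<omega>) \<omega>" using g reach_first_reach[OF w r] by blast
        then show ?thesis using bx by (simp add: loss_eq_0)
      next
        case False
        then show ?thesis using first_reach_not_reach[OF w False] w by (simp add: Q_def dyadic_def)
      qed
    qed
    note id = stopping_identity[OF st]
    have grid_index: "ennreal \<beta> * ?S \<le> ?H"
    proof -
      have "(\<lambda>N. A N + gain b * emeasure M (Q N)) \<longlonglongrightarrow> ?H + gain b * 0"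
        using gain_finite[of b] bx by (intro tendsto_add AH ennreal_tendsto_cmult P0) auto
      moreover have "(\<lambda>N. ennreal \<beta> * ?s N) \<longlonglongrightarrow> ennreal \<beta> * ?S" by (intro ennreal_tendsto_cmult S) simp
      moreover have "ennreal \<beta> * ?s N \<le> A N + gain b * emeasure M (Q N)" for N
        using I1[of N] unfolding id by (rule order_trans[rotated]) simp
      ultimately show ?thesis using LIMSEQ_le by fastforce
    qed
    have "?H \<le> ennreal \<beta> * ?S"
    proof (cases "?S = \<infinity>")
      case True then show ?thesis using beta_pos by (simp add: ennreal_mult_top)
    next
      case Sfin: False
      obtain c0 where c0: "c0 < \<infinity>" "\<And>y. loss y \<le> c0 + deficit y" using loss_le by blast
      obtain C where C: "C < \<infinity>" "\<And>i A. A \<in> sets (past (dyadic 0 i)) \<Longrightarrow> (\<integral>\<^sup>+\<omega>. indicator A \<omega> * deficit (innovation 0 i \<omega>) \<partial>M) \<le> C * emeasure M A"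
        using innovation_deficit_bound[of 0] by blast
      \<comment> \<open>A majorant of the loss on \<open>Q N\<close> for all \<open>N\<close> at
        once. On \<open>Q N\<close> every earlier \<open>Q i\<close> holds, so each innovation may
        carry the indicator of \<open>Q i\<close>, an event of its past. Then \<open>E D\<close> is
        at most a constant plus \<open>C\<close> times the sum of the probabilities of
        \<open>Q i\<close>, which is finite when the expected hitting time is.\<close>
      define D where "D \<omega> = (c0 + deficit x) + (\<Sum>i. indicator (Q i) \<omega> * deficit (innovation 0 i \<omega>))" for \<omega>
      have W0: "W \<longlonglongrightarrow> (\<integral>\<^sup>+\<omega>. 0 \<partial>M)"
        unfolding W_def
      proof (rule nn_integral_dominated_convergence[where w=D])
        show "AE \<omega> in M. indicator (Q N) \<omega> * loss (X (dyadic 0 N) \<omega>) \<le> D \<omega>" for N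
        proof (rule AE_I2)
          fix \<omega> assume w: "\<omega> \<in> space M"
          show "indicator (Q N) \<omega> * loss (X (dyadic 0 N) \<omega>) \<le> D \<omega>"
          proof (cases "\<omega> \<in> Q N")
            case in_Q: True
            have "loss (X (dyadic 0 N) \<omega>) \<le> c0 + deficit (X (dyadic 0 N) \<omega>)" by (rule c0(2))
            also have "\<dots> \<le> c0 + (deficit x + (\<Sum>i<N. deficit (innovation 0 i \<omega>)))" by (intro add_left_mono deficit_X_le[OF w])
            also have "(\<Sum>i<N. deficit (innovation 0 i \<omega>)) = (\<Sum>i<N. indicator (Q i) \<omega> * deficit (innovation 0 i \<omega>))"
            proof (rule sum.cong[OF refl])
              fix i assume "i \<in> {..<N}"
              then have "\<omega> \<in> Q i" using decseqD[OF Qdec, of i N] in_Q by auto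
              then show "deficit (innovation 0 i \<omega>) = indicator (Q i) \<omega> * deficit (innovation 0 i \<omega>)" by simp
            qed
            also have "c0 + (deficit x + \<dots>) \<le> D \<omega>" unfolding D_def add.assoc
              by (intro add_left_mono sum_le_suminf) auto
            finally show ?thesis using in_Q by simp
          qed simp
        qed
        have "(\<integral>\<^sup>+\<omega>. D \<omega> \<partial>M) = (c0 + deficit x) + (\<Sum>i. \<integral>\<^sup>+\<omega>. indicator (Q i) \<omega> * deficit (innovation 0 i \<omega>) \<partial>M)"
          unfolding D_def by (subst nn_integral_add) (simp_all add: nn_integral_suminf emeasure_space_1)
        also have "\<dots> \<le> (c0 + deficit x) + (\<Sum>i. C * emeasure M (Q i))"
          by (intro add_left_mono suminf_le C(2) QFil) auto
        also have "(\<Sum>i. C * emeasure M (Q i)) = C * (\<Sum>i. \<integral>\<^sup>+\<omega>. indicator (Q i) \<omega> \<partial>M)" by simp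
        also have "(\<Sum>i. \<integral>\<^sup>+\<omega>. indicator (Q i) \<omega> \<partial>M) = (\<integral>\<^sup>+\<omega>. (\<Sum>i. indicator (Q i) \<omega>) \<partial>M)"
          by (rule nn_integral_suminf[symmetric]) measurable
        also have "\<dots> \<le> (\<integral>\<^sup>+\<omega>. 1 + (SUP n. ennreal (first_reach b n \<omega>)) \<partial>M)"
        proof (rule nn_integral_mono)
          fix \<omega> assume w: "\<omega> \<in> space M"
          have part: "(\<Sum>i<n. indicator (Q i) \<omega>) \<le> 1 + (SUP n. ennreal (first_reach b n \<omega>))" for n
          proof -
            have "(\<Sum>i<n. indicator (Q i) \<omega> :: ennreal) \<le> (\<Sum>i<Suc n. indicator (Q i) \<omega>)" by simp
            also have "\<dots> = (\<Sum>i<Suc n. ennreal (indicator {\<omega>. \<not> reach b (real i) \<omega>} \<omega>))"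
              using w by (intro sum.cong) (auto simp: Q_def indicator_def)
            also have "\<dots> = ennreal (\<Sum>i<Suc n. indicator {\<omega>. \<not> reach b (real i) \<omega>} \<omega>)"
              by (rule sum_ennreal) simp
            also have "\<dots> \<le> ennreal (1 + first_reach b n \<omega>)" by (rule ennreal_leI[OF sum_not_reach_le[OF w]])
            also have "\<dots> = 1 + ennreal (first_reach b n \<omega>)" using first_reach_range(1)[of b n \<omega>] by (simp add: ennreal_plus)
            also have "\<dots> \<le> 1 + (SUP n. ennreal (first_reach b n \<omega>))" by (intro add_left_mono SUP_upper) simp
            finally show ?thesis .
          qed
          show "(\<Sum>i. indicator (Q i) \<omega>) \<le> 1 + (SUP n. ennreal (first_reach b n \<omega>))"
            by (rule suminf_le_const) (use part in auto)
        qed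
        also have "\<dots> \<le> (\<integral>\<^sup>+\<omega>. 1 \<partial>M) + (\<integral>\<^sup>+\<omega>. (SUP n. ennreal (first_reach b n \<omega>)) \<partial>M)"
          by (subst nn_integral_add) auto
        also have "\<dots> \<le> 1 + ?S"
          by (intro add_mono nn_integral_mono SUP_least first_reach_le_hit_time) (simp add: emeasure_space_1)
        finally have "(\<integral>\<^sup>+\<omega>. D \<omega> \<partial>M) \<le> (c0 + deficit x) + C * (1 + ?S)" by (simp add: mult_left_mono add_left_mono)
        also have "\<dots> < \<infinity>" using c0(1) deficit_finite[of x] C(1) Sfin by (simp add: ennreal_mult_less_top less_top)
        finally show "(\<integral>\<^sup>+\<omega>. D \<omega> \<partial>M) < \<infinity>" .
        show "AE \<omega> in M. (\<lambda>N. indicator (Q N) \<omega> * loss (X (dyadic 0 N) \<omega>)) \<longlonglongrightarrow> 0"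
          using hit
        proof eventually_elim
          case (elim \<omega>)
          then obtain N0 where N0: "reach b (real N0) \<omega>" by blast
          have "eventually (\<lambda>N. indicator (Q N) \<omega> * loss (X (dyadic 0 N) \<omega>) = 0) sequentially"
            using eventually_ge_at_top[of N0]
          proof eventually_elim
            case (elim N)
            then have "reach b (real N) \<omega>" using reach_mono[OF N0] by simp
            then show ?case by (simp add: Q_def)
          qed
          then show ?case by (rule tendsto_eventually)
        qed
        show "D \<in> borel_measurable M" unfolding D_def by measurable
      qed measurable
      have "A N \<le> ennreal \<beta> * ?s N + W N" for N
        using I1'[of N] I2[of N] unfolding id by (meson add_left_mono order_trans)
      moreover have "(\<lambda>N. ennreal \<beta> * ?s N + W N) \<longlonglongrightarrow> ennreal \<beta> * ?S + (\<integral>\<^sup>+\<omega>. 0 \<partial>M)"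
        by (intro tendsto_add ennreal_tendsto_cmult S W0) simp
      ultimately have "?H \<le> ennreal \<beta> * ?S + (\<integral>\<^sup>+\<omega>. 0 \<partial>M)" using LIMSEQ_le[OF AH] by blast
      then show ?thesis by simp
    qed
    with grid_index have "ennreal \<beta> * ?S = ?H" by (rule antisym)
    then show ?thesis unfolding H_def .
  qed
qed

end

text \<open>The value infinity on the event that \<open>b\<close> is never reached is consistent: if
  that event has positive probability, both sides are infinite. Otherwise the position at the
  hitting time is almost surely at least \<open>b > x\<close>, so the inner integrand is nonnegative
  and \<open>ennreal\<close> cuts nothing off.\<close>

theorem theorem2:
  fixes M :: "'a measure" and L X :: "real \<Rightarrow> 'a \<Rightarrow> real"
    and \<beta> x b K :: real
  assumes levy: "levy_process M L"
    and pos_jumps: "levy_measure M L {0<..} > 0"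
    and logmom: "integrable M (\<lambda>\<omega>. ln (1 + \<bar>L 1 \<omega>\<bar>))"
    and beta_pos: "\<beta> > 0"
    and OU_int: "\<And>\<omega> t. \<omega> \<in> space M \<Longrightarrow> t \<ge> 0 \<Longrightarrow> (\<lambda>s. X s \<omega>) integrable_on {0..t}"
    and OU: "\<And>\<omega> t. \<omega> \<in> space M \<Longrightarrow> t \<ge> 0 \<Longrightarrow>
               X t \<omega> = x - \<beta> * integral {0..t} (\<lambda>s. X s \<omega>) + L t \<omega>"
    and bx: "b > x"
    and K_def: "ereal K = Sup (ereal ` {u. 0 \<le> u \<and> integrable M (\<lambda>\<omega>. exp (u * L 1 \<omega>))})"
    and K_pos: "K > 0"
    and phi_lim: "filterlim (ou_phi M L \<beta>) at_top (at_left K)"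
  shows "ennreal \<beta> * (\<integral>\<^sup>+ \<omega>. hit_time X b \<omega> \<partial>M) =
    (\<integral>\<^sup>+ \<omega>. (if hit_time X b \<omega> = \<infinity> then \<infinity> else
        \<integral>\<^sup>+ u \<in> {0<..<K}.
           ennreal ((exp (u * X (enn2real (hit_time X b \<omega>)) \<omega>) - exp (u * x))
                    * exp (- ou_phi M L \<beta> u) / u) \<partial>lborel) \<partial>M)"
proof -
  interpret levy_ou M L X \<beta> x K
    by unfold_locales (fact levy logmom beta_pos OU_int OU K_def K_pos phi_lim)+
  show ?thesis
    using hitting_time_identity[OF bx] unfolding gain_def .
qed

end
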